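(* Let $R$ be a commutative ring, let $A\to B$ be a homomorphism of DG $R$-algebras such that $B$ is projective as an underlying graded $A$-module, and let $J$ be the kernel of the multiplication map $\pi_B\colon B^e=B\otimes_A B\to B$. Let $\delta\colon B\to J$, $\delta(b)=b\otimes_A 1-1\otimes_A b$, be the universal derivation. For a semifree DG $B$-module $N$ the following are equivalent: (i) $N$ is naïvely liftable to $A$; (ii) there exists a $\delta$-connection $\psi\in{}^*\mathrm{Conn}(N,N\otimes_B J)$ such that $\partial^{\mathrm{Conn}}(\psi)=0$; (iii) the fundamental exact sequence $\mathcal{E}_N(J)$ splits as a sequence of DG $B$-modules; (iv) the fundamental exact sequence $\mathcal{E}_N(X)$ splits as a sequence of DG $B$-modules for all DG $B^e$-modules $X$; (v) $N$ admits a ${}^*\mathrm{Der}_A(B,J)$-connection; (vi) $N$ admits a ${}^*\mathrm{Der}_A(B,X)$-connection for all DG $B^e$-modules $X$.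
   Context: DG conventions. A DG $R$-algebra is a non-negatively graded $R$-algebra $A=\bigoplus_{n\ge 0}A_n$ with an $R$-linear differential $d^A$ of degree $-1$, $d^A\circ d^A=0$, such that for homogeneous $a,b$: $ab=(-1)^{|a||b|}ba$, $a^2=0$ if $|a|$ is odd, and $d^A(ab)=d^A(a)b+(-1)^{|a|}a\,d^A(b)$. A DG $A$-module is a graded right $A$-module $M=\bigoplus_{n\in\mathbb Z}M_n$ with a differential $\partial^M$ of degree $-1$, $\partial^M\circ\partial^M=0$, satisfying $\partial^M(ma)=\partial^M(m)a+(-1)^{|m|}m\,d^A(a)$; it is also a left module via $am=(-1)^{|a||m|}ma$. DG module homomorphisms are degree-preserving module homomorphisms commuting with differentials; $\mathcal C(A)$ is the category of DG $A$-modules. The shift is $M(n)_i=M_{i+n}$, $\partial^{M(n)}_i=(-1)^n\partial^M_{i+n}$. A graded map $M\to N(n)$ is regarded as a map $f\colon M\to N$ of degree $|f|=n$, and ${}^*\mathrm{Hom}_A(M,N)=\bigoplus_{n\in\mathbb Z}\mathrm{Hom}_{\mathsf{Gr}(A)}(M,N(n))$ (right $A$-linear maps), with $\partial^{\mathrm{Hom}}(f)=\partial^N\circ f-(-1)^{|f|}f\circ\partial^M$. A DG $B^e$-module $X$ is a $B$-bimodule via $bx=(-1)^{|b||x|}x(b\otimes 1)$ and $xb=x(1\otimes b)$. For a DG $B$-module $N$, $N\otimes_B X$ has right $B$-action $(n\otimes x)b=n\otimes xb$, left $B$-action $b(n\otimes x)=(bn)\otimes x=(-1)^{|b||n|}n\otimes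 bx$, and differential $\partial(n\otimes x)=\partial^N(n)\otimes x+(-1)^{|n|}n\otimes\partial^X(x)$. Semifree: a DG $B$-module $N$ is semifree if it is free as an underlying graded $B$-module with a homogeneous basis $\{e_\lambda\}_{\lambda\in\Lambda}$ indexed by a well-ordered set $\Lambda$ such that $\partial^N(e_\lambda)=\sum_{\mu<\lambda}e_\mu b_{\mu\lambda}$ (finite sum) with $b_{\mu\lambda}\in B$, for all $\lambda$. Naïve lifting: let $N|_A$ be $N$ regarded as a DG $A$-module via $A\to B$ and $\pi_N\colon N|_A\otimes_A B\to N$, $\pi_N(n\otimes_A b)=nb$. The DG $B$-module $N$ is naïvely liftable to $A$ if $\pi_N$ has a right inverse in $\mathcal C(B)$. Derivations: for a DG $B^e$-module $X$, an $A$-derivation of degree $n$ is $D\in\mathrm{Hom}_{\mathsf{Gr}(A)}(B,X(n))$ with $D(b_1b_2)=D(b_1)b_2+(-1)^{n|b_1|}b_1D(b_2)$ for homogeneous $b_1,b_2\in B$; these form $\mathrm{Der}_A(B,X)_n$. Put ${}^*\mathrm{Der}_A(B,X)=\bigoplus_n\mathrm{Der}_A(B,X)_n$, a left DG $B$-module via $(bD)(c)=bD(c)$ and $\partial^{\mathrm{Der}}(D)=\partial^X\circ D-(-1)^{|D|}D\circ d^B$. One has $\delta\in\mathrm{Der}_A(B,J)_0$. Connections: for homogeneous $D\in{}^*\mathrm{Der}_A(B,X)$, a $D$-connection on $N$ along $X$ is $\psi\in\mathrm{Hom}_{\mathsf{Gr}(A)}(N,N\otimes_B X(|D|))$ with $\psi(xb)=\psi(x)b+(-1)^{|D||x|}x\otimes_B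 D(b)$ for all $b\in B$ and homogeneous $x\in N$. $\mathrm{Conn}(N,N\otimes_B X)_n$ is the set of all $\psi$ that are $D$-connections for some $D\in\mathrm{Der}_A(B,X)_n$, and ${}^*\mathrm{Conn}(N,N\otimes_B X)=\bigoplus_n\mathrm{Conn}(N,N\otimes_B X)_n$, a left DG $B$-module via $(b\psi)(x)=b\psi(x)$ and $\partial^{\mathrm{Conn}}(\psi)=\partial^{N\otimes_B X}\circ\psi-(-1)^{|\psi|}\psi\circ\partial^N$ (if $\psi$ is a $D$-connection, this is a $\partial^{\mathrm{Der}}(D)$-connection). If $N$ is nonzero and free as an underlying graded $B$-module, then $D$ is uniquely determined by the $D$-connection $\psi$. Convention for $N=0$: for each $D$ the zero map is regarded as a $D$-connection $0_D$, with $0_D\ne 0_{D'}$ for $D\neq D'$, so that ${}^*\mathrm{Conn}(0,0\otimes_B X)\cong{}^*\mathrm{Der}_A(B,X)$. Fundamental exact sequence: for $N$ free as an underlying graded $B$-module, $\mathcal E_N(X)$ is the short exact sequence of left DG $B$-modules $$0\to{}^*\mathrm{Hom}_B(N,N\otimes_B X)\xrightarrow{\iota}{}^*\mathrm{Conn}(N,N\otimes_B X)\xrightarrow{\nu}{}^*\mathrm{Der}_A(B,X)\to 0,$$ where $\iota$ is the inclusion ($B$-linear maps are exactly the $0$-connections; left action $(bf)(x)=bf(x)$) and $\nu$ sends a $D$-connection to $D$. It splits as a sequence of DG $B$-modules if there is a left DG $B$-module homomorphism $\Psi$ with $\nu\circ\Psi=\mathrm{id}$. $\mathcal L$-connections: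 for a left DG $B$-submodule $\mathcal L\subseteq{}^*\mathrm{Der}_A(B,X)$, $N$ admits an $\mathcal L$-connection if there is a left DG $B$-module homomorphism $\nabla\colon\mathcal L\to{}^*\mathrm{Conn}(N,N\otimes_B X)$, $D\mapsto\nabla_D$, such that $\nabla_D$ is a $D$-connection for every homogeneous $D\in\mathcal L$ (so $\nabla_{D+D'}=\nabla_D+\nabla_{D'}$, $\nabla_{bD}=b\nabla_D$, $\nabla_{\partial^{\mathrm{Der}}(D)}=\partial^{\mathrm{Conn}}(\nabla_D)$). *)

theory Defs
  imports "HOL-Algebra.Module" "HOL-Algebra.Chinese_Remainder" "HOL-Algebra.Free_Abelian_Groups"
begin

(* frees the name of the record field *)
hide_const (open) Wellorder_Constructions.zero

section \<open>Graded abelian groups\<close>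

text \<open>
  As in HOL-Algebra's record \<open>module\<close>, abelian groups are carried by the record type \<open>ring\<close>;
  for groups and modules the fields \<open>mult\<close> and \<open>one\<close> are meaningless.  Gradings are internal:
  \<open>hcomp M n\<close> is the subgroup of homogeneous elements of degree \<open>n\<close> of \<open>carrier M\<close>.
\<close>

record 'm graded = "'m ring" +
  hcomp :: "int \<Rightarrow> 'm set"

record 'm dgrp = "'m graded" +
  diff :: "'m \<Rightarrow> 'm"

definition decomposes :: "('m, 'z) graded_scheme \<Rightarrow> (int \<Rightarrow> 'm) \<Rightarrow> 'm \<Rightarrow> bool" where
  "decomposes M c x \<longleftrightarrow>
     (\<forall>n. c n \<in> hcomp M n) \<and> finite {n. c n \<noteq> \<zero>\<^bsub>M\<^esub>} \<and> x = (\<Oplus>\<^bsub>M\<^esub>n\<in>{n. c n \<noteq> \<zero>\<^bsub>M\<^esub>}. c n)"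

locale graded_group = abelian_group M for M :: "('m, 'z) graded_scheme" (structure) +
  assumes hcomp_subgroup: "subgroup (hcomp M n) (add_monoid M)"
    and ex1_decomposition: "x \<in> carrier M \<Longrightarrow> \<exists>!c. decomposes M c x"

locale dg_group = graded_group M for M :: "('m, 'z) dgrp_scheme" (structure) +
  assumes diff_hom: "diff M \<in> hom (add_monoid M) (add_monoid M)"
    and diff_degree: "diff M ` hcomp M n \<subseteq> hcomp M (n - 1)"
    and diff_diff: "x \<in> carrier M \<Longrightarrow> diff M (diff M x) = \<zero>"

definition hpart :: "('m, 'z) graded_scheme \<Rightarrow> int \<Rightarrow> 'm \<Rightarrow> 'm" where
  "hpart M n x = (THE c. decomposes M c x) n"

definition hsupp :: "('m, 'z) graded_scheme \<Rightarrow> 'm \<Rightarrow> int set" where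
  "hsupp M x = {n. hpart M n x \<noteq> \<zero>\<^bsub>M\<^esub>}"

definition ksign :: "('m, 'z) ring_scheme \<Rightarrow> int \<Rightarrow> 'm \<Rightarrow> 'm" where
  "ksign M k x = (if even k then x else \<ominus>\<^bsub>M\<^esub> x)"

text \<open>The additive map sending a homogeneous \<open>x\<close> to \<open>(-1)\<^sup>k\<^sup>|\<^sup>x\<^sup>| x\<close>.  It serves to extend formulas
  with Koszul signs, given on homogeneous elements, to all elements.\<close>

definition twist :: "('m, 'z) graded_scheme \<Rightarrow> int \<Rightarrow> 'm \<Rightarrow> 'm" where
  "twist M k x = (\<Oplus>\<^bsub>M\<^esub>n\<in>hsupp M x. ksign M (k * n) (hpart M n x))"


section \<open>DG algebras and DG modules\<close>

record ('r, 'a) dg_alg = "'a dgrp" +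
  rsmult :: "'r \<Rightarrow> 'a \<Rightarrow> 'a"

record ('a, 'm) dg_rmod = "'m dgrp" +
  ract :: "'m \<Rightarrow> 'a \<Rightarrow> 'm"

record ('a, 'm) dg_lmod = "'m dgrp" +
  lact :: "'a \<Rightarrow> 'm \<Rightarrow> 'm"

locale dg_algebra = ring A + dg_group A
  for R :: "('r, 'y) ring_scheme" and A :: "('r, 'a, 'z) dg_alg_scheme" (structure) +
  assumes R_module:
      "module R (module.make (carrier A) (\<otimes>) \<one> \<zero> (\<oplus>) (rsmult A))"
    and rsmult_mult_left: "\<lbrakk>r \<in> carrier R; a \<in> carrier A; b \<in> carrier A\<rbrakk>
      \<Longrightarrow> rsmult A r a \<otimes> b = rsmult A r (a \<otimes> b)"
    and rsmult_mult_right: "\<lbrakk>r \<in> carrier R; a \<in> carrier A; b \<in> carrier A\<rbrakk>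
      \<Longrightarrow> a \<otimes> rsmult A r b = rsmult A r (a \<otimes> b)"
    and rsmult_hcomp: "\<lbrakk>r \<in> carrier R; a \<in> hcomp A n\<rbrakk> \<Longrightarrow> rsmult A r a \<in> hcomp A n"
    and nonneg: "n < 0 \<Longrightarrow> hcomp A n = {\<zero>}"
    and one_hcomp: "\<one> \<in> hcomp A 0"
    and mult_hcomp: "\<lbrakk>a \<in> hcomp A i; b \<in> hcomp A j\<rbrakk> \<Longrightarrow> a \<otimes> b \<in> hcomp A (i + j)"
    and diff_rsmult: "\<lbrakk>r \<in> carrier R; a \<in> carrier A\<rbrakk>
      \<Longrightarrow> diff A (rsmult A r a) = rsmult A r (diff A a)"
    and graded_comm: "\<lbrakk>a \<in> hcomp A i; b \<in> hcomp A j\<rbrakk> \<Longrightarrow> a \<otimes> b = ksign A (i * j) (b \<otimes> a)"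
    and odd_square: "\<lbrakk>a \<in> hcomp A i; odd i\<rbrakk> \<Longrightarrow> a \<otimes> a = \<zero>"
    and Leibniz: "\<lbrakk>a \<in> hcomp A i; b \<in> hcomp A j\<rbrakk>
      \<Longrightarrow> diff A (a \<otimes> b) = diff A a \<otimes> b \<oplus> ksign A i (a \<otimes> diff A b)"

definition dg_algebra_hom ::
  "('r, 'y) ring_scheme \<Rightarrow> ('r, 'a, 'z) dg_alg_scheme \<Rightarrow> ('r, 'b, 'w) dg_alg_scheme \<Rightarrow> ('a \<Rightarrow> 'b) \<Rightarrow> bool" where
  "dg_algebra_hom R A B \<phi> \<longleftrightarrow>
     \<phi> \<in> ring_hom A B \<and>
     (\<forall>r\<in>carrier R. \<forall>a\<in>carrier A. \<phi> (rsmult A r a) = rsmult B r (\<phi> a)) \<and>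
     (\<forall>n. \<phi> ` hcomp A n \<subseteq> hcomp B n) \<and>
     (\<forall>a\<in>carrier A. \<phi> (diff A a) = diff B (\<phi> a))"

text \<open>Right modules.  The differential plays no role in \<open>graded_module\<close>.\<close>

locale graded_module = graded_group M
  for A :: "('a, 'y) graded_scheme" and M :: "('a, 'm, 'z) dg_rmod_scheme" (structure) +
  assumes ract_closed: "\<lbrakk>m \<in> carrier M; a \<in> carrier A\<rbrakk> \<Longrightarrow> ract M m a \<in> carrier M"
    and ract_add_left: "\<lbrakk>m \<in> carrier M; m' \<in> carrier M; a \<in> carrier A\<rbrakk>
      \<Longrightarrow> ract M (m \<oplus> m') a = ract M m a \<oplus> ract M m' a"
    and ract_add_right: "\<lbrakk>m \<in> carrier M; a \<in> carrier A; b \<in> carrier A\<rbrakk>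
      \<Longrightarrow> ract M m (a \<oplus>\<^bsub>A\<^esub> b) = ract M m a \<oplus> ract M m b"
    and ract_mult: "\<lbrakk>m \<in> carrier M; a \<in> carrier A; b \<in> carrier A\<rbrakk>
      \<Longrightarrow> ract M m (a \<otimes>\<^bsub>A\<^esub> b) = ract M (ract M m a) b"
    and ract_one: "m \<in> carrier M \<Longrightarrow> ract M m \<one>\<^bsub>A\<^esub> = m"
    and ract_hcomp: "\<lbrakk>m \<in> hcomp M i; a \<in> hcomp A j\<rbrakk> \<Longrightarrow> ract M m a \<in> hcomp M (i + j)"

locale dg_module = graded_module A M + dg_group M
  for A :: "('a, 'y) dgrp_scheme" and M :: "('a, 'm, 'z) dg_rmod_scheme" (structure) +
  assumes module_Leibniz: "\<lbrakk>m \<in> hcomp M i; a \<in> hcomp A j\<rbrakk>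
      \<Longrightarrow> diff M (ract M m a) = ract M (diff M m) a \<oplus> ksign M i (ract M m (diff A a))"

definition regular :: "('a, 'z) dgrp_scheme \<Rightarrow> ('a, 'a) dg_rmod" where
  "regular A = dgrp.extend (dgrp.truncate A) \<lparr>ract = mult A\<rparr>"

definition restrict_scalars :: "('a \<Rightarrow> 'b) \<Rightarrow> ('b, 'm, 'z) dg_rmod_scheme \<Rightarrow> ('a, 'm) dg_rmod" where
  "restrict_scalars f M = dgrp.extend (dgrp.truncate M) \<lparr>ract = (\<lambda>m a. ract M m (f a))\<rparr>"

text \<open>The left action \<open>a m = (-1)\<^sup>|\<^sup>a\<^sup>|\<^sup>|\<^sup>m\<^sup>| m a\<close> on a right module.\<close>

definition left_action ::
  "('a, 'y) graded_scheme \<Rightarrow> ('a, 'm, 'z) dg_rmod_scheme \<Rightarrow> 'a \<Rightarrow> 'm \<Rightarrow> 'm" where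
  "left_action A M a m = (\<Oplus>\<^bsub>M\<^esub>i\<in>hsupp A a. ract M (twist M i m) (hpart A i a))"

text \<open>Right \<open>A\<close>-linear maps of degree \<open>n\<close>, i.e. graded homomorphisms from \<open>M\<close> to the shift \<open>T(n)\<close>.\<close>

definition gr_hom :: "('a, 'y) ring_scheme \<Rightarrow> ('a, 'm, 'z) dg_rmod_scheme
    \<Rightarrow> ('a, 't, 'w) dg_rmod_scheme \<Rightarrow> int \<Rightarrow> ('m \<Rightarrow> 't) set" where
  "gr_hom A M T n = {f \<in> carrier M \<rightarrow>\<^sub>E carrier T.
     f \<in> hom (add_monoid M) (add_monoid T) \<and>
     (\<forall>m\<in>carrier M. \<forall>a\<in>carrier A. f (ract M m a) = ract T (f m) a) \<and>
     (\<forall>i. f ` hcomp M i \<subseteq> hcomp T (i + n))}"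

definition dg_hom :: "('a, 'y) ring_scheme \<Rightarrow> ('a, 'm, 'z) dg_rmod_scheme
    \<Rightarrow> ('a, 't, 'w) dg_rmod_scheme \<Rightarrow> ('m \<Rightarrow> 't) set" where
  "dg_hom A M T = {f \<in> gr_hom A M T 0. \<forall>x\<in>carrier M. f (diff M x) = diff T (f x)}"

definition left_dg_hom :: "('a, 'y) ring_scheme \<Rightarrow> ('a, 'm, 'z) dg_lmod_scheme
    \<Rightarrow> ('a, 't, 'w) dg_lmod_scheme \<Rightarrow> ('m \<Rightarrow> 't) \<Rightarrow> bool" where
  "left_dg_hom A L T f \<longleftrightarrow>
     f \<in> hom (add_monoid L) (add_monoid T) \<and>
     (\<forall>n. f ` hcomp L n \<subseteq> hcomp T n) \<and>
     (\<forall>a\<in>carrier A. \<forall>x\<in>carrier L. f (lact L a x) = lact T a (f x)) \<and>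
     (\<forall>x\<in>carrier L. f (diff L x) = diff T (f x))"

text \<open>
  Projectivity of \<open>P\<close> in the category of graded \<open>A\<close>-modules.  A proposition cannot quantify over
  types, so the lifting problems range over modules with carriers in \<open>'p \<Rightarrow> 'a\<close> and \<open>'p\<close>.
  This is no restriction: the epimorphism onto \<open>P\<close> from the free graded module on the nonzero
  homogeneous elements of \<open>P\<close> (finitely supported functions \<open>'p \<Rightarrow> 'a\<close>) is among them, and its
  splitting makes \<open>P\<close> a direct summand of a free graded module.
\<close>

definition graded_projective :: "('a, 'y) graded_scheme \<Rightarrow> ('a, 'p) dg_rmod \<Rightarrow> bool" where
  "graded_projective A P \<longleftrightarrow>
     (\<forall>(M :: ('a, 'p \<Rightarrow> 'a) dg_rmod) (Q :: ('a, 'p) dg_rmod) f g.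
        graded_module A M \<and> graded_module A Q \<and>
        f \<in> gr_hom A M Q 0 \<and> f ` carrier M = carrier Q \<and> g \<in> gr_hom A P Q 0 \<longrightarrow>
        (\<exists>h\<in>gr_hom A P M 0. \<forall>x\<in>carrier P. f (h x) = g x))"

definition homogeneous_basis :: "('b, 'y) ring_scheme \<Rightarrow> ('b, 'n, 'z) dg_rmod_scheme \<Rightarrow> 'n set \<Rightarrow> bool" where
  "homogeneous_basis B N E \<longleftrightarrow>
     E \<subseteq> (\<Union>n. hcomp N n) \<and>
     (\<forall>x\<in>carrier N. \<exists>!c. c \<in> E \<rightarrow>\<^sub>E carrier B \<and> finite {e\<in>E. c e \<noteq> \<zero>\<^bsub>B\<^esub>} \<and>
        x = (\<Oplus>\<^bsub>N\<^esub>e\<in>{e\<in>E. c e \<noteq> \<zero>\<^bsub>B\<^esub>}. ract N e (c e)))"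

text \<open>The basis is indexed by itself, \<open>r\<close> being the (reflexive) well-order on it.\<close>

definition semifree :: "('b, 'y) ring_scheme \<Rightarrow> ('b, 'n, 'z) dg_rmod_scheme \<Rightarrow> bool" where
  "semifree B N \<longleftrightarrow>
     (\<exists>E r. homogeneous_basis B N E \<and> well_order_on E r \<and>
        (\<forall>e\<in>E. \<exists>F b. finite F \<and> F \<subseteq> {u\<in>E. (u, e) \<in> r \<and> u \<noteq> e} \<and> b \<in> F \<rightarrow> carrier B \<and>
           diff N e = (\<Oplus>\<^bsub>N\<^esub>u\<in>F. ract N u (b u))))"


section \<open>Tensor products\<close>

text \<open>
  \<open>M \<otimes>\<^sub>S L\<close> for right modules \<open>M\<close>, \<open>L\<close> over the graded commutative \<open>S\<close>, where \<open>L\<close> is regarded as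
  a left module via \<open>left_action\<close>: the free abelian group on pairs modulo the usual relations.
  Its elements are cosets.
\<close>

type_synonym ('m, 'l) tensor = "(('m \<times> 'l) \<Rightarrow>\<^sub>0 int) set"

definition tensor_relations :: "('s, 'y) graded_scheme \<Rightarrow> ('s, 'm, 'z) dg_rmod_scheme
    \<Rightarrow> ('s, 'l, 'w) dg_rmod_scheme \<Rightarrow> (('m \<times> 'l) \<Rightarrow>\<^sub>0 int) set" where
  "tensor_relations S M L =
     {frag_of (m \<oplus>\<^bsub>M\<^esub> m', l) - frag_of (m, l) - frag_of (m', l) | m m' l.
        m \<in> carrier M \<and> m' \<in> carrier M \<and> l \<in> carrier L} \<union>
     {frag_of (m, l \<oplus>\<^bsub>L\<^esub> l') - frag_of (m, l) - frag_of (m, l') | m l l'.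
        m \<in> carrier M \<and> l \<in> carrier L \<and> l' \<in> carrier L} \<union>
     {frag_of (ract M m s, l) - frag_of (m, left_action S L s l) | m s l.
        m \<in> carrier M \<and> s \<in> carrier S \<and> l \<in> carrier L}"

definition tensor_kernel :: "('s, 'y) graded_scheme \<Rightarrow> ('s, 'm, 'z) dg_rmod_scheme
    \<Rightarrow> ('s, 'l, 'w) dg_rmod_scheme \<Rightarrow> (('m \<times> 'l) \<Rightarrow>\<^sub>0 int) set" where
  "tensor_kernel S M L =
     generate (free_Abelian_group (carrier M \<times> carrier L)) (tensor_relations S M L)"

definition pure_tensor :: "('s, 'y) graded_scheme \<Rightarrow> ('s, 'm, 'z) dg_rmod_scheme
    \<Rightarrow> ('s, 'l, 'w) dg_rmod_scheme \<Rightarrow> 'm \<Rightarrow> 'l \<Rightarrow> ('m, 'l) tensor" where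
  "pure_tensor S M L m l =
     tensor_kernel S M L #>\<^bsub>free_Abelian_group (carrier M \<times> carrier L)\<^esub> frag_of (m, l)"

definition tensor_group :: "('s, 'y) graded_scheme \<Rightarrow> ('s, 'm, 'z) dg_rmod_scheme
    \<Rightarrow> ('s, 'l, 'w) dg_rmod_scheme \<Rightarrow> ('m, 'l) tensor ring" where
  "tensor_group S M L =
     (let F = free_Abelian_group (carrier M \<times> carrier L); K = tensor_kernel S M L in
      \<lparr>carrier = rcosets\<^bsub>F\<^esub> K, mult = undefined, one = undefined,
       zero = K, add = (<#>\<^bsub>F\<^esub>)\<rparr>)"

text \<open>
  The additive map \<open>m \<otimes> l \<mapsto> g (m, l)\<close> from a tensor product to \<open>G\<close>; for biadditive, balanced \<open>g\<close>
  its value does not depend on the representative chosen.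
\<close>

definition tensor_lift :: "('g, 'z) ring_scheme \<Rightarrow> ('m \<times> 'l \<Rightarrow> 'g) \<Rightarrow> ('m, 'l) tensor \<Rightarrow> 'g" where
  "tensor_lift G g t =
     (let c = (SOME c. c \<in> t) in
      \<Oplus>\<^bsub>G\<^esub>p\<in>Poly_Mapping.keys c. [Poly_Mapping.lookup c p] \<cdot>\<^bsub>G\<^esub> g p)"

definition tensor_dg :: "('s, 'y) graded_scheme \<Rightarrow> ('s, 'm, 'z) dg_rmod_scheme
    \<Rightarrow> ('s, 'l, 'w) dg_rmod_scheme \<Rightarrow> ('m, 'l) tensor dgrp" where
  "tensor_dg S M L =
     (let T = tensor_group S M L in
      ring.extend T
       \<lparr>hcomp = (\<lambda>n. generate (add_monoid T)
          {pure_tensor S M L m l | i m l. m \<in> hcomp M i \<and> l \<in> hcomp L (n - i)}),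
        diff = tensor_lift T (\<lambda>(m, l).
          pure_tensor S M L (diff M m) l \<oplus>\<^bsub>T\<^esub> pure_tensor S M L (twist M 1 m) (diff L l))\<rparr>)"


section \<open>The enveloping algebra and the diagonal ideal\<close>

definition env_pure :: "('r, 'a) dg_alg \<Rightarrow> ('r, 'b) dg_alg \<Rightarrow> ('a \<Rightarrow> 'b) \<Rightarrow> 'b \<Rightarrow> 'b \<Rightarrow> ('b, 'b) tensor" where
  "env_pure A B \<phi> =
     pure_tensor A (restrict_scalars \<phi> (regular B)) (restrict_scalars \<phi> (regular B))"

text \<open>\<open>B \<otimes>\<^sub>A B\<close> with \<open>(b \<otimes> c)(b' \<otimes> c') = (-1)\<^sup>|\<^sup>c\<^sup>|\<^sup>|\<^sup>b\<^sup>'\<^sup>| bb' \<otimes> cc'\<close>.\<close>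

definition enveloping ::
  "('r, 'a) dg_alg \<Rightarrow> ('r, 'b) dg_alg \<Rightarrow> ('a \<Rightarrow> 'b) \<Rightarrow> ('r, ('b, 'b) tensor) dg_alg" where
  "enveloping A B \<phi> =
     (let T = tensor_dg A (restrict_scalars \<phi> (regular B)) (restrict_scalars \<phi> (regular B)) in
      dgrp.extend
       (T\<lparr>mult := (\<lambda>s t. tensor_lift T (\<lambda>(b, c). tensor_lift T (\<lambda>(b', c').
             \<Oplus>\<^bsub>T\<^esub>j\<in>hsupp B b'.
               env_pure A B \<phi> (b \<otimes>\<^bsub>B\<^esub> hpart B j b') (twist B j c \<otimes>\<^bsub>B\<^esub> c')) t) s),
          one := env_pure A B \<phi> \<one>\<^bsub>B\<^esub> \<one>\<^bsub>B\<^esub>\<rparr>)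
       \<lparr>rsmult = (\<lambda>r. tensor_lift T (\<lambda>(b, c). env_pure A B \<phi> (rsmult B r b) c))\<rparr>)"

definition env_mult_map :: "('r, 'b) dg_alg \<Rightarrow> ('b, 'b) tensor \<Rightarrow> 'b" where
  "env_mult_map B = tensor_lift B (\<lambda>(b, c). b \<otimes>\<^bsub>B\<^esub> c)"

definition diag_ideal :: "('r, 'a) dg_alg \<Rightarrow> ('r, 'b) dg_alg \<Rightarrow> ('a \<Rightarrow> 'b)
    \<Rightarrow> (('b, 'b) tensor, ('b, 'b) tensor) dg_rmod" where
  "diag_ideal A B \<phi> =
     (let Be = enveloping A B \<phi>; J = {t \<in> carrier Be. env_mult_map B t = \<zero>\<^bsub>B\<^esub>} in
      (regular Be)\<lparr>carrier := J, hcomp := (\<lambda>n. hcomp Be n \<inter> J)\<rparr>)"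

definition univ_derivation ::
  "('r, 'a) dg_alg \<Rightarrow> ('r, 'b) dg_alg \<Rightarrow> ('a \<Rightarrow> 'b) \<Rightarrow> 'b \<Rightarrow> ('b, 'b) tensor" where
  "univ_derivation A B \<phi> =
     (\<lambda>b\<in>carrier B. env_pure A B \<phi> b \<one>\<^bsub>B\<^esub> \<ominus>\<^bsub>enveloping A B \<phi>\<^esub> env_pure A B \<phi> \<one>\<^bsub>B\<^esub> b)"


section \<open>Naive liftings\<close>

definition base_change :: "('r, 'a) dg_alg \<Rightarrow> ('r, 'b) dg_alg \<Rightarrow> ('a \<Rightarrow> 'b) \<Rightarrow> ('b, 'n) dg_rmod
    \<Rightarrow> ('b, ('n, 'b) tensor) dg_rmod" where
  "base_change A B \<phi> N =
     (let M = restrict_scalars \<phi> N; L = restrict_scalars \<phi> (regular B); T = tensor_dg A M L in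
      dgrp.extend T
       \<lparr>ract = (\<lambda>t b. tensor_lift T (\<lambda>(n, c). pure_tensor A M L n (c \<otimes>\<^bsub>B\<^esub> b)) t)\<rparr>)"

definition base_change_counit :: "('b, 'n) dg_rmod \<Rightarrow> ('n, 'b) tensor \<Rightarrow> 'n" where
  "base_change_counit N = tensor_lift N (\<lambda>(n, b). ract N n b)"

definition naively_liftable ::
  "('r, 'a) dg_alg \<Rightarrow> ('r, 'b) dg_alg \<Rightarrow> ('a \<Rightarrow> 'b) \<Rightarrow> ('b, 'n) dg_rmod \<Rightarrow> bool" where
  "naively_liftable A B \<phi> N \<longleftrightarrow>
     (\<exists>s\<in>dg_hom B N (base_change A B \<phi> N). \<forall>x\<in>carrier N. base_change_counit N (s x) = x)"


section \<open>Bimodule structures\<close>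

text \<open>
  The two \<open>B\<close>-module structures of a right \<open>B\<^sup>e\<close>-module \<open>X\<close>: via \<open>b \<mapsto> b \<otimes> 1\<close> (used as a left
  structure through \<open>left_action\<close>) and via \<open>b \<mapsto> 1 \<otimes> b\<close>.
\<close>

definition outer :: "('r, 'a) dg_alg \<Rightarrow> ('r, 'b) dg_alg \<Rightarrow> ('a \<Rightarrow> 'b)
    \<Rightarrow> (('b, 'b) tensor, 'x) dg_rmod \<Rightarrow> ('b, 'x) dg_rmod" where
  "outer A B \<phi> X = restrict_scalars (\<lambda>b. env_pure A B \<phi> b \<one>\<^bsub>B\<^esub>) X"

definition inner :: "('r, 'a) dg_alg \<Rightarrow> ('r, 'b) dg_alg \<Rightarrow> ('a \<Rightarrow> 'b)
    \<Rightarrow> (('b, 'b) tensor, 'x) dg_rmod \<Rightarrow> ('b, 'x) dg_rmod" where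
  "inner A B \<phi> X = restrict_scalars (\<lambda>b. env_pure A B \<phi> \<one>\<^bsub>B\<^esub> b) X"

text \<open>\<open>N \<otimes>\<^sub>B X\<close> as a right DG \<open>B\<close>-module, and its left action \<open>b (n \<otimes> x) = (b n) \<otimes> x\<close>.\<close>

definition bitensor :: "('r, 'a) dg_alg \<Rightarrow> ('r, 'b) dg_alg \<Rightarrow> ('a \<Rightarrow> 'b) \<Rightarrow> ('b, 'n) dg_rmod
    \<Rightarrow> (('b, 'b) tensor, 'x) dg_rmod \<Rightarrow> ('b, ('n, 'x) tensor) dg_rmod" where
  "bitensor A B \<phi> N X =
     (let L = outer A B \<phi> X; T = tensor_dg B N L in
      dgrp.extend T
       \<lparr>ract = (\<lambda>t b. tensor_lift T (\<lambda>(n, x). pure_tensor B N L n (ract (inner A B \<phi> X) x b)) t)\<rparr>)"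

definition bitensor_left :: "('r, 'a) dg_alg \<Rightarrow> ('r, 'b) dg_alg \<Rightarrow> ('a \<Rightarrow> 'b) \<Rightarrow> ('b, 'n) dg_rmod
    \<Rightarrow> (('b, 'b) tensor, 'x) dg_rmod \<Rightarrow> 'b \<Rightarrow> ('n, 'x) tensor \<Rightarrow> ('n, 'x) tensor" where
  "bitensor_left A B \<phi> N X b t =
     tensor_lift (bitensor A B \<phi> N X)
       (\<lambda>(n, x). pure_tensor B N (outer A B \<phi> X) (left_action B N b n) x) t"


section \<open>Graded homs, derivations and connections\<close>

text \<open>Functions are extensional on the carrier of their source, with pointwise addition.\<close>

definition map_group :: "('m, 'y) ring_scheme \<Rightarrow> ('t, 'z) ring_scheme \<Rightarrow> ('m \<Rightarrow> 't) ring" where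
  "map_group M T =
     \<lparr>carrier = carrier M \<rightarrow>\<^sub>E carrier T, mult = undefined, one = undefined,
      zero = (\<lambda>x\<in>carrier M. \<zero>\<^bsub>T\<^esub>), add = (\<lambda>f g. \<lambda>x\<in>carrier M. f x \<oplus>\<^bsub>T\<^esub> g x)\<rparr>"

text \<open>
  The direct sum of subgroups \<open>H n\<close> of \<open>G\<close>, as a subgroup of \<open>G\<close>.  It is used for families of maps
  of degree \<open>n\<close> between graded groups, which are always independent.
\<close>

definition direct_sum :: "('g, 'z) ring_scheme \<Rightarrow> (int \<Rightarrow> 'g set) \<Rightarrow> 'g graded" where
  "direct_sum G H =
     \<lparr>carrier = {\<Oplus>\<^bsub>G\<^esub>n\<in>I. f n | I f. finite I \<and> f \<in> (\<Pi> n\<in>I. H n)},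
      mult = undefined, one = undefined, zero = \<zero>\<^bsub>G\<^esub>, add = add G, hcomp = H\<rparr>"

definition star_hom :: "('a, 'y) ring_scheme \<Rightarrow> ('a, 'm, 'z) dg_rmod_scheme
    \<Rightarrow> ('a, 't, 'w) dg_rmod_scheme \<Rightarrow> ('m \<Rightarrow> 't) dgrp" where
  "star_hom A M T =
     (let H = direct_sum (map_group M T) (gr_hom A M T) in
      graded.extend H
       \<lparr>diff = (\<lambda>f. \<lambda>x\<in>carrier M. diff T (f x) \<ominus>\<^bsub>T\<^esub> twist H 1 f (diff M x))\<rparr>)"

text \<open>\<open>\<^sup>*Hom\<^sub>A(B, X)\<close> and \<open>\<^sup>*Hom\<^sub>A(N, N \<otimes>\<^sub>B X)\<close>, the ambient complexes of \<open>\<^sup>*Der\<close> and \<open>\<^sup>*Conn\<close>.\<close>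

definition der_ambient :: "('r, 'a) dg_alg \<Rightarrow> ('r, 'b) dg_alg \<Rightarrow> ('a \<Rightarrow> 'b)
    \<Rightarrow> (('b, 'b) tensor, 'x) dg_rmod \<Rightarrow> ('b \<Rightarrow> 'x) dgrp" where
  "der_ambient A B \<phi> X =
     star_hom A (restrict_scalars \<phi> (regular B)) (restrict_scalars \<phi> (inner A B \<phi> X))"

definition conn_ambient :: "('r, 'a) dg_alg \<Rightarrow> ('r, 'b) dg_alg \<Rightarrow> ('a \<Rightarrow> 'b) \<Rightarrow> ('b, 'n) dg_rmod
    \<Rightarrow> (('b, 'b) tensor, 'x) dg_rmod \<Rightarrow> ('n \<Rightarrow> ('n, 'x) tensor) dgrp" where
  "conn_ambient A B \<phi> N X =
     star_hom A (restrict_scalars \<phi> N) (restrict_scalars \<phi> (bitensor A B \<phi> N X))"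

definition Der :: "('r, 'a) dg_alg \<Rightarrow> ('r, 'b) dg_alg \<Rightarrow> ('a \<Rightarrow> 'b)
    \<Rightarrow> (('b, 'b) tensor, 'x) dg_rmod \<Rightarrow> int \<Rightarrow> ('b \<Rightarrow> 'x) set" where
  "Der A B \<phi> X n = {D \<in> hcomp (der_ambient A B \<phi> X) n.
     \<forall>i j. \<forall>b\<in>hcomp B i. \<forall>c\<in>hcomp B j.
       D (b \<otimes>\<^bsub>B\<^esub> c) = ract (inner A B \<phi> X) (D b) c
                        \<oplus>\<^bsub>X\<^esub> ksign X (n * i) (left_action B (outer A B \<phi> X) b (D c))}"

definition star_Der :: "('r, 'a) dg_alg \<Rightarrow> ('r, 'b) dg_alg \<Rightarrow> ('a \<Rightarrow> 'b)
    \<Rightarrow> (('b, 'b) tensor, 'x) dg_rmod \<Rightarrow> ('b, 'b \<Rightarrow> 'x) dg_lmod" where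
  "star_Der A B \<phi> X =
     graded.extend (direct_sum (der_ambient A B \<phi> X) (Der A B \<phi> X))
       \<lparr>diff = diff (der_ambient A B \<phi> X),
        lact = (\<lambda>b D. \<lambda>c\<in>carrier B. left_action B (outer A B \<phi> X) b (D c))\<rparr>"

definition is_connection :: "('r, 'a) dg_alg \<Rightarrow> ('r, 'b) dg_alg \<Rightarrow> ('a \<Rightarrow> 'b) \<Rightarrow> ('b, 'n) dg_rmod
    \<Rightarrow> (('b, 'b) tensor, 'x) dg_rmod \<Rightarrow> int \<Rightarrow> ('b \<Rightarrow> 'x) \<Rightarrow> ('n \<Rightarrow> ('n, 'x) tensor) \<Rightarrow> bool" where
  "is_connection A B \<phi> N X n D \<psi> \<longleftrightarrow>
     D \<in> Der A B \<phi> X n \<and>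
     \<psi> \<in> hcomp (conn_ambient A B \<phi> N X) n \<and>
     (\<forall>i. \<forall>x\<in>hcomp N i. \<forall>b\<in>carrier B.
        \<psi> (ract N x b) = ract (bitensor A B \<phi> N X) (\<psi> x) b
          \<oplus>\<^bsub>bitensor A B \<phi> N X\<^esub>
          ksign (bitensor A B \<phi> N X) (n * i) (pure_tensor B N (outer A B \<phi> X) x (D b)))"

text \<open>
  Elements of \<open>\<^sup>*Conn(N, N \<otimes>\<^sub>B X)\<close> are pairs \<open>(D, \<psi>)\<close>, with \<open>\<psi>\<close> a \<open>D\<close>-connection if \<open>D\<close> is homogeneous.
  For nonzero free \<open>N\<close> the second component determines the first, so this is the set of connections
  \<open>\<psi>\<close>; for \<open>N = 0\<close> it implements the convention that the zero \<open>D\<close>-connections \<open>(D, 0)\<close> are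
  pairwise distinct.
\<close>

definition star_Conn :: "('r, 'a) dg_alg \<Rightarrow> ('r, 'b) dg_alg \<Rightarrow> ('a \<Rightarrow> 'b) \<Rightarrow> ('b, 'n) dg_rmod
    \<Rightarrow> (('b, 'b) tensor, 'x) dg_rmod
    \<Rightarrow> ('b, ('b \<Rightarrow> 'x) \<times> ('n \<Rightarrow> ('n, 'x) tensor)) dg_lmod" where
  "star_Conn A B \<phi> N X =
     graded.extend
       (direct_sum (RDirProd (der_ambient A B \<phi> X) (conn_ambient A B \<phi> N X))
          (\<lambda>n. {(D, \<psi>). is_connection A B \<phi> N X n D \<psi>}))
       \<lparr>diff = (\<lambda>(D, \<psi>). (diff (der_ambient A B \<phi> X) D, diff (conn_ambient A B \<phi> N X) \<psi>)),
        lact = (\<lambda>b (D, \<psi>). (lact (star_Der A B \<phi> X) b D,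
                             \<lambda>x\<in>carrier N. bitensor_left A B \<phi> N X b (\<psi> x)))\<rparr>"

definition star_Hom_B :: "('r, 'a) dg_alg \<Rightarrow> ('r, 'b) dg_alg \<Rightarrow> ('a \<Rightarrow> 'b) \<Rightarrow> ('b, 'n) dg_rmod
    \<Rightarrow> (('b, 'b) tensor, 'x) dg_rmod \<Rightarrow> ('b, 'n \<Rightarrow> ('n, 'x) tensor) dg_lmod" where
  "star_Hom_B A B \<phi> N X =
     dgrp.extend (star_hom B N (bitensor A B \<phi> N X))
       \<lparr>lact = (\<lambda>b f. \<lambda>x\<in>carrier N. bitensor_left A B \<phi> N X b (f x))\<rparr>"


section \<open>The fundamental exact sequence and its splittings\<close>

record ('b, 'k, 'm, 'q) dg_seq =
  sub :: "('b, 'k) dg_lmod"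
  incl :: "'k \<Rightarrow> 'm"
  mid :: "('b, 'm) dg_lmod"
  quotmap :: "'m \<Rightarrow> 'q"
  quot :: "('b, 'q) dg_lmod"

definition fundamental_sequence :: "('r, 'a) dg_alg \<Rightarrow> ('r, 'b) dg_alg \<Rightarrow> ('a \<Rightarrow> 'b)
    \<Rightarrow> ('b, 'n) dg_rmod \<Rightarrow> (('b, 'b) tensor, 'x) dg_rmod
    \<Rightarrow> ('b, 'n \<Rightarrow> ('n, 'x) tensor, ('b \<Rightarrow> 'x) \<times> ('n \<Rightarrow> ('n, 'x) tensor), 'b \<Rightarrow> 'x) dg_seq" where
  "fundamental_sequence A B \<phi> N X =
     \<lparr>sub = star_Hom_B A B \<phi> N X,
      incl = (\<lambda>f. (\<zero>\<^bsub>star_Der A B \<phi> X\<^esub>, f)),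
      mid = star_Conn A B \<phi> N X,
      quotmap = fst,
      quot = star_Der A B \<phi> X\<rparr>"

definition splits :: "('b, 'y) ring_scheme \<Rightarrow> ('b, 'k, 'm, 'q) dg_seq \<Rightarrow> bool" where
  "splits B E \<longleftrightarrow>
     (\<exists>\<Psi>. left_dg_hom B (quot E) (mid E) \<Psi> \<and> (\<forall>q\<in>carrier (quot E). quotmap E (\<Psi> q) = q))"

text \<open>\<open>L\<close> is meant to be the carrier of a left DG \<open>B\<close>-submodule of \<open>\<^sup>*Der\<^sub>A(B, X)\<close>.\<close>

definition admits_connection :: "('r, 'a) dg_alg \<Rightarrow> ('r, 'b) dg_alg \<Rightarrow> ('a \<Rightarrow> 'b)
    \<Rightarrow> ('b, 'n) dg_rmod \<Rightarrow> (('b, 'b) tensor, 'x) dg_rmod \<Rightarrow> ('b \<Rightarrow> 'x) set \<Rightarrow> bool" where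
  "admits_connection A B \<phi> N X L \<longleftrightarrow>
     (\<exists>\<Delta>. left_dg_hom B
            ((star_Der A B \<phi> X)\<lparr>carrier := L, hcomp := (\<lambda>n. Der A B \<phi> X n \<inter> L)\<rparr>)
            (star_Conn A B \<phi> N X) \<Delta> \<and>
          (\<forall>n. \<forall>D \<in> Der A B \<phi> X n \<inter> L. \<exists>\<psi>. \<Delta> D = (D, \<psi>) \<and> is_connection A B \<phi> N X n D \<psi>))"

end

theory Submission
  imports Defs
begin

text \<open>
  Let \<open>s\<close> be a section of \<open>\<pi>\<^sub>N : N \<otimes>\<^sub>A B \<rightarrow> N\<close>.  A derivation \<open>D : B \<rightarrow> X\<close> induces the map
  \<open>n \<otimes> c \<mapsto> (-1)\<^sup>|\<^sup>D\<^sup>|\<^sup>|\<^sup>n\<^sup>| n \<otimes> D c\<close> from \<open>N \<otimes>\<^sub>A B\<close> to \<open>N \<otimes>\<^sub>B X\<close>, and composing it with \<open>s\<close> gives a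
  \<open>D\<close>-connection that depends \<open>B\<close>-linearly and compatibly with differentials on \<open>D\<close>; so
  every \<open>\<E>\<^sub>N(X)\<close> splits.  Conversely, the image of \<open>\<delta>\<close> under a splitting for \<open>X = J\<close> is a closed
  \<open>\<delta>\<close>-connection \<open>\<psi>\<close>, and \<open>x \<mapsto> x \<otimes> 1 - \<psi> x\<close>, where \<open>N \<otimes>\<^sub>B J\<close> is mapped to \<open>N \<otimes>\<^sub>A B\<close> via
  \<open>N \<otimes>\<^sub>B B\<^sup>e \<cong> N \<otimes>\<^sub>A B\<close>, is a section of \<open>\<pi>\<^sub>N\<close>.
\<close>

section \<open>Additive maps\<close>

text \<open>The Leibniz term of a connection comes from a failure of linearity. On
  \<open>N \<otimes>\<^sub>A B\<close> the map induced by \<open>D\<close> misses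
  \<open>B\<close>-linearity by \<open>\<pi>\<^sub>N(t) \<otimes> D b\<close>, up to sign; for
  \<open>t = s x\<close> this is \<open>x \<otimes> D b\<close>. Conversely
  \<open>x \<mapsto> x \<otimes> 1\<close> misses \<open>B\<close>-linearity by
  \<open>x b \<otimes> 1 - x \<otimes> b\<close>, the image of
  \<open>x \<otimes> \<delta> b\<close>. Subtracting a \<open>\<delta>\<close>-connection removes
  this defect, and the subtracted term is invisible to \<open>\<pi>\<^sub>N\<close>, since
  multiplication kills \<open>J\<close>. The obstacle is that the elements of the complexes need not
  be homogeneous, while every sign is prescribed on homogeneous ones. All signs are therefore built
  into additive maps through \<open>twist\<close>, and identities are checked on homogeneous
  elements and pure tensors only. In particular the sign of degree \<open>|D| |n|\<close> becomes a
  conjugation of \<open>D\<close> by \<open>twist\<close>, with no decomposition of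
  \<open>D\<close>. A connection on all of \<open>star_Der\<close> is a splitting in other words.
  Since \<open>X\<close> ranges over carriers in a sum type, the way back from "all
  \<open>X\<close>" needs a copy of \<open>J\<close> on that type.\<close>

abbreviation ahom :: "('g, 'y) ring_scheme \<Rightarrow> ('h, 'z) ring_scheme \<Rightarrow> ('g \<Rightarrow> 'h) set" where
  "ahom G H \<equiv> hom (add_monoid G) (add_monoid H)"

lemma ahomI:
  assumes "\<And>x. x \<in> carrier G \<Longrightarrow> f x \<in> carrier H"
    and "\<And>x y. \<lbrakk>x \<in> carrier G; y \<in> carrier G\<rbrakk> \<Longrightarrow> f (x \<oplus>\<^bsub>G\<^esub> y) = f x \<oplus>\<^bsub>H\<^esub> f y"
  shows "f \<in> ahom G H"
  using assms by (auto simp: hom_def)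

lemma ahom_closed: "\<lbrakk>f \<in> ahom G H; x \<in> carrier G\<rbrakk> \<Longrightarrow> f x \<in> carrier H"
  by (auto simp: hom_def)

lemma ahom_add:
  "\<lbrakk>f \<in> ahom G H; x \<in> carrier G; y \<in> carrier G\<rbrakk> \<Longrightarrow> f (x \<oplus>\<^bsub>G\<^esub> y) = f x \<oplus>\<^bsub>H\<^esub> f y"
  by (auto simp: hom_def)

lemma ahom_group_hom:
  assumes "abelian_group G" "abelian_group H" "f \<in> ahom G H"
  shows "abelian_group_hom G H f"
  using assms
  by (intro abelian_group_homI) (auto simp: group_hom_def group_hom_axioms_def abelian_group.a_group)

lemma ahom_zero:
  assumes "abelian_group G" "abelian_group H" "f \<in> ahom G H"
  shows "f \<zero>\<^bsub>G\<^esub> = \<zero>\<^bsub>H\<^esub>"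
  using abelian_group_hom.hom_zero[OF ahom_group_hom[OF assms]] .

lemma ahom_a_inv:
  assumes "abelian_group G" "abelian_group H" "f \<in> ahom G H" "x \<in> carrier G"
  shows "f (\<ominus>\<^bsub>G\<^esub> x) = \<ominus>\<^bsub>H\<^esub> f x"
  using abelian_group_hom.hom_a_inv[OF ahom_group_hom[OF assms(1-3)] assms(4)] .

lemma ahom_a_minus:
  assumes "abelian_group G" "abelian_group H" "f \<in> ahom G H" "x \<in> carrier G" "y \<in> carrier G"
  shows "f (x \<ominus>\<^bsub>G\<^esub> y) = f x \<ominus>\<^bsub>H\<^esub> f y"
  using assms by (simp add: a_minus_def ahom_add ahom_a_inv abelian_group.a_inv_closed)

lemma ahom_ksign:
  assumes "abelian_group G" "abelian_group H" "f \<in> ahom G H" "x \<in> carrier G"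
  shows "f (ksign G k x) = ksign H k (f x)"
  using assms by (simp add: ksign_def ahom_a_inv)

lemma ahom_finsum:
  assumes G: "abelian_group G" and H: "abelian_group H" and f: "f \<in> ahom G H"
    and "\<And>i. i \<in> I \<Longrightarrow> g i \<in> carrier G"
  shows "f (\<Oplus>\<^bsub>G\<^esub>i\<in>I. g i) = (\<Oplus>\<^bsub>H\<^esub>i\<in>I. f (g i))"
proof -
  interpret G: abelian_group G by fact
  interpret H: abelian_group H by fact
  show ?thesis
    using assms(4)
  proof (induction I rule: infinite_finite_induct)
    case (infinite I)
    then show ?case by (simp add: G.finsum_infinite H.finsum_infinite ahom_zero[OF G H f])
  next
    case empty
    then show ?case by (simp add: ahom_zero[OF G H f])
  next
    case (insert i I)
    then have g: "g \<in> I \<rightarrow> carrier G" by auto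
    have "(\<lambda>i. f (g i)) \<in> I \<rightarrow> carrier H" using g ahom_closed[OF f] by auto
    then show ?case
      using insert g by (simp add: G.finsum_insert H.finsum_insert ahom_add[OF f] ahom_closed[OF f] G.finsum_closed)
  qed
qed

lemma ahom_id: "(\<lambda>x. x) \<in> ahom G G"
  by (simp add: hom_def)

lemma ahom_comp: "\<lbrakk>f \<in> ahom G H; g \<in> ahom H K\<rbrakk> \<Longrightarrow> (\<lambda>x. g (f x)) \<in> ahom G K"
  by (auto simp: hom_def Pi_iff)

lemma ahom_plus:
  assumes "abelian_group H" "f \<in> ahom G H" "g \<in> ahom G H"
  shows "(\<lambda>x. f x \<oplus>\<^bsub>H\<^esub> g x) \<in> ahom G H"
proof -
  interpret H: abelian_group H by fact
  show ?thesis
    by (rule ahomI)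
      (auto simp: ahom_closed[OF assms(2)] ahom_closed[OF assms(3)] ahom_add[OF assms(2)]
        ahom_add[OF assms(3)] H.a_ac)
qed

lemma ahom_inv:
  assumes "abelian_group H" "f \<in> ahom G H"
  shows "(\<lambda>x. \<ominus>\<^bsub>H\<^esub> f x) \<in> ahom G H"
proof -
  interpret H: abelian_group H by fact
  show ?thesis
    by (rule ahomI)
      (auto simp: ahom_closed[OF assms(2)] ahom_add[OF assms(2)] H.minus_add)
qed

lemma ahom_diff:
  assumes "abelian_group H" "f \<in> ahom G H" "g \<in> ahom G H"
  shows "(\<lambda>x. f x \<ominus>\<^bsub>H\<^esub> g x) \<in> ahom G H"
  unfolding a_minus_def by (intro ahom_plus ahom_inv assms)

lemma ahom_ksign_fun:
  assumes "abelian_group H" "f \<in> ahom G H"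
  shows "(\<lambda>x. ksign H k (f x)) \<in> ahom G H"
  using ahom_inv[OF assms] assms(2) by (cases "even k") (simp_all add: ksign_def)

lemma ahom_const_zero:
  assumes "abelian_group H" shows "(\<lambda>x. \<zero>\<^bsub>H\<^esub>) \<in> ahom G H"
proof -
  interpret H: abelian_group H by fact
  show ?thesis by (rule ahomI) auto
qed

lemma ahom_cong:
  assumes "abelian_group G" "f \<in> ahom G H" "\<And>x. x \<in> carrier G \<Longrightarrow> f x = g x"
  shows "g \<in> ahom G H"
proof -
  interpret G: abelian_group G by fact
  show ?thesis
    using assms(2) by (simp add: hom_def Pi_iff assms(3)[symmetric])
qed

lemma subgroup_add_monoid:
  assumes "subgroup H (add_monoid G)"
  shows "x \<in> H \<Longrightarrow> x \<in> carrier G" "\<zero>\<^bsub>G\<^esub> \<in> H"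
    "\<lbrakk>x \<in> H; y \<in> H\<rbrakk> \<Longrightarrow> x \<oplus>\<^bsub>G\<^esub> y \<in> H" "x \<in> H \<Longrightarrow> \<ominus>\<^bsub>G\<^esub> x \<in> H"
  using subgroup.mem_carrier[OF assms] subgroup.one_closed[OF assms] subgroup.m_closed[OF assms]
    subgroup.m_inv_closed[OF assms] by (auto simp: a_inv_def)

lemma subgroup_add_monoidI:
  assumes "abelian_group G" "H \<subseteq> carrier G" "\<zero>\<^bsub>G\<^esub> \<in> H"
    "\<And>x y. \<lbrakk>x \<in> H; y \<in> H\<rbrakk> \<Longrightarrow> x \<oplus>\<^bsub>G\<^esub> y \<in> H" "\<And>x. x \<in> H \<Longrightarrow> \<ominus>\<^bsub>G\<^esub> x \<in> H"
  shows "subgroup H (add_monoid G)"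
  using assms by (intro group.subgroupI) (auto simp: abelian_group.a_group a_inv_def)

context abelian_group
begin

text \<open>Removes the term common to two Leibniz expansions.\<close>

lemma add_diff_cancel:
  assumes "x \<in> carrier G" "y \<in> carrier G" "z \<in> carrier G"
  shows "(x \<oplus> y) \<ominus> (x \<oplus> z) = y \<ominus> z" "(y \<oplus> x) \<ominus> (z \<oplus> x) = y \<ominus> z"
proof -
  have "x \<oplus> (\<ominus> x \<oplus> (y \<oplus> \<ominus> z)) = y \<oplus> \<ominus> z" using assms by (intro r_neg2) auto
  then show "(x \<oplus> y) \<ominus> (x \<oplus> z) = y \<ominus> z"
    using assms by (simp add: a_minus_def minus_add a_ac)
  then show "(y \<oplus> x) \<ominus> (z \<oplus> x) = y \<ominus> z"
    using assms by (simp add: a_comm)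
qed

text \<open>For the Leibniz rule of the universal derivation: \<open>p\<close> is
  \<open>b \<otimes> c\<close>, which occurs in both \<open>\<delta>(b) c\<close> and
  \<open>b \<delta>(c)\<close>.\<close>

lemma minus_telescope:
  assumes "q \<in> carrier G" "p \<in> carrier G" "r \<in> carrier G"
  shows "(p \<ominus> r) \<oplus> (q \<ominus> p) = q \<ominus> r"
proof -
  have "(p \<ominus> r) \<oplus> (q \<ominus> p) = (q \<oplus> \<ominus> p) \<oplus> (p \<oplus> \<ominus> r)"
    unfolding a_minus_def using assms by (intro a_comm) auto
  also have "\<dots> = q \<oplus> (\<ominus> p \<oplus> (p \<oplus> \<ominus> r))" using assms by (intro a_assoc) auto
  also have "\<ominus> p \<oplus> (p \<oplus> \<ominus> r) = \<ominus> r" using assms by (intro r_neg1) auto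
  finally show ?thesis by (simp add: a_minus_def)
qed

text \<open>The cancellation behind \<open>B\<close>-linearity of the section: \<open>u\<close> is
  \<open>x b \<otimes> 1\<close>, \<open>w\<close> is \<open>x \<otimes> b\<close>, and
  \<open>v\<close> is the image of \<open>\<psi>(x) b\<close>.\<close>

lemma minus_plus_minus:
  assumes "u \<in> carrier G" "v \<in> carrier G" "w \<in> carrier G"
  shows "u \<ominus> (v \<oplus> (u \<ominus> w)) = w \<ominus> v"
proof -
  have "v \<oplus> (u \<ominus> w) = u \<oplus> (v \<ominus> w)" using assms by (simp add: a_minus_def a_lcomm)
  then have "u \<ominus> (v \<oplus> (u \<ominus> w)) = (u \<oplus> \<zero>) \<ominus> (u \<oplus> (v \<ominus> w))" using assms by simp
  also have "\<dots> = \<zero> \<ominus> (v \<ominus> w)" using assms by (intro add_diff_cancel) (auto simp: a_minus_def)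
  also have "\<dots> = w \<ominus> v" using assms by (simp add: a_minus_def minus_add a_comm)
  finally show ?thesis .
qed

end

section \<open>Graded groups\<close>

lemma ksign_cong: "even k = even l \<Longrightarrow> ksign M k x = ksign M l x"
  by (simp add: ksign_def)

lemma ksign_even: "even k \<Longrightarrow> ksign M k x = x"
  by (simp add: ksign_def)

text \<open>Restriction of scalars, bimodule structures and direct sums yield records of different
  types on one abelian group. Sums, inverses, signs, subgroups and additive maps depend on these
  three fields only, so all of them transfer along this relation.\<close>

definition same_add :: "('m, 'y) ring_scheme \<Rightarrow> ('m, 'z) ring_scheme \<Rightarrow> bool" where
  "same_add M M' \<longleftrightarrow> carrier M = carrier M' \<and> add M = add M' \<and> zero M = zero M'"

lemma same_add_sym: "same_add M M' \<Longrightarrow> same_add M' M"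
  by (simp add: same_add_def)

lemma a_inv_cong: "same_add M M' \<Longrightarrow> \<ominus>\<^bsub>M\<^esub> x = \<ominus>\<^bsub>M'\<^esub> x"
  by (simp add: a_inv_def m_inv_def same_add_def)

lemma a_minus_cong: "same_add M M' \<Longrightarrow> x \<ominus>\<^bsub>M\<^esub> y = x \<ominus>\<^bsub>M'\<^esub> y"
  by (simp add: a_minus_def a_inv_cong) (simp add: same_add_def)

lemma ksign_struct_cong: "same_add M M' \<Longrightarrow> ksign M k x = ksign M' k x"
  by (simp add: ksign_def a_inv_cong)

lemma finsum_struct_cong: "same_add M M' \<Longrightarrow> finsum M f I = finsum M' f I"
  by (simp add: finsum_def finprod_def same_add_def)

lemma subgroup_struct_cong: "same_add M M' \<Longrightarrow> subgroup H (add_monoid M) = subgroup H (add_monoid M')"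
  by (simp add: subgroup_def m_inv_def same_add_def)

lemma ahom_struct_cong: "\<lbrakk>same_add M M'; same_add G G'\<rbrakk> \<Longrightarrow> ahom M G = ahom M' G'"
  by (simp add: hom_def same_add_def)

lemma abelian_group_cong:
  assumes s: "same_add M G" and "abelian_group G"
  shows "abelian_group M"
proof -
  interpret G: abelian_group G by fact
  note eq = s[unfolded same_add_def]
  show ?thesis
  proof (rule abelian_groupI)
    fix x assume "x \<in> carrier M"
    then show "\<exists>y\<in>carrier M. y \<oplus>\<^bsub>M\<^esub> x = \<zero>\<^bsub>M\<^esub>"
      using eq G.l_neg[of x] G.a_inv_closed[of x] by auto
  qed (simp_all add: eq G.a_ac)
qed

context abelian_group
begin

lemma ksign_closed: "x \<in> carrier G \<Longrightarrow> ksign G k x \<in> carrier G"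
  by (simp add: ksign_def)

lemma ksign_add: "\<lbrakk>x \<in> carrier G; y \<in> carrier G\<rbrakk> \<Longrightarrow> ksign G k (x \<oplus> y) = ksign G k x \<oplus> ksign G k y"
  by (simp add: ksign_def minus_add)

lemma ksign_ksign: "x \<in> carrier G \<Longrightarrow> ksign G k (ksign G l x) = ksign G (k + l) x"
  by (auto simp: ksign_def)

lemma ksign_zero: "ksign G k \<zero> = \<zero>"
  by (simp add: ksign_def)

text \<open>The locale parameter has no field for a grading, so the graded record enters separately
  as \<open>M\<close>. The finite set \<open>I\<close> may exceed the support.\<close>

lemma decomposesI:
  fixes M :: "('a, 'z) graded_scheme"
  assumes M: "same_add M G"
    and "finite I" "\<And>n. c n \<in> hcomp M n" "\<And>n. n \<notin> I \<Longrightarrow> c n = \<zero>" "\<And>n. c n \<in> carrier G"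
    and "x = (\<Oplus>n\<in>I. c n)"
  shows "decomposes M c x"
proof -
  have z: "\<zero>\<^bsub>M\<^esub> = \<zero>" using M by (simp add: same_add_def)
  have sub: "{n. c n \<noteq> \<zero>} \<subseteq> I" using assms by auto
  have "(\<Oplus>\<^bsub>M\<^esub>n\<in>{n. c n \<noteq> \<zero>}. c n) = (\<Oplus>n\<in>{n. c n \<noteq> \<zero>}. c n)"
    using M by (rule finsum_struct_cong)
  also have "\<dots> = (\<Oplus>n\<in>I. c n)"
    using assms sub by (intro add.finprod_mono_neutral_cong_left) auto
  finally show ?thesis
    using assms sub by (auto simp: decomposes_def z intro: finite_subset)
qed

end

context graded_group
begin

lemma abelian: "abelian_group M" by unfold_locales

lemma hcomp_closed: "x \<in> hcomp M n \<Longrightarrow> x \<in> carrier M"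
  using subgroup_add_monoid(1)[OF hcomp_subgroup] .

lemma hcomp_zero: "\<zero> \<in> hcomp M n"
  using subgroup_add_monoid(2)[OF hcomp_subgroup] .

lemma hcomp_add: "\<lbrakk>x \<in> hcomp M n; y \<in> hcomp M n\<rbrakk> \<Longrightarrow> x \<oplus> y \<in> hcomp M n"
  using subgroup_add_monoid(3)[OF hcomp_subgroup] .

lemma hcomp_inv: "x \<in> hcomp M n \<Longrightarrow> \<ominus> x \<in> hcomp M n"
  using subgroup_add_monoid(4)[OF hcomp_subgroup] .

lemma hcomp_ksign: "x \<in> hcomp M n \<Longrightarrow> ksign M k x \<in> hcomp M n"
  by (simp add: ksign_def hcomp_inv)

lemma decomposes_hpart: "x \<in> carrier M \<Longrightarrow> decomposes M (\<lambda>n. hpart M n x) x"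
  unfolding hpart_def using theI'[OF ex1_decomposition, of x] by simp

lemma decomposes_closed: "decomposes M c x \<Longrightarrow> x \<in> carrier M"
  unfolding decomposes_def by (metis (no_types, lifting) Pi_I finsum_closed hcomp_closed)

lemma decomposes_unique: "decomposes M c x \<Longrightarrow> hpart M n x = c n"
  using ex1_decomposition[OF decomposes_closed] decomposes_hpart[OF decomposes_closed] by metis

lemma hpart_hcomp: "x \<in> hcomp M i \<Longrightarrow> hpart M n x = (if n = i then x else \<zero>)"
  by (rule decomposes_unique, rule decomposesI[of M "{i}"])
    (auto simp: same_add_def hcomp_zero hcomp_closed finsum_insert)

lemma hpart_mem: "x \<in> carrier M \<Longrightarrow> hpart M n x \<in> hcomp M n"
  using decomposes_hpart by (auto simp: decomposes_def)

lemma hpart_closed: "x \<in> carrier M \<Longrightarrow> hpart M n x \<in> carrier M"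
  using hpart_mem hcomp_closed by blast

lemma hsupp_finite: "x \<in> carrier M \<Longrightarrow> finite (hsupp M x)"
  using decomposes_hpart by (auto simp: decomposes_def hsupp_def)

lemma hpart_sum: "x \<in> carrier M \<Longrightarrow> (\<Oplus>n\<in>hsupp M x. hpart M n x) = x"
  using decomposes_hpart[of x] by (auto simp: decomposes_def hsupp_def)

lemma hpart_sum': 
  assumes "x \<in> carrier M" "finite I" "hsupp M x \<subseteq> I"
  shows "(\<Oplus>n\<in>I. hpart M n x) = x"
proof -
  have "(\<Oplus>n\<in>hsupp M x. hpart M n x) = (\<Oplus>n\<in>I. hpart M n x)"
    using assms by (intro add.finprod_mono_neutral_cong_left) (auto simp: hsupp_def hpart_closed)
  then show ?thesis using assms(1) by (simp add: hpart_sum)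
qed

lemma hpart_add:
  assumes "x \<in> carrier M" "y \<in> carrier M"
  shows "hpart M n (x \<oplus> y) = hpart M n x \<oplus> hpart M n y"
proof -
  let ?I = "hsupp M x \<union> hsupp M y"
  have I: "finite ?I" using assms by (simp add: hsupp_finite)
  have "x \<oplus> y = (\<Oplus>n\<in>?I. hpart M n x) \<oplus> (\<Oplus>n\<in>?I. hpart M n y)"
    using assms I by (simp add: hpart_sum')
  also have "\<dots> = (\<Oplus>n\<in>?I. hpart M n x \<oplus> hpart M n y)"
    using assms by (intro finsum_addf[symmetric]) (auto simp: hpart_closed)
  finally have "decomposes M (\<lambda>n. hpart M n x \<oplus> hpart M n y) (x \<oplus> y)"
    using assms I by (intro decomposesI[of _ ?I]) (auto simp: same_add_def hpart_mem hcomp_add hsupp_def hpart_closed)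
  then show ?thesis by (rule decomposes_unique)
qed

lemma hpart_ahom: "hpart M n \<in> ahom M M"
  by (rule ahomI) (auto simp: hpart_closed hpart_add)

lemma hsupp_hcomp: "x \<in> hcomp M i \<Longrightarrow> hsupp M x \<subseteq> {i}"
  by (auto simp: hsupp_def hpart_hcomp split: if_splits)

text \<open>Every element is a finite sum of its components. Together with
  \<open>graded_ahom_eqI\<close> this is how sign identities are reduced to homogeneous
  elements.\<close>

lemma graded_induct [consumes 1, case_names homogeneous add]:
  assumes "x \<in> carrier M" "\<And>i x. x \<in> hcomp M i \<Longrightarrow> P x"
    "\<And>x y. \<lbrakk>x \<in> carrier M; y \<in> carrier M; P x; P y\<rbrakk> \<Longrightarrow> P (x \<oplus> y)"
  shows "P x"
proof -
  have "finite J \<Longrightarrow> P (\<Oplus>n\<in>J. hpart M n x)" for J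
  proof (induction J rule: finite_induct)
    case empty
    then show ?case using assms(2)[OF hcomp_zero] by simp
  next
    case (insert j J)
    then show ?case
      using assms(1) by (simp add: finsum_insert hpart_closed Pi_iff assms(2)[OF hpart_mem] assms(3) finsum_closed)
  qed
  from this[OF hsupp_finite[OF assms(1)]] show ?thesis using assms(1) by (simp add: hpart_sum)
qed

lemma graded_ahom_eqI:
  assumes "f \<in> ahom M G" "g \<in> ahom M G" "x \<in> carrier M"
    "\<And>i x. x \<in> hcomp M i \<Longrightarrow> f x = g x"
  shows "f x = g x"
  using assms(3) by (induction x rule: graded_induct) (auto simp: assms ahom_add[OF assms(1)] ahom_add[OF assms(2)])

lemma hsum_superset:
  assumes G: "abelian_group G" and F: "\<And>i. F i \<in> ahom M G" and x: "x \<in> carrier M"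
    and I: "finite I" "hsupp M x \<subseteq> I"
  shows "(\<Oplus>\<^bsub>G\<^esub>i\<in>hsupp M x. F i (hpart M i x)) = (\<Oplus>\<^bsub>G\<^esub>i\<in>I. F i (hpart M i x))"
proof -
  interpret G: abelian_group G by fact
  show ?thesis
    by (rule G.add.finprod_mono_neutral_cong_left)
      (use assms ahom_closed[OF F] ahom_zero[OF abelian G F] in \<open>auto simp: hsupp_def hpart_closed\<close>)
qed

text \<open>The general form of a map whose formula depends on the degree of its argument, such as
  \<open>twist\<close>. The index set \<open>hsupp M x\<close> varies with \<open>x\<close>, so sums
  have to be compared over a common finite set.\<close>

lemma hsum_ahom:
  assumes G: "abelian_group G" and F: "\<And>i. F i \<in> ahom M G"
  shows "(\<lambda>x. \<Oplus>\<^bsub>G\<^esub>i\<in>hsupp M x. F i (hpart M i x)) \<in> ahom M G"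
proof -
  interpret G: abelian_group G by fact
  note Fc = ahom_closed[OF F] and Fa = ahom_add[OF F]
  show ?thesis
  proof (rule ahomI)
    fix x y assume xy: "x \<in> carrier M" "y \<in> carrier M"
    \<comment> \<open>Including the support of the sum itself spares the comparison with the other
      two supports.\<close>
    let ?I = "hsupp M x \<union> hsupp M y \<union> hsupp M (x \<oplus> y)"
    have I: "finite ?I" using xy by (simp add: hsupp_finite)
    have "(\<Oplus>\<^bsub>G\<^esub>i\<in>hsupp M (x \<oplus> y). F i (hpart M i (x \<oplus> y))) = (\<Oplus>\<^bsub>G\<^esub>i\<in>?I. F i (hpart M i (x \<oplus> y)))"
      using xy I by (intro hsum_superset G F) auto
    also have "\<dots> = (\<Oplus>\<^bsub>G\<^esub>i\<in>?I. F i (hpart M i x) \<oplus>\<^bsub>G\<^esub> F i (hpart M i y))"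
      using xy by (simp add: hpart_add Fa hpart_closed)
    also have "\<dots> = (\<Oplus>\<^bsub>G\<^esub>i\<in>?I. F i (hpart M i x)) \<oplus>\<^bsub>G\<^esub> (\<Oplus>\<^bsub>G\<^esub>i\<in>?I. F i (hpart M i y))"
      using xy by (intro G.finsum_addf) (auto simp: hpart_closed Fc)
    also have "\<dots> = (\<Oplus>\<^bsub>G\<^esub>i\<in>hsupp M x. F i (hpart M i x)) \<oplus>\<^bsub>G\<^esub> (\<Oplus>\<^bsub>G\<^esub>i\<in>hsupp M y. F i (hpart M i y))"
      using xy I by (intro arg_cong2[where f="add G"] hsum_superset[symmetric] G F) auto
    finally show "(\<Oplus>\<^bsub>G\<^esub>i\<in>hsupp M (x \<oplus> y). F i (hpart M i (x \<oplus> y)))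
        = (\<Oplus>\<^bsub>G\<^esub>i\<in>hsupp M x. F i (hpart M i x)) \<oplus>\<^bsub>G\<^esub> (\<Oplus>\<^bsub>G\<^esub>i\<in>hsupp M y. F i (hpart M i y))" .
  qed (auto intro!: G.finsum_closed simp: Fc hpart_closed)
qed

lemma hsum_hcomp:
  assumes G: "abelian_group G" and F: "\<And>i. F i \<in> ahom M G" and x: "x \<in> hcomp M i"
  shows "(\<Oplus>\<^bsub>G\<^esub>i\<in>hsupp M x. F i (hpart M i x)) = F i x"
proof -
  interpret G: abelian_group G by fact
  have "(\<Oplus>\<^bsub>G\<^esub>i\<in>hsupp M x. F i (hpart M i x)) = (\<Oplus>\<^bsub>G\<^esub>i\<in>{i}. F i (hpart M i x))"
    using x hsupp_hcomp[OF x] by (intro hsum_superset G F) (auto simp: hcomp_closed)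
  then show ?thesis using x ahom_closed[OF F, of x i] by (simp add: hpart_hcomp hcomp_closed)
qed

lemma ksign_ahom: "ksign M k \<in> ahom M M"
  by (rule ahomI) (auto simp: ksign_closed ksign_add)

lemma twist_ahom: "twist M k \<in> ahom M M"
  unfolding twist_def[abs_def] by (rule hsum_ahom[OF abelian ksign_ahom])

lemma twist_hcomp: "x \<in> hcomp M i \<Longrightarrow> twist M k x = ksign M (k * i) x"
  unfolding twist_def[abs_def] using hsum_hcomp[where F="\<lambda>n. ksign M (k * n)", OF abelian ksign_ahom] by simp

lemma twist_closed: "x \<in> carrier M \<Longrightarrow> twist M k x \<in> carrier M"
  using ahom_closed[OF twist_ahom] .

lemma twist_twist: "x \<in> carrier M \<Longrightarrow> twist M k (twist M k x) = x"
proof (rule graded_ahom_eqI[where f = "\<lambda>x. twist M k (twist M k x)" and G = M])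
  fix i x assume "x \<in> hcomp M i"
  then show "twist M k (twist M k x) = x"
    by (simp add: twist_hcomp[OF hcomp_ksign] twist_hcomp ksign_ksign hcomp_closed ksign_even)
qed (auto intro: ahom_comp twist_ahom ahom_id)

lemma twist_add: "x \<in> carrier M \<Longrightarrow> twist M k (twist M l x) = twist M (k + l) x"
proof (rule graded_ahom_eqI[where f = "\<lambda>x. twist M k (twist M l x)" and G = M])
  fix i x assume "x \<in> hcomp M i"
  then show "twist M k (twist M l x) = twist M (k + l) x"
    by (simp add: twist_hcomp[OF hcomp_ksign] twist_hcomp ksign_ksign hcomp_closed algebra_simps)
qed (auto intro: ahom_comp twist_ahom)

text \<open>For homogeneous \<open>x\<close> the degrees of \<open>f x\<close> and \<open>x\<close>
  differ by \<open>n\<close>, so the two signs differ by the parity of \<open>k * n\<close>.\<close>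

lemma twist_commute:
  assumes T: "graded_group T" and f: "f \<in> ahom M T" and d: "\<And>i x. x \<in> hcomp M i \<Longrightarrow> f x \<in> hcomp T (i + n)"
    and x: "x \<in> carrier M"
  shows "twist T k (f x) = ksign T (k * n) (f (twist M k x))"
proof -
  interpret T: graded_group T by fact
  show ?thesis
  proof (rule graded_ahom_eqI[where f = "\<lambda>x. twist T k (f x)" and G = T])
    fix i x assume "x \<in> hcomp M i"
    then show "twist T k (f x) = ksign T (k * n) (f (twist M k x))"
      by (simp add: twist_hcomp T.twist_hcomp[OF d] ahom_ksign[OF abelian T.abelian f] hcomp_closed
        T.ksign_ksign ahom_closed[OF f] algebra_simps)
  qed (intro ahom_comp[OF f T.twist_ahom] ahom_ksign_fun[OF T.abelian] ahom_comp[OF twist_ahom f] x)+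
qed

end

lemma twist_cong: "even k = even l \<Longrightarrow> twist M k x = twist M l x"
proof -
  assume "even k = even l"
  then have "ksign M (k * n) = ksign M (l * n)" for n :: int by (auto simp: ksign_def)
  then show ?thesis by (simp add: twist_def)
qed

text \<open>The maps \<open>p n\<close> play the role of the projections onto the homogeneous components.\<close>

lemma graded_groupI:
  fixes M :: "('m, 'z) graded_scheme" and G :: "('m, 'y) ring_scheme"
  assumes M: "abelian_group M" and G: "abelian_group G"
    and sub: "\<And>n. subgroup (hcomp M n) (add_monoid M)"
    and p: "\<And>n. p n \<in> ahom M G"
    and p1: "\<And>n x. x \<in> hcomp M n \<Longrightarrow> p n x = x"
    and p0: "\<And>n k x. \<lbrakk>x \<in> hcomp M k; k \<noteq> n\<rbrakk> \<Longrightarrow> p n x = \<zero>\<^bsub>G\<^esub>"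
    and ind: "\<And>P x. \<lbrakk>x \<in> carrier M; \<And>n x. x \<in> hcomp M n \<Longrightarrow> P x;
        \<And>x y. \<lbrakk>x \<in> carrier M; y \<in> carrier M; P x; P y\<rbrakk> \<Longrightarrow> P (x \<oplus>\<^bsub>M\<^esub> y)\<rbrakk> \<Longrightarrow> P x"
  shows "graded_group M"
proof -
  interpret M: abelian_group M by fact
  interpret G: abelian_group G by fact
  have c: "x \<in> carrier M" if "x \<in> hcomp M n" for x n
    using subgroup_add_monoid(1)[OF sub that] .
  \<comment> \<open>Applying \<open>p n\<close> to a decomposition kills every summand outside
    degree \<open>n\<close>, which forces the component.\<close>
  have unique: "d n = p n x" if "decomposes M d x" for d x n
  proof -
    let ?I = "insert n {n. d n \<noteq> \<zero>\<^bsub>M\<^esub>}"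
    have d: "d n \<in> hcomp M n" for n using that by (auto simp: decomposes_def)
    have fin: "finite ?I" using that by (auto simp: decomposes_def)
    have "x = (\<Oplus>\<^bsub>M\<^esub>n\<in>{n. d n \<noteq> \<zero>\<^bsub>M\<^esub>}. d n)" using that by (auto simp: decomposes_def)
    also have "\<dots> = (\<Oplus>\<^bsub>M\<^esub>n\<in>?I. d n)"
      using fin c[OF d] by (intro M.add.finprod_mono_neutral_cong_left) auto
    finally have "p n x = (\<Oplus>\<^bsub>G\<^esub>k\<in>?I. p n (d k))"
      using ahom_finsum[OF M G p, where g = d] c[OF d] by metis
    also have "\<dots> = (\<Oplus>\<^bsub>G\<^esub>k\<in>{n}. p n (d k))"
      using fin c[OF d] p0[OF d] ahom_closed[OF p]
      by (intro G.add.finprod_mono_neutral_cong_right) auto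
    also have "\<dots> = d n"
      using p1[OF d] ahom_closed[OF p c[OF d], of n n] by simp
    finally show ?thesis by simp
  qed
  have "\<exists>d. decomposes M d x" if "x \<in> carrier M" for x
    using that
  proof (rule ind)
    fix n x assume "x \<in> hcomp M n"
    then have "decomposes M (\<lambda>k. if k = n then x else \<zero>\<^bsub>M\<^esub>) x"
      by (intro M.decomposesI[of _ "{n}"]) (auto simp: same_add_def c subgroup_add_monoid(2)[OF sub] M.finsum_insert)
    then show "\<exists>d. decomposes M d x" by blast
  next
    fix x y assume "\<exists>d. decomposes M d x" "\<exists>d. decomposes M d y" and xy: "x \<in> carrier M" "y \<in> carrier M"
    then obtain d e where d: "decomposes M d x" and e: "decomposes M e y" by blast
    let ?I = "{n. d n \<noteq> \<zero>\<^bsub>M\<^esub>} \<union> {n. e n \<noteq> \<zero>\<^bsub>M\<^esub>}"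
    have fin: "finite ?I" using d e by (auto simp: decomposes_def)
    have dh: "d n \<in> hcomp M n" "e n \<in> hcomp M n" for n using d e by (auto simp: decomposes_def)
    have "(\<Oplus>\<^bsub>M\<^esub>n\<in>?I. d n \<oplus>\<^bsub>M\<^esub> e n) = (\<Oplus>\<^bsub>M\<^esub>n\<in>?I. d n) \<oplus>\<^bsub>M\<^esub> (\<Oplus>\<^bsub>M\<^esub>n\<in>?I. e n)"
      using c[OF dh(1)] c[OF dh(2)] by (intro M.finsum_addf) auto
    also have "(\<Oplus>\<^bsub>M\<^esub>n\<in>?I. d n) = (\<Oplus>\<^bsub>M\<^esub>n\<in>{n. d n \<noteq> \<zero>\<^bsub>M\<^esub>}. d n)"
      using fin c[OF dh(1)] by (intro M.add.finprod_mono_neutral_cong_right) auto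
    also have "\<dots> = x" using d by (simp add: decomposes_def)
    also have "(\<Oplus>\<^bsub>M\<^esub>n\<in>?I. e n) = (\<Oplus>\<^bsub>M\<^esub>n\<in>{n. e n \<noteq> \<zero>\<^bsub>M\<^esub>}. e n)"
      using fin c[OF dh(2)] by (intro M.add.finprod_mono_neutral_cong_right) auto
    also have "\<dots> = y" using e by (simp add: decomposes_def)
    finally have "decomposes M (\<lambda>n. d n \<oplus>\<^bsub>M\<^esub> e n) (x \<oplus>\<^bsub>M\<^esub> y)"
      using fin c[OF dh(1)] c[OF dh(2)] subgroup_add_monoid(3)[OF sub] dh
      by (intro M.decomposesI[of _ ?I]) (auto simp: same_add_def)
    then show "\<exists>d. decomposes M d (x \<oplus>\<^bsub>M\<^esub> y)" by blast
  qed
  moreover have "d = e" if "decomposes M d x" "decomposes M e x" for d e x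
    using unique[OF that(1)] unique[OF that(2)] by auto
  ultimately show ?thesis
    using sub M by (auto simp: graded_group_def graded_group_axioms_def)
qed

lemma twist_struct_cong:
  assumes "same_add M M'" "hcomp M = hcomp M'"
  shows "twist M k x = twist M' k x" "hpart M n x = hpart M' n x" "hsupp M x = hsupp M' x"
    "decomposes M c x = decomposes M' c x"
proof -
  note eq = assms(1)[unfolded same_add_def]
  have fs: "finsum M f I = finsum M' f I" for f :: "int \<Rightarrow> 'a" and I using assms(1) by (rule finsum_struct_cong)
  show d: "decomposes M c x = decomposes M' c x" for c x unfolding decomposes_def by (simp add: eq assms fs)
  show h: "hpart M n x = hpart M' n x" for n by (simp add: hpart_def d)
  show s: "hsupp M x = hsupp M' x" by (simp add: hsupp_def eq h)
  show "twist M k x = twist M' k x" by (simp add: twist_def s h fs ksign_struct_cong[OF assms(1)])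
qed

lemma graded_group_cong:
  assumes "same_add M M'" "hcomp M = hcomp M'" "graded_group M'"
  shows "graded_group M"
proof -
  interpret graded_group M' by fact
  show ?thesis
    using assms(1)[unfolded same_add_def] subgroup_struct_cong[OF assms(1)] twist_struct_cong(4)[OF assms(1,2)] ex1_decomposition hcomp_subgroup assms
      abelian_group_cong[OF assms(1) abelian]
    by (auto simp: graded_group_def graded_group_axioms_def)
qed

section \<open>Biadditive maps\<close>

definition biadd :: "('m, 'x) ring_scheme \<Rightarrow> ('l, 'y) ring_scheme \<Rightarrow> ('g, 'z) ring_scheme
    \<Rightarrow> ('m \<Rightarrow> 'l \<Rightarrow> 'g) \<Rightarrow> bool" where
  "biadd M L G g \<longleftrightarrow>
     (\<forall>l\<in>carrier L. (\<lambda>m. g m l) \<in> ahom M G) \<and> (\<forall>m\<in>carrier M. g m \<in> ahom L G)"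

lemma biaddI:
  assumes "\<And>m l. \<lbrakk>m \<in> carrier M; l \<in> carrier L\<rbrakk> \<Longrightarrow> g m l \<in> carrier G"
    and "\<And>m m' l. \<lbrakk>m \<in> carrier M; m' \<in> carrier M; l \<in> carrier L\<rbrakk> \<Longrightarrow> g (m \<oplus>\<^bsub>M\<^esub> m') l = g m l \<oplus>\<^bsub>G\<^esub> g m' l"
    and "\<And>m l l'. \<lbrakk>m \<in> carrier M; l \<in> carrier L; l' \<in> carrier L\<rbrakk> \<Longrightarrow> g m (l \<oplus>\<^bsub>L\<^esub> l') = g m l \<oplus>\<^bsub>G\<^esub> g m l'"
  shows "biadd M L G g"
  using assms by (auto simp: biadd_def hom_def)

lemma biadd_left: "\<lbrakk>biadd M L G g; l \<in> carrier L\<rbrakk> \<Longrightarrow> (\<lambda>m. g m l) \<in> ahom M G"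
  by (simp add: biadd_def)

lemma biadd_right: "\<lbrakk>biadd M L G g; m \<in> carrier M\<rbrakk> \<Longrightarrow> (\<lambda>l. g m l) \<in> ahom L G"
  by (simp add: biadd_def)

lemma biadd_closed: "\<lbrakk>biadd M L G g; m \<in> carrier M; l \<in> carrier L\<rbrakk> \<Longrightarrow> g m l \<in> carrier G"
  by (auto simp: biadd_def hom_def)

lemma biadd_ksign:
  assumes "abelian_group M" "abelian_group L" "abelian_group G" "biadd M L G g"
    "m \<in> carrier M" "l \<in> carrier L"
  shows "g (ksign M k m) l = ksign G k (g m l)" "g m (ksign L k l) = ksign G k (g m l)"
  using ahom_ksign[OF assms(1,3) biadd_left[OF assms(4,6)] assms(5)]
    ahom_ksign[OF assms(2,3) biadd_right[OF assms(4,5)] assms(6)] by auto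

lemma biadd_comp:
  assumes g: "biadd M L G g" and f: "f \<in> ahom M' M" and h: "h \<in> ahom L' L"
  shows "biadd M' L' G (\<lambda>m l. g (f m) (h l))"
  unfolding biadd_def
  using ahom_comp[OF f biadd_left[OF g ahom_closed[OF h]]]
    ahom_comp[OF h biadd_right[OF g ahom_closed[OF f]]] by blast

lemma biadd_post:
  assumes g: "biadd M L G g" and f: "f \<in> ahom G H"
  shows "biadd M L H (\<lambda>m l. f (g m l))"
  unfolding biadd_def
  using ahom_comp[OF biadd_left[OF g] f] ahom_comp[OF biadd_right[OF g] f] by blast

lemma biadd_plus:
  assumes "abelian_group G" "biadd M L G g" "biadd M L G h"
  shows "biadd M L G (\<lambda>m l. g m l \<oplus>\<^bsub>G\<^esub> h m l)"
  using assms by (auto simp: biadd_def intro!: ahom_plus)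

lemma biadd_flip: "biadd M L G g \<Longrightarrow> biadd L M G (\<lambda>l m. g m l)"
  by (auto simp: biadd_def)

lemma biadd_cong:
  assumes M: "abelian_group M" and L: "abelian_group L" and g: "biadd M L G g"
    and eq: "\<And>m l. \<lbrakk>m \<in> carrier M; l \<in> carrier L\<rbrakk> \<Longrightarrow> g m l = h m l"
  shows "biadd M L G h"
  unfolding biadd_def
proof (intro conjI ballI)
  show "(\<lambda>m. h m l) \<in> ahom M G" if "l \<in> carrier L" for l
    by (rule ahom_cong[OF M biadd_left[OF g that] eq[OF _ that]])
  show "h m \<in> ahom L G" if "m \<in> carrier M" for m
    by (rule ahom_cong[OF L biadd_right[OF g that] eq[OF that]])
qed

lemma biadd_struct_cong:
  "\<lbrakk>same_add M M'; same_add L L'; same_add G G'\<rbrakk> \<Longrightarrow> biadd M L G g = biadd M' L' G' g"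
  by (simp add: biadd_def ahom_struct_cong[of M M' G G'] ahom_struct_cong[of L L' G G']) (simp add: same_add_def)

lemma biadd_eqI:
  assumes "graded_group M" "graded_group L" "biadd M L G g" "biadd M L G h"
    and eq: "\<And>i j m l. \<lbrakk>m \<in> hcomp M i; l \<in> hcomp L j\<rbrakk> \<Longrightarrow> g m l = h m l"
    and "m \<in> carrier M" "l \<in> carrier L"
  shows "g m l = h m l"
proof -
  interpret M: graded_group M by fact
  interpret L: graded_group L by fact
  show ?thesis
  proof (rule M.graded_ahom_eqI[where f = "\<lambda>m. g m l" and g = "\<lambda>m. h m l" and G = G])
    fix i m assume m: "m \<in> hcomp M i"
    show "g m l = h m l"
      by (rule L.graded_ahom_eqI[where f = "g m" and G = G])
        (intro biadd_right[OF assms(3)] biadd_right[OF assms(4)] assms(7) M.hcomp_closed[OF m] eq[OF m] | assumption)+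
  qed (intro biadd_left[OF assms(3)] biadd_left[OF assms(4)] assms(6,7))+
qed

text \<open>Serves every two-variable formula that depends on the degree of the left argument:
  \<open>left_action\<close>, the product of the enveloping algebra, \<open>proj\<close> and
  \<open>der_pt\<close>.\<close>

lemma biadd_hsum_left:
  assumes M: "graded_group M" and G: "abelian_group G" and F: "\<And>i. biadd M L G (F i)"
    and L: "abelian_group L"
  shows "biadd M L G (\<lambda>m l. \<Oplus>\<^bsub>G\<^esub>i\<in>hsupp M m. F i (hpart M i m) l)"
proof -
  interpret M: graded_group M by fact
  interpret G: abelian_group G by fact
  note Fc = biadd_closed[OF F]
  show ?thesis
    unfolding biadd_def
  proof (intro conjI ballI)
    fix l assume "l \<in> carrier L"
    then show "(\<lambda>m. \<Oplus>\<^bsub>G\<^esub>i\<in>hsupp M m. F i (hpart M i m) l) \<in> ahom M G"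
      using M.hsum_ahom[OF G, where F="\<lambda>i m. F i m l"] biadd_left[OF F] by blast
  next
    fix m assume m: "m \<in> carrier M"
    show "(\<lambda>l. \<Oplus>\<^bsub>G\<^esub>i\<in>hsupp M m. F i (hpart M i m) l) \<in> ahom L G"
    proof (rule ahomI)
      fix x y assume xy: "x \<in> carrier L" "y \<in> carrier L"
      have "(\<Oplus>\<^bsub>G\<^esub>i\<in>hsupp M m. F i (hpart M i m) (x \<oplus>\<^bsub>L\<^esub> y))
        = (\<Oplus>\<^bsub>G\<^esub>i\<in>hsupp M m. F i (hpart M i m) x \<oplus>\<^bsub>G\<^esub> F i (hpart M i m) y)"
        using xy m by (simp add: ahom_add[OF biadd_right[OF F]] M.hpart_closed)
      also have "\<dots> = (\<Oplus>\<^bsub>G\<^esub>i\<in>hsupp M m. F i (hpart M i m) x) \<oplus>\<^bsub>G\<^esub> (\<Oplus>\<^bsub>G\<^esub>i\<in>hsupp M m. F i (hpart M i m) y)"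
        using xy m by (intro G.finsum_addf) (auto simp: Fc M.hpart_closed)
      finally show "(\<Oplus>\<^bsub>G\<^esub>i\<in>hsupp M m. F i (hpart M i m) (x \<oplus>\<^bsub>L\<^esub> y))
        = (\<Oplus>\<^bsub>G\<^esub>i\<in>hsupp M m. F i (hpart M i m) x) \<oplus>\<^bsub>G\<^esub> (\<Oplus>\<^bsub>G\<^esub>i\<in>hsupp M m. F i (hpart M i m) y)" .
    qed (use m in \<open>auto intro!: G.finsum_closed simp: Fc M.hpart_closed\<close>)
  qed
qed

lemma biadd_hsum_left_hcomp:
  assumes "graded_group M" "abelian_group G" "\<And>i. biadd M L G (F i)" "m \<in> hcomp M i" "l \<in> carrier L"
  shows "(\<Oplus>\<^bsub>G\<^esub>i\<in>hsupp M m. F i (hpart M i m) l) = F i m l"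
  using graded_group.hsum_hcomp[OF assms(1,2), where F="\<lambda>i m. F i m l"] biadd_left[OF assms(3,5)] assms(4) by blast

section \<open>Modules over graded commutative algebras\<close>

lemma restrict_scalars_simps [simp]:
  "carrier (restrict_scalars f M) = carrier M" "add (restrict_scalars f M) = add M"
  "zero (restrict_scalars f M) = zero M" "hcomp (restrict_scalars f M) = hcomp M"
  "diff (restrict_scalars f M) = diff M" "ract (restrict_scalars f M) = (\<lambda>m a. ract M m (f a))"
  by (simp_all add: restrict_scalars_def dgrp.defs)

lemma regular_simps [simp]:
  "carrier (regular M) = carrier M" "add (regular M) = add M"
  "zero (regular M) = zero M" "hcomp (regular M) = hcomp M"
  "diff (regular M) = diff M" "ract (regular M) = mult M"
  by (simp_all add: regular_def dgrp.defs)

lemma same_add_restrict: "same_add (restrict_scalars f M) M"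
  by (simp add: same_add_def)

lemma twist_restrict [simp]: "twist (restrict_scalars f M) k x = twist M k x"
  by (rule twist_struct_cong) (simp_all add: same_add_def)

lemma twist_regular [simp]: "twist (regular M) k x = twist M k x"
  by (rule twist_struct_cong) (simp_all add: same_add_def)

lemma ksign_restrict [simp]: "ksign (restrict_scalars f M) k x = ksign M k x"
  by (rule ksign_struct_cong) (simp_all add: same_add_def)

lemma ksign_regular [simp]: "ksign (regular M) k x = ksign M k x"
  by (rule ksign_struct_cong) (simp_all add: same_add_def)

text \<open>Weaker than \<open>dg_algebra_hom\<close>: it makes sense for the bare ring with grading
  and differential of \<open>enveloping A B \<phi>\<close>, the target of \<open>e1\<close> and
  \<open>e2\<close> below.\<close>

definition dg_ring_hom :: "('a, 'y) dgrp_scheme \<Rightarrow> ('b, 'z) dgrp_scheme \<Rightarrow> ('a \<Rightarrow> 'b) \<Rightarrow> bool" where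
  "dg_ring_hom A B f \<longleftrightarrow> f \<in> ring_hom A B \<and> (\<forall>n. f ` hcomp A n \<subseteq> hcomp B n) \<and>
     (\<forall>a\<in>carrier A. f (diff A a) = diff B (f a))"

context dg_group
begin

lemma diff_closed: "x \<in> carrier M \<Longrightarrow> diff M x \<in> carrier M"
  using ahom_closed[OF diff_hom] .

lemma diff_hcomp: "x \<in> hcomp M n \<Longrightarrow> diff M x \<in> hcomp M (n - 1)"
  using diff_degree by blast

lemma diff_add: "\<lbrakk>x \<in> carrier M; y \<in> carrier M\<rbrakk> \<Longrightarrow> diff M (x \<oplus> y) = diff M x \<oplus> diff M y"
  using ahom_add[OF diff_hom] .

lemma diff_ksign: "x \<in> carrier M \<Longrightarrow> diff M (ksign M k x) = ksign M k (diff M x)"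
  using ahom_ksign[OF abelian abelian diff_hom] .

lemma diff_twist: "x \<in> carrier M \<Longrightarrow> twist M k (diff M x) = ksign M k (diff M (twist M k x))"
  using twist_commute[OF graded_group_axioms diff_hom, where n="-1" and k=k] diff_hcomp
  by (simp add: ksign_def)

end

lemma dg_group_cong:
  assumes "same_add M M'" "hcomp M = hcomp M'" "diff M = diff M'" "dg_group M'"
  shows "dg_group M"
proof -
  interpret dg_group M' by fact
  have "graded_group M" using assms(1,2) graded_group_axioms by (rule graded_group_cong)
  then show ?thesis
    using assms(1)[unfolded same_add_def] ahom_struct_cong[OF assms(1,1)] assms(2,3) diff_hom diff_degree diff_diff
    by (simp add: dg_group_def dg_group_axioms_def)
qed

context graded_module
begin

lemma ract_biadd: "biadd M A M (ract M)"
  by (rule biaddI) (auto simp: ract_closed ract_add_left ract_add_right)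

end

lemma dg_ring_hom_ahom: "dg_ring_hom A B f \<Longrightarrow> f \<in> ahom A B"
  by (rule ahomI) (auto simp: dg_ring_hom_def ring_hom_def)

lemma dg_module_restrict_scalars:
  assumes "dg_module B M" "dg_ring_hom A B f" "\<And>n x. x \<in> hcomp A n \<Longrightarrow> x \<in> carrier A"
  shows "dg_module A (restrict_scalars f M)"
proof -
  interpret M: dg_module B M by fact
  have f: "f a \<in> carrier B" "f (a \<oplus>\<^bsub>A\<^esub> b) = f a \<oplus>\<^bsub>B\<^esub> f b" "f (a \<otimes>\<^bsub>A\<^esub> b) = f a \<otimes>\<^bsub>B\<^esub> f b" "f \<one>\<^bsub>A\<^esub> = \<one>\<^bsub>B\<^esub>"
    "f (diff A a) = diff B (f a)" if "a \<in> carrier A" "b \<in> carrier A" for a b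
    using assms(2) that by (auto simp: dg_ring_hom_def ring_hom_def)
  have f1: "f \<one>\<^bsub>A\<^esub> = \<one>\<^bsub>B\<^esub>" using assms(2) by (auto simp: dg_ring_hom_def ring_hom_def)
  have fh: "f a \<in> hcomp B n" if "a \<in> hcomp A n" for a n
    using assms(2) that by (auto simp: dg_ring_hom_def)
  have "dg_group (restrict_scalars f M)"
    by (rule dg_group_cong[OF _ _ _ M.dg_group_axioms]) (simp_all add: same_add_def)
  then show ?thesis
    using M.graded_module_axioms
    by (auto simp: dg_module_def graded_module_def dg_group_def graded_module_axioms_def dg_module_axioms_def
        f f1 fh assms(3)) (metis M.module_Leibniz assms(3) f(5) fh)
qed

context dg_algebra
begin

lemma comm_ksign: "\<lbrakk>a \<in> hcomp A i; b \<in> hcomp A j\<rbrakk> \<Longrightarrow> b \<otimes> a = ksign A (i * j) (a \<otimes> b)"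
  using graded_comm[of b j a i] by (simp add: mult.commute)

lemma mult_biadd: "biadd A A A (\<otimes>)"
  by (rule biaddI) (auto simp: l_distr r_distr)

lemma ksign_mult:
  assumes "a \<in> carrier A" "b \<in> carrier A"
  shows "ksign A k a \<otimes> b = ksign A k (a \<otimes> b)" "a \<otimes> ksign A k b = ksign A k (a \<otimes> b)"
  using biadd_ksign[OF abelian abelian abelian mult_biadd assms] by auto

text \<open>The Leibniz rule for \<open>1 = 1 1\<close>, without sign since 1 has degree 0, makes
  \<open>d 1\<close> equal to its own double.\<close>

lemma diff_one: "diff A \<one> = \<zero>"
proof -
  have "diff A \<one> = diff A \<one> \<oplus> diff A \<one>"
    using Leibniz[OF one_hcomp one_hcomp] diff_closed[OF one_closed] by (simp add: ksign_def)
  then show ?thesis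
    using diff_closed[OF one_closed] by (metis add.r_cancel_one' one_closed)
qed

lemma dg_module_regular: "dg_module A (regular A)"
proof -
  have "dg_group (regular A)"
    by (rule dg_group_cong[OF _ _ _ dg_group_axioms]) (simp_all add: same_add_def)
  then show ?thesis
    by (auto simp: dg_module_def graded_module_def dg_group_def graded_module_axioms_def dg_module_axioms_def
        l_distr r_distr m_assoc mult_hcomp Leibniz)
qed

end

locale dg_alg_module = S: dg_algebra R S + dg_module S L
  for R :: "('r, 'y) ring_scheme" and S :: "('r, 's, 'z) dg_alg_scheme" and L :: "('s, 'l, 'w) dg_rmod_scheme"
begin

lemma ract_ksign:
  assumes "l \<in> carrier L" "s \<in> carrier S"
  shows "ract L (ksign L k l) s = ksign L k (ract L l s)" "ract L l (ksign S k s) = ksign L k (ract L l s)"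
  using biadd_ksign[OF abelian S.abelian abelian ract_biadd assms] by auto

lemma left_biadd: "biadd S L L (left_action S L)"
  unfolding left_action_def[abs_def]
  by (rule biadd_hsum_left[OF S.graded_group_axioms abelian _ abelian])
    (rule biadd_flip, rule biadd_comp[OF ract_biadd twist_ahom ahom_id])

lemma left_hcomp:
  assumes "s \<in> hcomp S j" "l \<in> hcomp L k"
  shows "left_action S L s l = ksign L (j * k) (ract L l s)"
proof -
  have "left_action S L s l = ract L (twist L j l) s"
    unfolding left_action_def
    by (rule biadd_hsum_left_hcomp[OF S.graded_group_axioms abelian, where F = "\<lambda>i s l. ract L (twist L i l) s"])
      (rule biadd_flip, rule biadd_comp[OF ract_biadd twist_ahom ahom_id], use assms hcomp_closed in auto)
  then show ?thesis using assms by (simp add: twist_hcomp ract_ksign hcomp_closed S.hcomp_closed)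
qed

lemma left_closed: "\<lbrakk>s \<in> carrier S; l \<in> carrier L\<rbrakk> \<Longrightarrow> left_action S L s l \<in> carrier L"
  using biadd_closed[OF left_biadd] .

lemma left_mem: "\<lbrakk>s \<in> hcomp S j; l \<in> hcomp L k\<rbrakk> \<Longrightarrow> left_action S L s l \<in> hcomp L (j + k)"
  using ract_hcomp[of l k s j] by (simp add: left_hcomp hcomp_ksign add.commute)

lemma left_ksign:
  assumes "s \<in> carrier S" "l \<in> carrier L"
  shows "left_action S L (ksign S k s) l = ksign L k (left_action S L s l)"
    "left_action S L s (ksign L k l) = ksign L k (left_action S L s l)"
  using biadd_ksign[OF S.abelian abelian abelian left_biadd assms] by auto

lemma ract_twist:
  assumes "l \<in> carrier L" "s \<in> carrier S"
  shows "twist L k (ract L l s) = ract L (twist L k l) (twist S k s)"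
proof (rule biadd_eqI[OF graded_group_axioms S.graded_group_axioms _ _ _ assms, where g = "\<lambda>l s. twist L k (ract L l s)"])
  show "biadd L S L (\<lambda>l s. twist L k (ract L l s))" by (rule biadd_post[OF ract_biadd twist_ahom])
  show "biadd L S L (\<lambda>l s. ract L (twist L k l) (twist S k s))" by (rule biadd_comp[OF ract_biadd twist_ahom S.twist_ahom])
  fix i j l s assume h: "l \<in> hcomp L i" "s \<in> hcomp S j"
  then show "twist L k (ract L l s) = ract L (twist L k l) (twist S k s)"
    by (simp add: twist_hcomp[OF ract_hcomp] twist_hcomp S.twist_hcomp ract_ksign hcomp_closed S.hcomp_closed
        ksign_closed S.ksign_closed ract_closed ksign_ksign algebra_simps)
qed

lemma left_twist:
  assumes "l \<in> carrier L" "s \<in> carrier S"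
  shows "twist L k (left_action S L s l) = left_action S L (twist S k s) (twist L k l)"
proof (rule biadd_eqI[OF S.graded_group_axioms graded_group_axioms _ _ _ assms(2,1), where g = "\<lambda>s l. twist L k (left_action S L s l)"])
  show "biadd S L L (\<lambda>s l. twist L k (left_action S L s l))" by (rule biadd_post[OF left_biadd twist_ahom])
  show "biadd S L L (\<lambda>s l. left_action S L (twist S k s) (twist L k l))" by (rule biadd_comp[OF left_biadd S.twist_ahom twist_ahom])
  fix i j s l assume h: "s \<in> hcomp S i" "l \<in> hcomp L j"
  then show "twist L k (left_action S L s l) = left_action S L (twist S k s) (twist L k l)"
    by (simp add: twist_hcomp[OF left_mem] twist_hcomp S.twist_hcomp left_ksign hcomp_closed S.hcomp_closed
        ksign_closed S.ksign_closed left_closed ksign_ksign algebra_simps)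
qed

text \<open>When only one argument is homogeneous, the Koszul sign is absorbed into a twist of the
  other one. This version and the next are needed for arguments \<open>D c\<close> with
  inhomogeneous \<open>D\<close>.\<close>

lemma left_hcomp_left:
  assumes "s \<in> hcomp S j" "l \<in> carrier L"
  shows "left_action S L s l = ract L (twist L j l) s"
proof (rule graded_ahom_eqI[where f = "left_action S L s" and G = L, OF _ _ assms(2)])
  show "left_action S L s \<in> ahom L L" by (rule biadd_right[OF left_biadd S.hcomp_closed[OF assms(1)]])
  show "(\<lambda>l. ract L (twist L j l) s) \<in> ahom L L"
    by (rule ahom_comp[OF twist_ahom biadd_left[OF ract_biadd S.hcomp_closed[OF assms(1)]]])
qed (use assms in \<open>simp add: left_hcomp twist_hcomp ract_ksign hcomp_closed S.hcomp_closed\<close>)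

lemma left_hcomp_right:
  assumes "l \<in> hcomp L k" "s \<in> carrier S"
  shows "left_action S L s l = ract L l (twist S k s)"
proof (rule S.graded_ahom_eqI[where f = "\<lambda>s. left_action S L s l" and G = L, OF _ _ assms(2)])
  show "(\<lambda>s. left_action S L s l) \<in> ahom S L" by (rule biadd_left[OF left_biadd hcomp_closed[OF assms(1)]])
  show "(\<lambda>s. ract L l (twist S k s)) \<in> ahom S L"
    by (rule ahom_comp[OF S.twist_ahom biadd_right[OF ract_biadd hcomp_closed[OF assms(1)]]])
qed (use assms in \<open>simp add: left_hcomp S.twist_hcomp ract_ksign hcomp_closed S.hcomp_closed mult.commute\<close>)

lemma Leibniz_twist:
  assumes "l \<in> carrier L" "s \<in> carrier S"
  shows "diff L (ract L l s) = ract L (diff L l) s \<oplus>\<^bsub>L\<^esub> ract L (twist L 1 l) (diff S s)"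
proof (rule biadd_eqI[OF graded_group_axioms S.graded_group_axioms _ _ _ assms, where g = "\<lambda>l s. diff L (ract L l s)"])
  show "biadd L S L (\<lambda>l s. diff L (ract L l s))" by (rule biadd_post[OF ract_biadd diff_hom])
  show "biadd L S L (\<lambda>l s. ract L (diff L l) s \<oplus>\<^bsub>L\<^esub> ract L (twist L 1 l) (diff S s))"
    by (intro biadd_plus abelian biadd_comp[OF ract_biadd diff_hom ahom_id] biadd_comp[OF ract_biadd twist_ahom S.diff_hom])
qed (simp add: module_Leibniz twist_hcomp ract_ksign hcomp_closed S.hcomp_closed S.diff_closed)

text \<open>Moving \<open>b\<close> past \<open>l s\<close> costs the sign of
  \<open>|b|(|l| + |s|)\<close>; the part \<open>|b||s|\<close> is what graded commutativity of
  \<open>S\<close> pays for interchanging \<open>b\<close> and \<open>s\<close>.\<close>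

lemma left_ract:
  assumes b: "b \<in> carrier S" and l: "l \<in> carrier L" and s: "s \<in> carrier S"
  shows "left_action S L b (ract L l s) = ract L (left_action S L b l) s"
proof (rule graded_ahom_eqI[where f = "\<lambda>l. left_action S L b (ract L l s)" and G = L, OF _ _ l])
  show "(\<lambda>l. left_action S L b (ract L l s)) \<in> ahom L L"
    by (rule ahom_comp[OF biadd_left[OF ract_biadd s] biadd_right[OF left_biadd b]])
  show "(\<lambda>l. ract L (left_action S L b l) s) \<in> ahom L L"
    by (rule ahom_comp[OF biadd_right[OF left_biadd b] biadd_left[OF ract_biadd s]])
  fix k l assume l: "l \<in> hcomp L k"
  note lc = hcomp_closed[OF l]
  show "left_action S L b (ract L l s) = ract L (left_action S L b l) s"
  proof (rule biadd_eqI[OF S.graded_group_axioms S.graded_group_axioms _ _ _ b s, where g = "\<lambda>b s. left_action S L b (ract L l s)"])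
    show "biadd S S L (\<lambda>b s. left_action S L b (ract L l s))"
      by (rule biadd_comp[OF left_biadd ahom_id biadd_right[OF ract_biadd lc]])
    show "biadd S S L (\<lambda>b s. ract L (left_action S L b l) s)"
      by (rule biadd_comp[OF ract_biadd biadd_left[OF left_biadd lc] ahom_id])
    fix i j b s assume h: "b \<in> hcomp S i" "s \<in> hcomp S j"
    have "ract L (ract L l s) b = ksign L (i * j) (ract L (ract L l b) s)"
      using h[THEN S.hcomp_closed] lc S.comm_ksign[OF h]
      by (simp add: ract_mult[symmetric] ract_ksign)
    then show "left_action S L b (ract L l s) = ract L (left_action S L b l) s"
      using h[THEN S.hcomp_closed] lc
      by (simp add: left_hcomp[OF h(1) ract_hcomp[OF l h(2)]] left_hcomp[OF h(1) l] ract_ksign ract_closed ksign_ksign)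
        (auto intro!: ksign_cong)
  qed
qed

end

section \<open>Tensor products\<close>

text \<open>\<open>tensor_dg\<close> generates its homogeneous components inside the plain group
  \<open>tensor_group\<close>, while all later arguments live in \<open>tensor_dg\<close>.\<close>

lemma generate_struct_cong:
  assumes "same_add M M'"
  shows "generate (add_monoid M) H = generate (add_monoid M') H"
proof -
  \<comment> \<open>One inclusion for arbitrary record types, so that it can be used in both
    directions.\<close>
  have "x \<in> generate (add_monoid N') H" if "x \<in> generate (add_monoid N) H" "same_add N N'"
    for x and N :: "('a, 'x) ring_scheme" and N' :: "('a, 'y) ring_scheme"
    using that
  proof (induction rule: generate.induct)
    case one
    then show ?case using generate.one[of "add_monoid N'"] by (simp add: same_add_def)
  next
    case (inv h)
    then show ?case
      using generate.inv[of h H "add_monoid N'"] a_inv_cong[of N N' h] by (simp add: a_inv_def)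
  next
    case (eng h1 h2)
    then show ?case using generate.eng[of h1 "add_monoid N'" H h2] by (simp add: same_add_def)
  qed (rule generate.incl)
  from this[OF _ assms] this[OF _ same_add_sym[OF assms]] show ?thesis by blast
qed

lemma add_pow_struct_cong: "same_add G G' \<Longrightarrow> add_pow G (k :: int) x = add_pow G' k x"
  by (simp add: add_pow_def int_pow_def nat_pow_def a_inv_cong[unfolded a_inv_def] Let_def) (simp add: same_add_def)

lemma tensor_lift_struct_cong: "same_add G G' \<Longrightarrow> tensor_lift G g t = tensor_lift G' g t"
  by (simp add: tensor_lift_def add_pow_struct_cong finsum_struct_cong Let_def)

lemma subgroup_zero: "abelian_group G \<Longrightarrow> subgroup {\<zero>\<^bsub>G\<^esub>} (add_monoid G)"
  using group.triv_subgroup[OF abelian_group.a_group] by fastforce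

locale dg_tensor = S: dg_algebra R S + M: dg_alg_module R S M + L: dg_alg_module R S L
  for R :: "('r, 'y) ring_scheme" and S :: "('r, 's, 'z) dg_alg_scheme"
    and M :: "('s, 'm) dg_rmod" and L :: "('s, 'l) dg_rmod"
begin

abbreviation "F \<equiv> free_Abelian_group (carrier M \<times> carrier L)"
abbreviation "K \<equiv> tensor_kernel S M L"
abbreviation "T \<equiv> tensor_dg S M L"
abbreviation "pt \<equiv> pure_tensor S M L"

lemma tensor_dg_simps:
  "carrier T = rcosets\<^bsub>F\<^esub> K" "zero T = K" "add T = (<#>\<^bsub>F\<^esub>)"
  by (simp_all add: tensor_dg_def tensor_group_def Let_def ring.defs)

lemma same_add_tensor_group: "same_add (tensor_group S M L) T"
  by (simp add: same_add_def tensor_group_def Let_def tensor_dg_simps)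

lemma add_monoid_tensor_group: "add_monoid (tensor_group S M L) = F Mod K"
  by (simp add: tensor_group_def Let_def FactGroup_def)

lemma relations_closed: "tensor_relations S M L \<subseteq> carrier F"
  unfolding tensor_relations_def
  by (auto simp del: carrier_free_Abelian_group_iff 
      intro!: group.subgroup_self[THEN subgroup.m_inv_closed]) (auto simp: M.ract_closed L.left_closed dest!: keys_diff[THEN subsetD])

lemma kernel_subgroup: "subgroup K F"
  unfolding tensor_kernel_def by (rule group.generate_is_subgroup[OF group_free_Abelian_group relations_closed])

lemma kernel_normal: "K \<lhd> F"
  by (rule comm_group.subgroup_imp_normal[OF abelian_free_Abelian_group kernel_subgroup])

lemma abelian: "abelian_group T"
proof -
  have "comm_group (add_monoid (tensor_group S M L))"
    unfolding add_monoid_tensor_group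
    by (rule comm_group.abelian_FactGroup[OF abelian_free_Abelian_group kernel_subgroup])
  then have "abelian_group (tensor_group S M L)"
    by (simp add: abelian_group_def abelian_group_axioms_def abelian_monoid_def comm_group_def)
  then show ?thesis
    using abelian_group_cong same_add_sym[OF same_add_tensor_group] by blast
qed

abbreviation coset where "coset c \<equiv> K #>\<^bsub>F\<^esub> c"

lemma coset_hom: "coset \<in> hom F (F Mod K)"
  by (rule normal.r_coset_hom_Mod[OF kernel_normal])

lemma coset_closed: "c \<in> carrier F \<Longrightarrow> coset c \<in> carrier T"
  using hom_in_carrier[OF coset_hom] by (simp add: FactGroup_def tensor_dg_simps)

lemma coset_add: "\<lbrakk>c \<in> carrier F; d \<in> carrier F\<rbrakk> \<Longrightarrow> coset (c + d) = coset c \<oplus>\<^bsub>T\<^esub> coset d"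
  using hom_mult[OF coset_hom, of c d] by (simp add: FactGroup_def tensor_dg_simps)

lemma keys_minus: "\<lbrakk>c \<in> carrier F; d \<in> carrier F\<rbrakk> \<Longrightarrow> c - d \<in> carrier F"
  using keys_diff[of c d] by auto

lemma coset_diff: 
  assumes "c \<in> carrier F" "d \<in> carrier F"
  shows "coset (c - d) = coset c \<ominus>\<^bsub>T\<^esub> coset d"
proof -
  interpret T: abelian_group T by (rule abelian)
  have cc: "c - d \<in> carrier F" using keys_minus assms by blast
  have "coset c = coset (c - d) \<oplus>\<^bsub>T\<^esub> coset d"
    using coset_add[OF cc assms(2)] by simp
  then show ?thesis
    using coset_closed[OF cc] coset_closed[OF assms(2)] unfolding a_minus_def
    by (metis T.a_assoc T.a_inv_closed T.r_neg T.r_zero)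
qed

lemma coset_surj: "t \<in> carrier T \<Longrightarrow> \<exists>c\<in>carrier F. t = coset c"
  by (auto simp: RCOSETS_def tensor_dg_simps)

lemma coset_kernel: "c \<in> K \<Longrightarrow> coset c = \<zero>\<^bsub>T\<^esub>"
  using subgroup.rcos_const[OF kernel_subgroup group_free_Abelian_group] by (simp add: tensor_dg_simps)

lemma coset_relation: "c \<in> tensor_relations S M L \<Longrightarrow> coset c = \<zero>\<^bsub>T\<^esub>"
  by (rule coset_kernel) (simp add: tensor_kernel_def generate.incl)

lemma pt_closed: "\<lbrakk>m \<in> carrier M; l \<in> carrier L\<rbrakk> \<Longrightarrow> pt m l \<in> carrier T"
  unfolding pure_tensor_def by (rule coset_closed) simp

lemma pt_biadd: "biadd M L T pt"
proof -
  interpret T: abelian_group T by (rule abelian)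
  have *: "x = y \<oplus>\<^bsub>T\<^esub> z" if "x \<ominus>\<^bsub>T\<^esub> y \<ominus>\<^bsub>T\<^esub> z = \<zero>\<^bsub>T\<^esub>" "x \<in> carrier T" "y \<in> carrier T" "z \<in> carrier T" for x y z
    using that unfolding a_minus_def 
    by (metis T.a_assoc T.a_comm T.a_inv_closed T.minus_equality T.minus_minus T.minus_add T.a_closed)
  have cosetd: "coset (frag_of x - frag_of y - frag_of z) = coset (frag_of x) \<ominus>\<^bsub>T\<^esub> coset (frag_of y) \<ominus>\<^bsub>T\<^esub> coset (frag_of z)"
    if "x \<in> carrier M \<times> carrier L" "y \<in> carrier M \<times> carrier L" "z \<in> carrier M \<times> carrier L" for x y z
    using that by (subst coset_diff, use keys_minus in \<open>auto simp: coset_diff\<close>)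
  show ?thesis
  proof (rule biaddI)
    fix m m' l assume "m \<in> carrier M" "m' \<in> carrier M" "l \<in> carrier L"
    moreover from this have "coset (frag_of (m \<oplus>\<^bsub>M\<^esub> m', l) - frag_of (m, l) - frag_of (m', l)) = \<zero>\<^bsub>T\<^esub>"
      by (intro coset_relation) (auto simp: tensor_relations_def)
    ultimately show "pt (m \<oplus>\<^bsub>M\<^esub> m') l = pt m l \<oplus>\<^bsub>T\<^esub> pt m' l"
      by (intro *) (auto simp: cosetd pure_tensor_def intro: coset_closed)
  next
    fix m l l' assume "m \<in> carrier M" "l \<in> carrier L" "l' \<in> carrier L"
    moreover from this have "coset (frag_of (m, l \<oplus>\<^bsub>L\<^esub> l') - frag_of (m, l) - frag_of (m, l')) = \<zero>\<^bsub>T\<^esub>"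
      by (intro coset_relation) (auto simp: tensor_relations_def)
    ultimately show "pt m (l \<oplus>\<^bsub>L\<^esub> l') = pt m l \<oplus>\<^bsub>T\<^esub> pt m l'"
      by (intro *) (auto simp: cosetd pure_tensor_def intro: coset_closed)
  qed (rule pt_closed)
qed

lemma pt_balanced:
  assumes "m \<in> carrier M" "s \<in> carrier S" "l \<in> carrier L"
  shows "pt (ract M m s) l = pt m (left_action S L s l)"
proof -
  interpret T: abelian_group T by (rule abelian)
  have "coset (frag_of (ract M m s, l) - frag_of (m, left_action S L s l)) = \<zero>\<^bsub>T\<^esub>"
    using assms by (intro coset_relation) (auto simp: tensor_relations_def)
  then have "pt (ract M m s) l \<ominus>\<^bsub>T\<^esub> pt m (left_action S L s l) = \<zero>\<^bsub>T\<^esub>"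
    using assms by (simp add: coset_diff pure_tensor_def M.ract_closed L.left_closed)
  then show ?thesis
    using assms T.r_neg[OF pt_closed[OF M.ract_closed[OF assms(1,2)] assms(3)]] unfolding a_minus_def
    by (metis L.left_closed M.ract_closed T.a_inv_closed T.minus_equality T.minus_minus pt_closed)
qed

lemma pt_balanced_hcomp:
  assumes "m \<in> carrier M" "s \<in> hcomp S i" "l \<in> hcomp L j"
  shows "pt (ract M m s) l = ksign T (i * j) (pt m (ract L l s))"
  using assms pt_balanced[of m s l] 
    biadd_ksign(2)[OF M.abelian L.abelian abelian pt_biadd, of m "ract L l s" "i * j"]
  by (simp add: S.hcomp_closed L.hcomp_closed L.left_hcomp L.ract_closed)

section \<open>Additive maps out of a tensor product\<close>

lemma tensor_ahom_eqI':
  assumes G: "abelian_group G" and f: "f \<in> ahom T G" and g: "g \<in> ahom T G" and t: "t \<in> carrier T"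
    and eq: "\<And>m l. \<lbrakk>m \<in> carrier M; l \<in> carrier L\<rbrakk> \<Longrightarrow> f (pt m l) = g (pt m l)"
  shows "f t = g t"
proof -
  interpret T: abelian_group T by (rule abelian)
  obtain c where c: "c \<in> carrier F" "t = coset c" using coset_surj[OF t] by blast
  have "f (coset c) = g (coset c)"
    using c(1)[unfolded carrier_free_Abelian_group_iff]
  proof (rule free_Abelian_group_induct)
    show "f (coset 0) = g (coset 0)"
      using coset_kernel[OF subgroup.one_closed[OF kernel_subgroup]] 
      by (simp only: one_free_Abelian_group ahom_zero[OF abelian G f] ahom_zero[OF abelian G g])
  next
    fix x y :: "('m \<times> 'l) \<Rightarrow>\<^sub>0 int"
    assume *: "Poly_Mapping.keys x \<subseteq> carrier M \<times> carrier L" "Poly_Mapping.keys y \<subseteq> carrier M \<times> carrier L"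
      "f (coset x) = g (coset x)" "f (coset y) = g (coset y)"
    then have xy: "x \<in> carrier F" "y \<in> carrier F" by auto
    show "f (coset (x - y)) = g (coset (x - y))"
      unfolding coset_diff[OF xy] ahom_a_minus[OF abelian G f coset_closed[OF xy(1)] coset_closed[OF xy(2)]]
        ahom_a_minus[OF abelian G g coset_closed[OF xy(1)] coset_closed[OF xy(2)]] * ..
  next
    fix a assume "a \<in> carrier M \<times> carrier L"
    then show "f (coset (frag_of a)) = g (coset (frag_of a))"
      using eq[of "fst a" "snd a"] by (auto simp: pure_tensor_def)
  qed
  then show ?thesis using c by simp
qed

lemma tensor_ahom_eqI:
  assumes G: "abelian_group G" and f: "f \<in> ahom T G" and g: "g \<in> ahom T G" and t: "t \<in> carrier T"
    and eq: "\<And>i j m l. \<lbrakk>m \<in> hcomp M i; l \<in> hcomp L j\<rbrakk> \<Longrightarrow> f (pt m l) = g (pt m l)"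
  shows "f t = g t"
proof (rule tensor_ahom_eqI'[OF G f g t])
  fix m l assume ml: "m \<in> carrier M" "l \<in> carrier L"
  show "f (pt m l) = g (pt m l)"
    by (rule biadd_eqI[OF M.graded_group_axioms L.graded_group_axioms biadd_post[OF pt_biadd f]
          biadd_post[OF pt_biadd g] eq ml])
qed

text \<open>The extension of \<open>g\<close> to formal sums of pairs; \<open>tensor_lift\<close> is
  its value at a chosen representative.\<close>

definition chain_sum :: "('g, 'x) ring_scheme \<Rightarrow> ('m \<times> 'l \<Rightarrow> 'g) \<Rightarrow> (('m \<times> 'l) \<Rightarrow>\<^sub>0 int) \<Rightarrow> 'g" where
  "chain_sum G g c = (\<Oplus>\<^bsub>G\<^esub>p\<in>Poly_Mapping.keys c. [Poly_Mapping.lookup c p] \<cdot>\<^bsub>G\<^esub> g p)"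

lemma chain_sum_hom:
  assumes "abelian_group G" and g: "\<And>p. p \<in> carrier M \<times> carrier L \<Longrightarrow> g p \<in> carrier G"
  shows "chain_sum G g \<in> hom F (add_monoid G)"
proof -
  interpret G: abelian_group G by fact
  have sup: "chain_sum G g c = (\<Oplus>\<^bsub>G\<^esub>p\<in>I. [Poly_Mapping.lookup c p] \<cdot>\<^bsub>G\<^esub> g p)"
    if "finite I" "Poly_Mapping.keys c \<subseteq> I" "I \<subseteq> carrier M \<times> carrier L" for c I
    unfolding chain_sum_def
  proof (rule G.add.finprod_mono_neutral_cong_left)
    fix i assume "i \<in> I - Poly_Mapping.keys c"
    then show "[Poly_Mapping.lookup c i] \<cdot>\<^bsub>G\<^esub> g i = \<zero>\<^bsub>G\<^esub>"
      using that g by (auto simp: in_keys_iff add_pow_def)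
  next
    show "(\<lambda>i. [Poly_Mapping.lookup c i] \<cdot>\<^bsub>G\<^esub> g i) \<in> I \<rightarrow> carrier G"
      using that g by (auto intro!: G.add.int_pow_closed)
  qed (use that in auto)
  show ?thesis
  proof (rule homI)
    fix x assume "x \<in> carrier F"
    then show "chain_sum G g x \<in> carrier (add_monoid G)"
      using g by (auto simp: chain_sum_def intro!: G.finsum_closed G.add.int_pow_closed)
  next
    fix x y assume xy: "x \<in> carrier F" "y \<in> carrier F"
    let ?I = "Poly_Mapping.keys x \<union> Poly_Mapping.keys y"
    have I: "finite ?I" "Poly_Mapping.keys (x + y) \<subseteq> ?I" "?I \<subseteq> carrier M \<times> carrier L"
      using xy keys_add[of x y] by auto
    have "chain_sum G g (x + y) = (\<Oplus>\<^bsub>G\<^esub>p\<in>?I. [Poly_Mapping.lookup x p] \<cdot>\<^bsub>G\<^esub> g p \<oplus>\<^bsub>G\<^esub> [Poly_Mapping.lookup y p] \<cdot>\<^bsub>G\<^esub> g p)"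
      unfolding sup[OF I] using I(3) g
      by (intro G.finsum_cong') (auto simp: lookup_add G.add.int_pow_mult intro!: G.add.int_pow_closed)
    also have "\<dots> = chain_sum G g x \<oplus>\<^bsub>G\<^esub> chain_sum G g y"
      using I(3) g sup[OF I(1) _ I(3), of x] sup[OF I(1) _ I(3), of y]
      by (subst G.finsum_addf) (auto intro!: G.add.int_pow_closed)
    finally show "chain_sum G g (x \<otimes>\<^bsub>F\<^esub> y) = chain_sum G g x \<otimes>\<^bsub>add_monoid G\<^esub> chain_sum G g y" by simp
  qed
qed

text \<open>Biadditivity and balancing say that \<open>chain_sum G g\<close> kills each tensor
  relation, hence the whole subgroup \<open>K\<close>, so the representative chosen in
  \<open>tensor_lift\<close> does not matter.\<close>

lemma tensor_lift_coset:
  assumes G: "abelian_group G" and g: "biadd M L G (\<lambda>m l. g (m, l))"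
    and bal: "\<And>m s l. \<lbrakk>m \<in> carrier M; s \<in> carrier S; l \<in> carrier L\<rbrakk> \<Longrightarrow> g (ract M m s, l) = g (m, left_action S L s l)"
    and c: "c \<in> carrier F"
  shows "tensor_lift G g (coset c) = chain_sum G g c"
proof -
  interpret G: abelian_group G by fact
  have gc: "\<And>p. p \<in> carrier M \<times> carrier L \<Longrightarrow> g p \<in> carrier G" using biadd_closed[OF g] by auto
  note h = chain_sum_hom[OF G gc]
  interpret h: group_hom F "add_monoid G" "chain_sum G g"
    by (rule group_hom.intro) (simp_all add: G.a_group group_hom_axioms_def h)
  have of: "chain_sum G g (frag_of p) = g p" if "p \<in> carrier M \<times> carrier L" for p
    using gc[OF that] by (simp add: chain_sum_def keys_frag_of G.add.int_pow_1)
  have minus: "chain_sum G g (x - y) = chain_sum G g x \<ominus>\<^bsub>G\<^esub> chain_sum G g y" if "x \<in> carrier F" "y \<in> carrier F" for x y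
  proof -
    have "chain_sum G g x = chain_sum G g (x - y) \<oplus>\<^bsub>G\<^esub> chain_sum G g y"
      using hom_mult[OF h keys_minus[OF that] that(2)] by simp
    then show ?thesis
      using hom_in_carrier[OF h keys_minus[OF that]] hom_in_carrier[OF h that(2)] unfolding a_minus_def
      by (simp add: G.a_assoc G.r_neg)
  qed
  have "tensor_relations S M L \<subseteq> kernel F (add_monoid G) (chain_sum G g)"
  proof
    fix r assume r: "r \<in> tensor_relations S M L"
    then have rF: "r \<in> carrier F" using relations_closed by blast
    have m3: "chain_sum G g (frag_of x - frag_of y - frag_of z) = g x \<ominus>\<^bsub>G\<^esub> g y \<ominus>\<^bsub>G\<^esub> g z"
      if "x \<in> carrier M \<times> carrier L" "y \<in> carrier M \<times> carrier L" "z \<in> carrier M \<times> carrier L" for x y z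
      using that by (subst minus, use keys_minus in \<open>auto simp: minus of\<close>)
    have z: "(a \<oplus>\<^bsub>G\<^esub> b) \<ominus>\<^bsub>G\<^esub> a \<ominus>\<^bsub>G\<^esub> b = \<zero>\<^bsub>G\<^esub>" if "a \<in> carrier G" "b \<in> carrier G" for a b
      using that unfolding a_minus_def by (metis G.a_assoc G.a_comm G.a_inv_closed G.a_closed G.r_neg G.r_neg2)
    have "chain_sum G g r = \<zero>\<^bsub>G\<^esub>"
      using r unfolding tensor_relations_def
    proof (elim UnE CollectE exE conjE)
      fix m m' l assume "r = frag_of (m \<oplus>\<^bsub>M\<^esub> m', l) - frag_of (m, l) - frag_of (m', l)"
        "m \<in> carrier M" "m' \<in> carrier M" "l \<in> carrier L"
      then show ?thesis using ahom_add[OF biadd_left[OF g]] by (simp add: m3 z gc)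
    next
      fix m l l' assume "r = frag_of (m, l \<oplus>\<^bsub>L\<^esub> l') - frag_of (m, l) - frag_of (m, l')"
        "m \<in> carrier M" "l \<in> carrier L" "l' \<in> carrier L"
      then show ?thesis using ahom_add[OF biadd_right[OF g]] by (simp add: m3 z gc)
    next
      fix m s l assume "r = frag_of (ract M m s, l) - frag_of (m, left_action S L s l)"
        "m \<in> carrier M" "s \<in> carrier S" "l \<in> carrier L"
      then show ?thesis
        by (simp add: minus of M.ract_closed L.left_closed bal gc G.r_neg a_minus_def)
    qed
    then show "r \<in> kernel F (add_monoid G) (chain_sum G g)" using rF by (simp add: kernel_def)
  qed
  then have ker: "K \<subseteq> kernel F (add_monoid G) (chain_sum G g)"
    unfolding tensor_kernel_def
    by (rule group.generate_subgroup_incl[OF group_free_Abelian_group _ h.subgroup_kernel])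
  \<comment> \<open>The chosen representative exists because the coset is nonempty, and it differs
    from \<open>c\<close> by an element of \<open>K\<close>.\<close>
  have "c \<in> coset c"
    using subgroup.one_closed[OF kernel_subgroup] by (auto simp: r_coset_def)
  then have "(SOME c'. c' \<in> coset c) \<in> coset c" by (rule someI)
  then obtain k where k: "k \<in> K" "(SOME c'. c' \<in> coset c) = k + c" by (auto simp: r_coset_def)
  have kF: "k \<in> carrier F" using k(1) subgroup.subset[OF kernel_subgroup] by blast
  have "tensor_lift G g (coset c) = chain_sum G g (k + c)"
    by (simp add: tensor_lift_def k(2) chain_sum_def Let_def)
  also have "\<dots> = chain_sum G g c"
    using hom_mult[OF h kF c] ker k(1) hom_in_carrier[OF h c] by (auto simp: kernel_def)
  finally show ?thesis .
qed

text \<open>The universal property. Balancing is demanded only for homogeneous arguments and in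
  terms of right actions, with the sign that \<open>left_action\<close> introduces; additivity in
  each argument gives the general case.\<close>

lemma tensor_lift:
  assumes G: "abelian_group G" and g: "biadd M L G g"
    and bal: "\<And>m s l i j k. \<lbrakk>m \<in> hcomp M i; s \<in> hcomp S j; l \<in> hcomp L k\<rbrakk>
      \<Longrightarrow> g (ract M m s) l = ksign G (j * k) (g m (ract L l s))"
  shows "tensor_lift G (\<lambda>(m, l). g m l) \<in> ahom T G"
    and "\<lbrakk>m \<in> carrier M; l \<in> carrier L\<rbrakk> \<Longrightarrow> tensor_lift G (\<lambda>(m, l). g m l) (pt m l) = g m l"
proof -
  interpret G: abelian_group G by fact
  have g': "biadd M L G (\<lambda>m l. (\<lambda>(m, l). g m l) (m, l))" using g by simp
  have bal': "g (ract M m s) l = g m (left_action S L s l)"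
    if "m \<in> carrier M" "s \<in> carrier S" "l \<in> carrier L" for m s l
  proof (rule M.graded_ahom_eqI[where f = "\<lambda>m. g (ract M m s) l" and g = "\<lambda>m. g m (left_action S L s l)"])
    show "(\<lambda>m. g (ract M m s) l) \<in> ahom M G"
      by (rule ahom_comp[OF biadd_left[OF M.ract_biadd that(2)] biadd_left[OF g that(3)]])
    show "(\<lambda>m. g m (left_action S L s l)) \<in> ahom M G"
      by (rule biadd_left[OF g L.left_closed[OF that(2,3)]])
    fix i m assume m: "m \<in> hcomp M i"
    note mc = M.hcomp_closed[OF m]
    show "g (ract M m s) l = g m (left_action S L s l)"
    proof (rule biadd_eqI[OF S.graded_group_axioms L.graded_group_axioms _ _ _ that(2,3)])
      show "biadd S L G (\<lambda>s l. g (ract M m s) l)"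
        by (rule biadd_comp[OF g biadd_right[OF M.ract_biadd mc] ahom_id])
      show "biadd S L G (\<lambda>s l. g m (left_action S L s l))"
        by (rule biadd_post[OF L.left_biadd biadd_right[OF g mc]])
      show "g (ract M m s) l = g m (left_action S L s l)" if "s \<in> hcomp S j" "l \<in> hcomp L k" for j k s l
        using bal[OF m that] L.left_hcomp[OF that] that
          ahom_ksign[OF L.abelian G biadd_right[OF g mc], of "ract L l s" "j * k"]
        by (simp add: L.ract_closed S.hcomp_closed L.hcomp_closed)
    qed
  qed fact
  note lc = tensor_lift_coset[OF G g', simplified, OF bal']
  have gc: "\<And>p. p \<in> carrier M \<times> carrier L \<Longrightarrow> (\<lambda>(m, l). g m l) p \<in> carrier G" using biadd_closed[OF g] by auto
  note h = chain_sum_hom[where g = "\<lambda>(m, l). g m l", OF G gc]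
  show "tensor_lift G (\<lambda>(m, l). g m l) \<in> ahom T G"
  proof (rule ahomI)
    fix x assume "x \<in> carrier T"
    then obtain c where "c \<in> carrier F" "x = coset c" using coset_surj by blast
    then show "tensor_lift G (\<lambda>(m, l). g m l) x \<in> carrier G"
      using lc hom_in_carrier[OF h] by simp
  next
    fix x y assume "x \<in> carrier T" "y \<in> carrier T"
    then obtain c d where cd: "c \<in> carrier F" "x = coset c" "d \<in> carrier F" "y = coset d" using coset_surj by meson
    have "c + d \<in> carrier F" using cd keys_add[of c d] by auto
    then show "tensor_lift G (\<lambda>(m, l). g m l) (x \<oplus>\<^bsub>T\<^esub> y) = tensor_lift G (\<lambda>(m, l). g m l) x \<oplus>\<^bsub>G\<^esub> tensor_lift G (\<lambda>(m, l). g m l) y"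
      using cd lc hom_mult[OF h cd(1,3)] unfolding cd(2,4) coset_add[OF cd(1,3), symmetric] by simp
  qed
  show "tensor_lift G (\<lambda>(m, l). g m l) (pt m l) = g m l" if "m \<in> carrier M" "l \<in> carrier L"
    unfolding pure_tensor_def using that lc[of "frag_of (m, l)"] gc[of "(m, l)"]
    by (simp add: chain_sum_def keys_frag_of G.add.int_pow_1)
qed

interpretation T: abelian_group T by (rule abelian)

lemma pt_add:
  "\<lbrakk>m \<in> carrier M; m' \<in> carrier M; l \<in> carrier L\<rbrakk> \<Longrightarrow> pt (m \<oplus>\<^bsub>M\<^esub> m') l = pt m l \<oplus>\<^bsub>T\<^esub> pt m' l"
  "\<lbrakk>m \<in> carrier M; l \<in> carrier L; l' \<in> carrier L\<rbrakk> \<Longrightarrow> pt m (l \<oplus>\<^bsub>L\<^esub> l') = pt m l \<oplus>\<^bsub>T\<^esub> pt m l'"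
  using ahom_add[OF biadd_left[OF pt_biadd]] ahom_add[OF biadd_right[OF pt_biadd]] by auto

lemma pt_ksign:
  assumes "m \<in> carrier M" "l \<in> carrier L"
  shows "pt (ksign M k m) l = ksign T k (pt m l)" "pt m (ksign L k l) = ksign T k (pt m l)"
  using biadd_ksign[OF M.abelian L.abelian abelian pt_biadd assms] by auto

lemma pt_zero:
  "l \<in> carrier L \<Longrightarrow> pt \<zero>\<^bsub>M\<^esub> l = \<zero>\<^bsub>T\<^esub>" "m \<in> carrier M \<Longrightarrow> pt m \<zero>\<^bsub>L\<^esub> = \<zero>\<^bsub>T\<^esub>"
  using ahom_zero[OF M.abelian abelian biadd_left[OF pt_biadd]]
    ahom_zero[OF L.abelian abelian biadd_right[OF pt_biadd]] by auto

section \<open>Grading of the tensor product\<close>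

lemma hcomp_T: "hcomp T n = generate (add_monoid T) {pt m l | i m l. m \<in> hcomp M i \<and> l \<in> hcomp L (n - i)}"
  by (subst generate_struct_cong[OF same_add_sym[OF same_add_tensor_group]])
    (simp add: tensor_dg_def Let_def ring.defs)

lemma hcomp_T_subgroup: "subgroup (hcomp T n) (add_monoid T)"
  unfolding hcomp_T
  by (rule group.generate_is_subgroup[OF T.a_group]) (auto intro!: pt_closed M.hcomp_closed L.hcomp_closed)

lemma hcomp_T_closed: "x \<in> hcomp T n \<Longrightarrow> x \<in> carrier T"
  using subgroup_add_monoid(1)[OF hcomp_T_subgroup] .

lemma pt_mem: "\<lbrakk>m \<in> hcomp M i; l \<in> hcomp L j\<rbrakk> \<Longrightarrow> pt m l \<in> hcomp T (i + j)"
  unfolding hcomp_T by (rule generate.incl) force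

text \<open>The preimage of \<open>H\<close> is a subgroup containing the generators of degree
  \<open>n\<close>. With \<open>H\<close> a component of \<open>G\<close> this shows that
  \<open>f\<close> respects degrees; with \<open>H\<close> the zero subgroup it shows that
  \<open>f\<close> vanishes.\<close>

lemma hcomp_T_map:
  assumes G: "abelian_group G" and f: "f \<in> ahom T G" and H: "subgroup H (add_monoid G)"
    and pt: "\<And>i m l. \<lbrakk>m \<in> hcomp M i; l \<in> hcomp L (n - i)\<rbrakk> \<Longrightarrow> f (pt m l) \<in> H"
    and x: "x \<in> hcomp T n"
  shows "f x \<in> H"
proof -
  let ?X = "{pt m l | i m l. m \<in> hcomp M i \<and> l \<in> hcomp L (n - i)}"
  have X: "y \<in> carrier T \<and> f y \<in> H" if "y \<in> ?X" for y
    using that pt by (auto intro!: pt_closed M.hcomp_closed L.hcomp_closed)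
  have "x \<in> carrier T \<and> f x \<in> H"
    using x unfolding hcomp_T
  proof (induction rule: generate.induct)
    case one
    then show ?case using subgroup_add_monoid(2)[OF H] ahom_zero[OF abelian G f] by simp
  next
    case (incl h)
    then show ?case by (rule X)
  next
    case (inv h)
    then have "h \<in> carrier T" "f h \<in> H" using X by auto
    then show ?case using ahom_a_inv[OF abelian G f] subgroup_add_monoid(4)[OF H] T.a_inv_closed
      by (auto simp: a_inv_def)
  next
    case (eng h1 h2)
    then show ?case using subgroup_add_monoid(3)[OF H] by (simp add: ahom_add[OF f])
  qed
  then show ?thesis ..
qed

lemma tensor_induct:
  assumes t: "t \<in> carrier T" and hom: "\<And>n t. t \<in> hcomp T n \<Longrightarrow> P t"
    and add: "\<And>s t. \<lbrakk>s \<in> carrier T; t \<in> carrier T; P s; P t\<rbrakk> \<Longrightarrow> P (s \<oplus>\<^bsub>T\<^esub> t)"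
  shows "P t"
proof -
  \<comment> \<open>The induction principle for free abelian groups closes under differences,
    whereas \<open>P\<close> is only known to be closed under sums. Quantifying over all admissible
    predicates allows the passage from \<open>P\<close> to \<open>P\<close> precomposed with
    negation, which is admissible again.\<close>
  define adm where "adm P \<longleftrightarrow> (\<forall>n. \<forall>t\<in>hcomp T n. P t) \<and> (\<forall>s\<in>carrier T. \<forall>t\<in>carrier T. P s \<longrightarrow> P t \<longrightarrow> P (s \<oplus>\<^bsub>T\<^esub> t))" for P
  obtain c where c: "c \<in> carrier F" "t = coset c" using coset_surj[OF t] by blast
  have "\<forall>P. adm P \<longrightarrow> P (coset c)"
    using c(1)[unfolded carrier_free_Abelian_group_iff]
  proof (rule free_Abelian_group_induct)
    show "\<forall>P. adm P \<longrightarrow> P (coset 0)"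
      using coset_kernel[OF subgroup.one_closed[OF kernel_subgroup]] subgroup_add_monoid(2)[OF hcomp_T_subgroup]
      by (auto simp: adm_def)
  next
    fix x y :: "('m \<times> 'l) \<Rightarrow>\<^sub>0 int"
    assume *: "Poly_Mapping.keys x \<subseteq> carrier M \<times> carrier L" "Poly_Mapping.keys y \<subseteq> carrier M \<times> carrier L"
      "\<forall>P. adm P \<longrightarrow> P (coset x)" "\<forall>P. adm P \<longrightarrow> P (coset y)"
    then have xy: "x \<in> carrier F" "y \<in> carrier F" by auto
    show "\<forall>P. adm P \<longrightarrow> P (coset (x - y))"
    proof (intro allI impI)
      fix P assume P: "adm P"
      have "adm (\<lambda>t. P (\<ominus>\<^bsub>T\<^esub> t))"
        using P subgroup_add_monoid(4)[OF hcomp_T_subgroup] by (auto simp: adm_def T.minus_add)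
      then have "P (\<ominus>\<^bsub>T\<^esub> coset y)" using *(4) by blast
      then show "P (coset (x - y))"
        using P[unfolded adm_def, THEN conjunct2, rule_format, OF coset_closed[OF xy(1)]
            T.a_inv_closed[OF coset_closed[OF xy(2)]] *(3)[rule_format, OF P]]
        \<open>P (\<ominus>\<^bsub>T\<^esub> coset y)\<close>
        unfolding coset_diff[OF xy] a_minus_def by blast
    qed
  next
    fix a assume a: "a \<in> carrier M \<times> carrier L"
    show "\<forall>P. adm P \<longrightarrow> P (coset (frag_of a))"
    proof (intro allI impI)
      fix P assume P: "adm P"
      have "P (pt m l)" if "m \<in> carrier M" "l \<in> carrier L" for m l
        using that
      proof (induction m rule: M.graded_induct)
        case (homogeneous i m)
        show ?case
          using homogeneous(2,1)
        proof (induction l rule: L.graded_induct)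
          case (homogeneous j l)
          then show ?case using P pt_mem unfolding adm_def by blast
        qed (use P in \<open>auto simp: adm_def pt_add M.hcomp_closed pt_closed\<close>)
      qed (use P in \<open>auto simp: adm_def pt_add pt_closed\<close>)
      then show "P (coset (frag_of a))" using a by (auto simp: pure_tensor_def)
    qed
  qed
  moreover have "adm P" using hom add by (auto simp: adm_def)
  ultimately show ?thesis using c by blast
qed

text \<open>The projection onto degree \<open>n\<close>. Uniqueness of decompositions in a quotient
  needs an explicit map that separates the degrees, and this is one that respects the tensor
  relations.\<close>

definition proj :: "int \<Rightarrow> ('m, 'l) tensor \<Rightarrow> ('m, 'l) tensor" where
  "proj n = tensor_lift T (\<lambda>(m, l). \<Oplus>\<^bsub>T\<^esub>i\<in>hsupp M m. pt (hpart M i m) (hpart L (n - i) l))"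

lemma proj_biadd: "biadd M L T (\<lambda>m l. pt m (hpart L (n - i) l))"
  by (rule biadd_comp[OF pt_biadd ahom_id L.hpart_ahom])

lemma proj_hcomp:
  assumes "m \<in> hcomp M i" "l \<in> hcomp L j"
  shows "(\<Oplus>\<^bsub>T\<^esub>i\<in>hsupp M m. pt (hpart M i m) (hpart L (n - i) l)) = (if i + j = n then pt m l else \<zero>\<^bsub>T\<^esub>)"
  using assms biadd_hsum_left_hcomp[where F = "\<lambda>i m l. pt m (hpart L (n - i) l)", OF M.graded_group_axioms abelian proj_biadd assms(1) L.hcomp_closed[OF assms(2)]]
  by (auto simp: L.hpart_hcomp pt_zero M.hcomp_closed)

lemma proj: "proj n \<in> ahom T T" "\<lbrakk>m \<in> hcomp M i; l \<in> hcomp L j\<rbrakk> \<Longrightarrow> proj n (pt m l) = (if i + j = n then pt m l else \<zero>\<^bsub>T\<^esub>)"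
proof -
  have b: "biadd M L T (\<lambda>m l. \<Oplus>\<^bsub>T\<^esub>i\<in>hsupp M m. pt (hpart M i m) (hpart L (n - i) l))"
    using biadd_hsum_left[where F = "\<lambda>i m l. pt m (hpart L (n - i) l)", OF M.graded_group_axioms abelian proj_biadd L.abelian] .
  \<comment> \<open>Moving \<open>s\<close> across the tensor sign leaves the total degree
    \<open>i + j + k\<close> unchanged, so both sides vanish unless it equals \<open>n\<close>, and
    then this is the usual balancing.\<close>
  have bal: "(\<Oplus>\<^bsub>T\<^esub>i\<in>hsupp M (ract M m s). pt (hpart M i (ract M m s)) (hpart L (n - i) l))
      = ksign T (j * k) (\<Oplus>\<^bsub>T\<^esub>i\<in>hsupp M m. pt (hpart M i m) (hpart L (n - i) (ract L l s)))"
    if "m \<in> hcomp M i" "s \<in> hcomp S j" "l \<in> hcomp L k" for m s l i j k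
    using that pt_balanced_hcomp[OF M.hcomp_closed that(2,3)]
    by (simp add: proj_hcomp[OF M.ract_hcomp L.hcomp_zero] proj_hcomp[OF M.ract_hcomp] proj_hcomp[OF _ L.ract_hcomp] T.ksign_zero algebra_simps)
  note tl = tensor_lift[OF abelian b bal]
  show "proj n \<in> ahom T T" using tl(1) by (simp add: proj_def)
  show "proj n (pt m l) = (if i + j = n then pt m l else \<zero>\<^bsub>T\<^esub>)" if "m \<in> hcomp M i" "l \<in> hcomp L j"
    using tl(2) that by (simp add: proj_def proj_hcomp M.hcomp_closed L.hcomp_closed)
qed

lemma graded_group_T: "graded_group T"
proof (rule graded_groupI[OF abelian abelian hcomp_T_subgroup proj(1)])
  fix n x assume x: "x \<in> hcomp T n"
  \<comment> \<open>The difference of \<open>proj n\<close> and the identity vanishes on the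
    generators of degree \<open>n\<close>, hence on the subgroup they generate.\<close>
  have "proj n x \<ominus>\<^bsub>T\<^esub> x \<in> {\<zero>\<^bsub>T\<^esub>}"
    by (rule hcomp_T_map[OF abelian _ subgroup_zero[OF abelian] _ x])
      (auto simp: proj(2) a_minus_def T.r_neg pt_closed M.hcomp_closed L.hcomp_closed 
        intro!: ahom_diff[unfolded a_minus_def] abelian proj ahom_id)
  then show "proj n x = x"
    using ahom_closed[OF proj(1) hcomp_T_closed[OF x], of n] hcomp_T_closed[OF x]
    by (simp add: a_minus_def) (metis T.a_inv_closed T.minus_equality T.minus_minus)
next
  fix n k x assume x: "x \<in> hcomp T k" and kn: "k \<noteq> n"
  have "proj n x \<in> {\<zero>\<^bsub>T\<^esub>}"
    by (rule hcomp_T_map[OF abelian proj(1) subgroup_zero[OF abelian] _ x]) (use kn in \<open>simp add: proj(2)\<close>)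
  then show "proj n x = \<zero>\<^bsub>T\<^esub>" by simp
next
  fix P x assume "x \<in> carrier T" "\<And>n x. x \<in> hcomp T n \<Longrightarrow> P x"
    "\<And>x y. \<lbrakk>x \<in> carrier T; y \<in> carrier T; P x; P y\<rbrakk> \<Longrightarrow> P (x \<oplus>\<^bsub>T\<^esub> y)"
  then show "P x" by (rule tensor_induct)
qed

lemma twist_pt:
  assumes "m \<in> carrier M" "l \<in> carrier L"
  shows "twist T k (pt m l) = pt (twist M k m) (twist L k l)"
proof (rule biadd_eqI[OF M.graded_group_axioms L.graded_group_axioms _ _ _ assms])
  show "biadd M L T (\<lambda>m l. twist T k (pt m l))"
    by (rule biadd_post[OF pt_biadd graded_group.twist_ahom[OF graded_group_T]])
  show "biadd M L T (\<lambda>m l. pt (twist M k m) (twist L k l))"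
    by (rule biadd_comp[OF pt_biadd M.twist_ahom L.twist_ahom])
  show "twist T k (pt m l) = pt (twist M k m) (twist L k l)" if "m \<in> hcomp M i" "l \<in> hcomp L j" for i j m l
    using that
    by (simp add: graded_group.twist_hcomp[OF graded_group_T pt_mem] M.twist_hcomp L.twist_hcomp pt_ksign
        M.ksign_closed L.ksign_closed M.hcomp_closed L.hcomp_closed T.ksign_ksign pt_closed algebra_simps)
qed

section \<open>Differential of the tensor product\<close>

lemma diff_T: "diff T = tensor_lift T (\<lambda>(m, l). pt (diff M m) l \<oplus>\<^bsub>T\<^esub> pt (twist M 1 m) (diff L l))"
proof -
  have "add (tensor_group S M L) = add T" using same_add_tensor_group by (simp add: same_add_def)
  then show ?thesis
    using tensor_lift_struct_cong[OF same_add_tensor_group]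
    by (intro ext) (simp add: tensor_dg_def Let_def ring.defs)
qed

lemma diff_T_ahom: "diff T \<in> ahom T T"
  and diff_pt': "\<lbrakk>m \<in> carrier M; l \<in> carrier L\<rbrakk> \<Longrightarrow> diff T (pt m l) = pt (diff M m) l \<oplus>\<^bsub>T\<^esub> pt (twist M 1 m) (diff L l)"
proof -
  have b: "biadd M L T (\<lambda>m l. pt (diff M m) l \<oplus>\<^bsub>T\<^esub> pt (twist M 1 m) (diff L l))"
    by (intro biadd_plus abelian biadd_comp[OF pt_biadd M.diff_hom ahom_id] biadd_comp[OF pt_biadd M.twist_ahom L.diff_hom])
  have bal: "pt (diff M (ract M m s)) l \<oplus>\<^bsub>T\<^esub> pt (twist M 1 (ract M m s)) (diff L l)
      = ksign T (j * k) (pt (diff M m) (ract L l s) \<oplus>\<^bsub>T\<^esub> pt (twist M 1 m) (diff L (ract L l s)))"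
    if h: "m \<in> hcomp M i" "s \<in> hcomp S j" "l \<in> hcomp L k" for m s l i j k
  proof -
    note c = M.hcomp_closed[OF h(1)] S.hcomp_closed[OF h(2)] L.hcomp_closed[OF h(3)]
    note d = M.diff_hcomp[OF h(1)] S.diff_hcomp[OF h(2)] L.diff_hcomp[OF h(3)]
    note dc = M.hcomp_closed[OF d(1)] S.hcomp_closed[OF d(2)] L.hcomp_closed[OF d(3)]
    \<comment> \<open>After moving all scalars to the right factor, both sides are signed sums of
      these three tensors, one for each of the elements that is differentiated; only parities remain
      to be compared.\<close>
    let ?x = "pt (diff M m) (ract L l s)" and ?y = "pt m (ract L l (diff S s))" and ?z = "pt m (ract L (diff L l) s)"
    have xyz: "?x \<in> carrier T" "?y \<in> carrier T" "?z \<in> carrier T"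
      using c dc by (auto intro!: pt_closed L.ract_closed)
    have "pt (diff M (ract M m s)) l \<oplus>\<^bsub>T\<^esub> pt (twist M 1 (ract M m s)) (diff L l)
       = ksign T (j * k) ?x \<oplus>\<^bsub>T\<^esub> ksign T (i + (j - 1) * k) ?y \<oplus>\<^bsub>T\<^esub> ksign T (i + j + j * (k - 1)) ?z"
      using h c d dc xyz
      by (simp add: M.module_Leibniz pt_add M.ract_closed M.ksign_closed pt_ksign pt_balanced_hcomp[OF _ h(2,3)]
          pt_balanced_hcomp[OF _ d(2) h(3)] pt_balanced_hcomp[OF _ h(2) d(3)] M.twist_hcomp[OF M.ract_hcomp] T.ksign_ksign)
    moreover have "ksign T (j * k) (pt (diff M m) (ract L l s) \<oplus>\<^bsub>T\<^esub> pt (twist M 1 m) (diff L (ract L l s)))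
       = ksign T (j * k) ?x \<oplus>\<^bsub>T\<^esub> (ksign T (j * k + i) ?z \<oplus>\<^bsub>T\<^esub> ksign T (j * k + i + k) ?y)"
      using h c d dc xyz
      by (simp add: L.module_Leibniz pt_add L.ract_closed L.ksign_closed pt_ksign M.twist_hcomp T.ksign_ksign T.ksign_add T.ksign_closed M.ksign_closed algebra_simps)
    moreover have "ksign T (i + (j - 1) * k) ?y = ksign T (j * k + i + k) ?y"
      "ksign T (i + j + j * (k - 1)) ?z = ksign T (j * k + i) ?z"
      by (auto intro!: ksign_cong)
    ultimately show ?thesis using xyz by (simp add: T.ksign_closed T.a_ac)
  qed
  note tl = tensor_lift[OF abelian b bal]
  show "diff T \<in> ahom T T" using tl(1) by (simp add: diff_T)
  show "diff T (pt m l) = pt (diff M m) l \<oplus>\<^bsub>T\<^esub> pt (twist M 1 m) (diff L l)" if "m \<in> carrier M" "l \<in> carrier L"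
    using tl(2) that by (simp add: diff_T)
qed

lemma diff_pt: "\<lbrakk>m \<in> hcomp M i; l \<in> carrier L\<rbrakk> \<Longrightarrow> diff T (pt m l) = pt (diff M m) l \<oplus>\<^bsub>T\<^esub> ksign T i (pt m (diff L l))"
  by (simp add: diff_pt' M.twist_hcomp pt_ksign M.hcomp_closed L.diff_closed)

lemma dg_group_T: "dg_group T"
proof -
  interpret T': graded_group T by (rule graded_group_T)
  show ?thesis
  proof
    show "diff T \<in> ahom T T" by (rule diff_T_ahom)
  next
    fix n
    show "diff T ` hcomp T n \<subseteq> hcomp T (n - 1)"
    proof
      fix y assume "y \<in> diff T ` hcomp T n"
      then obtain x where x: "x \<in> hcomp T n" "y = diff T x" by blast
      have "diff T x \<in> hcomp T (n - 1)"
      proof (rule hcomp_T_map[OF abelian diff_T_ahom hcomp_T_subgroup _ x(1)])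
        fix i m l assume h: "m \<in> hcomp M i" "l \<in> hcomp L (n - i)"
        show "diff T (pt m l) \<in> hcomp T (n - 1)"
          using pt_mem[OF M.diff_hcomp[OF h(1)] h(2)] pt_mem[OF h(1) L.diff_hcomp[OF h(2)]] h
          by (simp add: diff_pt L.hcomp_closed T'.hcomp_add T'.hcomp_ksign algebra_simps)
      qed
      then show "y \<in> hcomp T (n - 1)" using x by simp
    qed
  next
    fix t assume t: "t \<in> carrier T"
    show "diff T (diff T t) = \<zero>\<^bsub>T\<^esub>"
    proof (rule tensor_ahom_eqI[where f = "\<lambda>t. diff T (diff T t)", OF abelian ahom_comp[OF diff_T_ahom diff_T_ahom] ahom_const_zero[OF abelian] t])
      fix i j m l assume h: "m \<in> hcomp M i" "l \<in> hcomp L j"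
      note c = M.hcomp_closed[OF h(1)] L.hcomp_closed[OF h(2)]
      let ?x = "pt (diff M m) (diff L l)"
      have x: "?x \<in> carrier T" using c by (simp add: pt_closed M.diff_closed L.diff_closed)
      \<comment> \<open>The two mixed terms agree up to sign, and lowering the degree of
        \<open>m\<close> by one makes their signs opposite.\<close>
      have "diff T (diff T (pt m l)) = ksign T (i - 1) ?x \<oplus>\<^bsub>T\<^esub> ksign T i ?x"
        using h c x
        by (simp add: diff_pt[OF h(1)] ahom_add[OF diff_T_ahom] ahom_ksign[OF abelian abelian diff_T_ahom] pt_closed M.diff_closed L.diff_closed
            T.ksign_closed diff_pt[OF M.diff_hcomp[OF h(1)]] M.diff_diff L.diff_diff pt_zero T.ksign_zero)
      also have "\<dots> = \<zero>\<^bsub>T\<^esub>" using x by (simp add: ksign_def T.l_neg T.r_neg)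
      finally show "diff T (diff T (pt m l)) = \<zero>\<^bsub>T\<^esub>" .
    qed
  qed
qed

end

section \<open>Direct sums of subgroups and complexes of maps\<close>

lemma direct_sum_simps [simp]:
  "zero (direct_sum G H) = zero G" "add (direct_sum G H) = add G" "hcomp (direct_sum G H) = H"
  by (simp_all add: direct_sum_def)

text \<open>Common to graded maps, derivations and connections. Independence of the subgroups is a
  matter of \<open>sum_graded\<close>, which derives it from projections.\<close>

locale subgroup_family = G: abelian_group G for G :: "('g, 'z) ring_scheme" +
  fixes H :: "int \<Rightarrow> 'g set"
  assumes sub: "subgroup (H n) (add_monoid G)"
begin

lemma sum_mem: "x \<in> H n \<Longrightarrow> x \<in> carrier (direct_sum G H)"
  using subgroup_add_monoid(1)[OF sub]
  by (auto simp: direct_sum_def intro!: exI[of _ "{n}"] exI[of _ "\<lambda>_. x"])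

lemma sum_subset: "x \<in> carrier (direct_sum G H) \<Longrightarrow> x \<in> carrier G"
  using subgroup_add_monoid(1)[OF sub] by (auto simp: direct_sum_def intro!: G.finsum_closed)

lemma sum_induct [consumes 1, case_names homogeneous add]:
  assumes "x \<in> carrier (direct_sum G H)" "\<And>n x. x \<in> H n \<Longrightarrow> P x"
    "\<And>x y. \<lbrakk>x \<in> carrier (direct_sum G H); y \<in> carrier (direct_sum G H); P x; P y\<rbrakk> \<Longrightarrow> P (x \<oplus>\<^bsub>G\<^esub> y)"
  shows "P x"
proof -
  obtain I f where x: "x = (\<Oplus>\<^bsub>G\<^esub>n\<in>I. f n)" "finite I" "f \<in> (\<Pi> n\<in>I. H n)"
    using assms(1) by (auto simp: direct_sum_def)
  have "P (\<Oplus>\<^bsub>G\<^esub>n\<in>I. f n)" using x(2,3)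
  proof (induction I rule: finite_induct)
    case empty
    then show ?case using assms(2)[OF subgroup_add_monoid(2)[OF sub]] by simp
  next
    case (insert i I)
    then have "(\<Oplus>\<^bsub>G\<^esub>n\<in>I. f n) \<in> carrier (direct_sum G H)" by (auto simp: direct_sum_def)
    then show ?case
      using insert subgroup_add_monoid(1)[OF sub]
      by (subst G.finsum_insert) (auto intro!: assms(3) sum_mem intro: assms(2))
  qed
  then show ?thesis using x by simp
qed

lemma sum_add_closed:
  assumes "x \<in> carrier (direct_sum G H)" "y \<in> carrier (direct_sum G H)"
  shows "x \<oplus>\<^bsub>G\<^esub> y \<in> carrier (direct_sum G H)"
proof -
  note HG = subgroup_add_monoid(1)[OF sub] and H0 = subgroup_add_monoid(2)[OF sub] and Ha = subgroup_add_monoid(3)[OF sub]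
  obtain I f where x: "x = (\<Oplus>\<^bsub>G\<^esub>n\<in>I. f n)" "finite I" "f \<in> (\<Pi> n\<in>I. H n)"
    using assms(1) by (auto simp: direct_sum_def)
  obtain J g where y: "y = (\<Oplus>\<^bsub>G\<^esub>n\<in>J. g n)" "finite J" "g \<in> (\<Pi> n\<in>J. H n)"
    using assms(2) by (auto simp: direct_sum_def)
  define f' where "f' n = (if n \<in> I then f n else \<zero>\<^bsub>G\<^esub>)" for n
  define g' where "g' n = (if n \<in> J then g n else \<zero>\<^bsub>G\<^esub>)" for n
  have f': "f' n \<in> H n" and g': "g' n \<in> H n" for n using x y H0 by (auto simp: f'_def g'_def)
  have "x = (\<Oplus>\<^bsub>G\<^esub>n\<in>I \<union> J. f' n)"
    unfolding x using x y HG[OF f'] by (intro G.add.finprod_mono_neutral_cong_left) (auto simp: f'_def)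
  moreover have "y = (\<Oplus>\<^bsub>G\<^esub>n\<in>I \<union> J. g' n)"
    unfolding y using x y HG[OF g'] by (intro G.add.finprod_mono_neutral_cong_left) (auto simp: g'_def)
  ultimately have "x \<oplus>\<^bsub>G\<^esub> y = (\<Oplus>\<^bsub>G\<^esub>n\<in>I \<union> J. f' n \<oplus>\<^bsub>G\<^esub> g' n)"
    using HG[OF f'] HG[OF g'] by (simp add: G.finsum_addf)
  moreover have "(\<lambda>n. f' n \<oplus>\<^bsub>G\<^esub> g' n) \<in> (\<Pi> n\<in>I \<union> J. H n)" using f' g' Ha by auto
  moreover have "finite (I \<union> J)" using x y by auto
  ultimately show ?thesis unfolding direct_sum_def by force
qed

lemma sum_inv_closed: "x \<in> carrier (direct_sum G H) \<Longrightarrow> \<ominus>\<^bsub>G\<^esub> x \<in> carrier (direct_sum G H)"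
  by (induction x rule: sum_induct)
    (auto simp: G.minus_add sum_subset intro!: sum_add_closed intro: sum_mem subgroup_add_monoid(4)[OF sub])

lemma sum_abelian: "abelian_group (direct_sum G H)"
proof (rule abelian_groupI)
  fix x assume x: "x \<in> carrier (direct_sum G H)"
  show "\<exists>y\<in>carrier (direct_sum G H). y \<oplus>\<^bsub>direct_sum G H\<^esub> x = \<zero>\<^bsub>direct_sum G H\<^esub>"
    using sum_inv_closed[OF x] sum_subset[OF x] by (auto intro!: bexI[of _ "\<ominus>\<^bsub>G\<^esub> x"] G.l_neg)
qed (auto simp: sum_add_closed sum_subset G.a_ac intro: sum_mem subgroup_add_monoid(2)[OF sub])

text \<open>Inverses are defined by description over the carrier, so those of the smaller group have
  to be compared with those of \<open>G\<close>.\<close>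

lemma sum_inv: 
  assumes "x \<in> carrier (direct_sum G H)" shows "\<ominus>\<^bsub>direct_sum G H\<^esub> x = \<ominus>\<^bsub>G\<^esub> x"
proof -
  interpret D: abelian_group "direct_sum G H" by (rule sum_abelian)
  show ?thesis
    using D.minus_equality[of "\<ominus>\<^bsub>G\<^esub> x" x] sum_inv_closed assms sum_subset G.l_neg by auto
qed

lemma sum_subgroup: "subgroup (H n) (add_monoid (direct_sum G H))"
  by (intro subgroup_add_monoidI[OF sum_abelian])
    (auto simp: sum_inv sum_mem subgroup_add_monoid(2-4)[OF sub])

lemma sum_graded:
  assumes "\<And>n. p n \<in> ahom (direct_sum G H) G" "\<And>n x. x \<in> H n \<Longrightarrow> p n x = x"
    "\<And>n k x. \<lbrakk>x \<in> H k; k \<noteq> n\<rbrakk> \<Longrightarrow> p n x = \<zero>\<^bsub>G\<^esub>"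
  shows "graded_group (direct_sum G H)"
proof (rule graded_groupI[OF sum_abelian G.abelian_group_axioms, where p = p])
  fix P x assume "x \<in> carrier (direct_sum G H)" "\<And>n x. x \<in> hcomp (direct_sum G H) n \<Longrightarrow> P x"
    "\<And>x y. \<lbrakk>x \<in> carrier (direct_sum G H); y \<in> carrier (direct_sum G H); P x; P y\<rbrakk> \<Longrightarrow> P (x \<oplus>\<^bsub>direct_sum G H\<^esub> y)"
  then show "P x" by (induction x rule: sum_induct) auto
qed (use assms sum_subgroup in auto)

end

section \<open>Complexes of graded maps\<close>

lemma map_group_simps [simp]:
  "carrier (map_group M T) = carrier M \<rightarrow>\<^sub>E carrier T"
  "zero (map_group M T) = (\<lambda>x\<in>carrier M. \<zero>\<^bsub>T\<^esub>)"
  "add (map_group M T) = (\<lambda>f g. \<lambda>x\<in>carrier M. f x \<oplus>\<^bsub>T\<^esub> g x)"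
  by (simp_all add: map_group_def)

lemma map_group_abelian:
  assumes "abelian_group T" shows "abelian_group (map_group M T)"
proof -
  interpret T: abelian_group T by fact
  show ?thesis
  proof (rule abelian_groupI)
    fix f assume f: "f \<in> carrier (map_group M T)"
    then have "f x \<in> carrier T" if "x \<in> carrier M" for x using that by auto
    then have "(\<lambda>x\<in>carrier M. \<ominus>\<^bsub>T\<^esub> f x) \<oplus>\<^bsub>map_group M T\<^esub> f = \<zero>\<^bsub>map_group M T\<^esub>"
      by (auto simp: fun_eq_iff restrict_def T.l_neg)
    then show "\<exists>g\<in>carrier (map_group M T). g \<oplus>\<^bsub>map_group M T\<^esub> f = \<zero>\<^bsub>map_group M T\<^esub>"
      using f by (intro bexI[of _ "\<lambda>x\<in>carrier M. \<ominus>\<^bsub>T\<^esub> f x"]) auto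
  qed (auto simp: fun_eq_iff restrict_def T.a_ac PiE_def extensional_def Pi_iff)
qed

lemma map_group_inv:
  assumes "abelian_group T" "f \<in> carrier (map_group M T)"
  shows "\<ominus>\<^bsub>map_group M T\<^esub> f = (\<lambda>x\<in>carrier M. \<ominus>\<^bsub>T\<^esub> f x)"
proof -
  interpret T: abelian_group T by fact
  interpret MG: abelian_group "map_group M T" by (rule map_group_abelian[OF assms(1)])
  have "f x \<in> carrier T" if "x \<in> carrier M" for x using assms(2) that by auto
  then show ?thesis
    using assms(2) by (intro MG.minus_equality) (auto simp: fun_eq_iff restrict_def T.l_neg)
qed

text \<open>Of the action on \<open>T\<close> only additivity is asked; for
  \<open>N \<otimes>\<^sub>B X\<close> this is what \<open>BT_ract\<close> supplies.\<close>

locale hom_complex = M: dg_group M + T: dg_group T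
  for A :: "('a, 'y) ring_scheme" and M :: "('a, 'm) dg_rmod" and T :: "('a, 't) dg_rmod" +
  assumes ract_ahom: "a \<in> carrier A \<Longrightarrow> (\<lambda>t. ract T t a) \<in> ahom T T"
    and ract_M_closed: "\<lbrakk>m \<in> carrier M; a \<in> carrier A\<rbrakk> \<Longrightarrow> ract M m a \<in> carrier M"
begin

abbreviation "MG \<equiv> map_group M T"
abbreviation "C \<equiv> star_hom A M T"
abbreviation "C0 \<equiv> direct_sum MG (gr_hom A M T)"

lemma gr_homI:
  assumes g: "g \<in> ahom M T" and "\<And>m a. \<lbrakk>m \<in> carrier M; a \<in> carrier A\<rbrakk> \<Longrightarrow> g (ract M m a) = ract T (g m) a"
    "\<And>i x. x \<in> hcomp M i \<Longrightarrow> g x \<in> hcomp T (i + n)"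
  shows "restrict g (carrier M) \<in> gr_hom A M T n"
proof -
  have "restrict g (carrier M) \<in> ahom M T" by (rule ahom_cong[OF M.abelian g]) simp
  then show ?thesis
    using assms ahom_closed[OF g] M.hcomp_closed by (auto simp: gr_hom_def ract_M_closed)
qed

lemma gr_homD:
  assumes "f \<in> gr_hom A M T n"
  shows "f \<in> ahom M T" "\<lbrakk>m \<in> carrier M; a \<in> carrier A\<rbrakk> \<Longrightarrow> f (ract M m a) = ract T (f m) a"
    "x \<in> hcomp M i \<Longrightarrow> f x \<in> hcomp T (i + n)" "f \<in> carrier M \<rightarrow>\<^sub>E carrier T"
  using assms by (auto simp: gr_hom_def image_subset_iff)

lemma gr_hom_subgroup: "subgroup (gr_hom A M T n) (add_monoid MG)"
proof (rule subgroup_add_monoidI[OF map_group_abelian[OF T.abelian]])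
  show "gr_hom A M T n \<subseteq> carrier MG" by (auto simp: gr_hom_def)
  have "ract T \<zero>\<^bsub>T\<^esub> a = \<zero>\<^bsub>T\<^esub>" if "a \<in> carrier A" for a
    using ahom_zero[OF T.abelian T.abelian ract_ahom[OF that]] .
  then show "\<zero>\<^bsub>MG\<^esub> \<in> gr_hom A M T n"
    unfolding map_group_simps by (intro gr_homI ahom_const_zero T.abelian) (auto simp: T.hcomp_zero)
next
  fix f g assume f: "f \<in> gr_hom A M T n" and g: "g \<in> gr_hom A M T n"
  note fc = ahom_closed[OF gr_homD(1)[OF f]] and gc = ahom_closed[OF gr_homD(1)[OF g]]
  show "f \<oplus>\<^bsub>MG\<^esub> g \<in> gr_hom A M T n"
    unfolding map_group_simps
    by (intro gr_homI ahom_plus T.abelian gr_homD(1)[OF f] gr_homD(1)[OF g])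
      (auto simp: gr_homD[OF f] gr_homD[OF g] fc gc ahom_add[OF ract_ahom] T.hcomp_add)
next
  fix f assume f: "f \<in> gr_hom A M T n"
  note fc = ahom_closed[OF gr_homD(1)[OF f]]
  show "\<ominus>\<^bsub>MG\<^esub> f \<in> gr_hom A M T n"
    unfolding map_group_inv[OF T.abelian, of f M, simplified, OF gr_homD(4)[OF f]]
    by (intro gr_homI ahom_inv T.abelian gr_homD(1)[OF f])
      (auto simp: gr_homD[OF f] fc ahom_a_inv[OF T.abelian T.abelian ract_ahom] T.hcomp_inv)
qed

sublocale maps: subgroup_family MG "gr_hom A M T"
  by (intro subgroup_family.intro subgroup_family_axioms.intro map_group_abelian T.abelian gr_hom_subgroup)

lemma C_simps [simp]:
  "carrier C = carrier C0" "zero C = (\<lambda>x\<in>carrier M. \<zero>\<^bsub>T\<^esub>)" "add C = add MG" "hcomp C = gr_hom A M T"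
  by (simp_all add: star_hom_def Let_def graded.defs)

lemma same_add_C: "same_add C C0"
  by (simp add: same_add_def)

lemma C_closed: "f \<in> carrier C \<Longrightarrow> f \<in> carrier M \<rightarrow>\<^sub>E carrier T"
  using maps.sum_subset by auto

lemma C_ahom: "f \<in> carrier C \<Longrightarrow> f \<in> ahom M T"
  unfolding C_simps
proof (induction f rule: maps.sum_induct)
  case (add f g)
  have "(\<lambda>x. f x \<oplus>\<^bsub>T\<^esub> g x) \<in> ahom M T" by (intro ahom_plus T.abelian add)
  then show ?case by (rule ahom_cong[OF M.abelian]) simp
qed (rule gr_homD(1))

lemma C_linear: "\<lbrakk>f \<in> carrier C; m \<in> carrier M; a \<in> carrier A\<rbrakk> \<Longrightarrow> f (ract M m a) = ract T (f m) a"
  unfolding C_simps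
proof (induction f rule: maps.sum_induct)
  case (add f g)
  then have "f m \<in> carrier T" "g m \<in> carrier T" using maps.sum_subset by auto
  with add show ?case by (simp add: ract_M_closed ahom_add[OF ract_ahom])
qed (rule gr_homD(2))

text \<open>The degree \<open>n\<close> component of a map: each homogeneous component of the
  argument of degree \<open>i\<close> is followed by the projection to degree \<open>i + n\<close>.
  It shows that maps of different degrees are independent.\<close>

definition comp_proj :: "int \<Rightarrow> ('m \<Rightarrow> 't) \<Rightarrow> 'm \<Rightarrow> 't" where
  "comp_proj n f = (\<lambda>x\<in>carrier M. \<Oplus>\<^bsub>T\<^esub>i\<in>hsupp M x. hpart T (i + n) (f (hpart M i x)))"

lemma graded_C0: "graded_group C0"
proof (rule maps.sum_graded[where p = comp_proj])
  fix n
  show "comp_proj n \<in> ahom C0 MG"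
  proof (rule ahomI)
    fix f assume "f \<in> carrier C0"
    then have "f \<in> carrier M \<rightarrow>\<^sub>E carrier T" using maps.sum_subset by auto
    then show "comp_proj n f \<in> carrier MG"
      by (auto simp: comp_proj_def intro!: T.finsum_closed T.hpart_closed M.hpart_closed)
  next
    fix f g assume "f \<in> carrier C0" "g \<in> carrier C0"
    then have fg: "f \<in> carrier M \<rightarrow>\<^sub>E carrier T" "g \<in> carrier M \<rightarrow>\<^sub>E carrier T" using maps.sum_subset by auto
    have "(\<Oplus>\<^bsub>T\<^esub>i\<in>hsupp M x. hpart T (i + n) ((\<lambda>x\<in>carrier M. f x \<oplus>\<^bsub>T\<^esub> g x) (hpart M i x)))
      = (\<Oplus>\<^bsub>T\<^esub>i\<in>hsupp M x. hpart T (i + n) (f (hpart M i x))) \<oplus>\<^bsub>T\<^esub> (\<Oplus>\<^bsub>T\<^esub>i\<in>hsupp M x. hpart T (i + n) (g (hpart M i x)))"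
      if "x \<in> carrier M" for x
    proof -
      have c: "f (hpart M i x) \<in> carrier T" "g (hpart M i x) \<in> carrier T" for i
        using fg M.hpart_closed[OF that] by auto
      then show ?thesis
        using M.hpart_closed[OF that]
        by (subst T.finsum_addf[symmetric]) (auto simp: T.hpart_closed T.hpart_add)
    qed
    then show "comp_proj n (f \<oplus>\<^bsub>C0\<^esub> g) = comp_proj n f \<oplus>\<^bsub>MG\<^esub> comp_proj n g"
      by (auto simp: comp_proj_def fun_eq_iff)
  qed
next
  fix n f assume f: "f \<in> gr_hom A M T n"
  show "comp_proj n f = f"
  proof
    fix x
    show "comp_proj n f x = f x"
    proof (cases "x \<in> carrier M")
      case True
      have "comp_proj n f x = (\<Oplus>\<^bsub>T\<^esub>i\<in>hsupp M x. f (hpart M i x))"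
        using True ahom_closed[OF gr_homD(1)[OF f]] M.hpart_closed[OF True]
        by (auto simp: comp_proj_def T.hpart_hcomp[OF gr_homD(3)[OF f M.hpart_mem[OF True]]])
      also have "\<dots> = f (\<Oplus>\<^bsub>M\<^esub>i\<in>hsupp M x. hpart M i x)"
        using ahom_finsum[OF M.abelian T.abelian gr_homD(1)[OF f]] M.hpart_closed[OF True] by metis
      finally show ?thesis by (simp add: M.hpart_sum True)
    next
      case False
      then show ?thesis using PiE_arb[OF gr_homD(4)[OF f] False] by (simp add: comp_proj_def)
    qed
  qed
next
  fix n k f assume f: "f \<in> gr_hom A M T k" and kn: "k \<noteq> n"
  show "comp_proj n f = \<zero>\<^bsub>MG\<^esub>"
    using kn by (auto simp: comp_proj_def fun_eq_iff restrict_def T.hpart_hcomp[OF gr_homD(3)[OF f M.hpart_mem]])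
qed

text \<open>For homogeneous \<open>f\<close> and \<open>x\<close> the degree of \<open>f\<close> is
  that of \<open>f x\<close> minus that of \<open>x\<close>, so a sign in \<open>|f|\<close> is a
  sign on the target times a sign on the source. This turns the sign in the differential of a Hom
  complex into a formula valid for inhomogeneous \<open>f\<close>, and it is the origin of the
  conjugation in \<open>der_pt\<close>.\<close>

lemma C_twist:
  assumes f: "f \<in> carrier C" and x: "x \<in> carrier M"
  shows "twist C0 k f x = twist T k (f (twist M k x))"
proof -
  interpret C0: graded_group C0 by (rule graded_C0)
  show ?thesis
    using f unfolding C_simps
  proof (induction f rule: maps.sum_induct)
    case (homogeneous n f)
    have fc: "f \<in> carrier M \<rightarrow>\<^sub>E carrier T" using gr_homD(4)[OF homogeneous] .
    have "ksign C0 (k * n) f x = ksign T (k * n) (f x)"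
      using maps.sum_inv[OF maps.sum_mem[OF homogeneous]] map_group_inv[OF T.abelian, of f M] fc x
      by (simp add: ksign_def)
    also have "\<dots> = twist T k (f (twist M k x))"
      using M.twist_commute[OF T.graded_group_axioms gr_homD(1,3)[OF homogeneous] M.twist_closed[OF x], of k k] x
      by (simp add: M.twist_twist)
    finally show ?case using C0.twist_hcomp[of f n k] homogeneous by simp
  next
    case (add f g)
    have "f \<in> carrier M \<rightarrow>\<^sub>E carrier T" "g \<in> carrier M \<rightarrow>\<^sub>E carrier T" using add(1,2) maps.sum_subset by auto
    then have "f (twist M k x) \<in> carrier T" "g (twist M k x) \<in> carrier T" using M.twist_closed[OF x] by auto
    moreover have "twist C0 k (f \<oplus>\<^bsub>MG\<^esub> g) = twist C0 k f \<oplus>\<^bsub>MG\<^esub> twist C0 k g"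
      using add ahom_add[OF C0.twist_ahom, of f g k] by (simp del: map_group_simps)
    ultimately show ?case
      unfolding \<open>twist C0 k (f \<oplus>\<^bsub>MG\<^esub> g) = _\<close> using add x by (simp add: M.twist_closed ahom_add[OF T.twist_ahom])
  qed
qed

lemma C_diff:
  assumes "f \<in> carrier C" "x \<in> carrier M"
  shows "diff C f x = diff T (f x) \<ominus>\<^bsub>T\<^esub> twist T 1 (f (twist M 1 (diff M x)))"
  using assms C_twist[OF assms(1) M.diff_closed[OF assms(2)]]
  by (simp add: star_hom_def Let_def graded.defs)

lemma C_diff_hcomp:
  assumes "f \<in> gr_hom A M T n" "x \<in> carrier M"
  shows "diff C f x = diff T (f x) \<ominus>\<^bsub>T\<^esub> ksign T n (f (diff M x))"
  using assms C_diff[of f x] maps.sum_mem[OF assms(1)] M.diff_closed[OF assms(2)]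
    M.twist_commute[OF T.graded_group_axioms gr_homD(1,3)[OF assms(1)], where k = 1]
  by (simp add: M.twist_twist M.twist_closed)

lemma C_abelian: "abelian_group C"
  by (rule abelian_group_cong[OF same_add_C maps.sum_abelian])

lemma C_inv: 
  assumes "f \<in> carrier C" "x \<in> carrier M" shows "(\<ominus>\<^bsub>C\<^esub> f) x = \<ominus>\<^bsub>T\<^esub> f x"
  using assms a_inv_cong[OF same_add_C] maps.sum_inv[of f] map_group_inv[OF T.abelian, of f M] C_closed[OF assms(1)]
  by simp

lemma C_hcomp_subgroup: "subgroup (gr_hom A M T n) (add_monoid C)"
  using maps.sum_subgroup subgroup_struct_cong[OF same_add_C] by blast

lemma C_hcomp_closed: "f \<in> gr_hom A M T n \<Longrightarrow> f \<in> carrier C"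
  using maps.sum_mem by simp

lemma C_diff_extensional: "diff C f \<in> extensional (carrier M)"
  by (simp add: star_hom_def Let_def graded.defs)

end

section \<open>The enveloping algebra\<close>

locale dg_extension = A: dg_algebra R A + B: dg_algebra R B
  for R :: "'r ring" and A :: "('r, 'a) dg_alg" and B :: "('r, 'b) dg_alg" +
  fixes \<phi> :: "'a \<Rightarrow> 'b"
  assumes \<phi>_hom: "dg_algebra_hom R A B \<phi>"
begin

abbreviation "BA \<equiv> restrict_scalars \<phi> (regular B)"
abbreviation "ept \<equiv> env_pure A B \<phi>"
abbreviation "Be \<equiv> enveloping A B \<phi>"

lemma \<phi>_dg: "dg_ring_hom A B \<phi>"
  using \<phi>_hom by (auto simp: dg_algebra_hom_def dg_ring_hom_def)

lemma \<phi>_closed: "a \<in> carrier A \<Longrightarrow> \<phi> a \<in> carrier B"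
  using ahom_closed[OF dg_ring_hom_ahom[OF \<phi>_dg]] .

lemma \<phi>_hcomp: "a \<in> hcomp A n \<Longrightarrow> \<phi> a \<in> hcomp B n"
  using \<phi>_dg by (auto simp: dg_ring_hom_def)

lemma dg_module_restrict: "dg_module B N \<Longrightarrow> dg_module A (restrict_scalars \<phi> N)"
  by (rule dg_module_restrict_scalars[OF _ \<phi>_dg A.hcomp_closed])

lemma dg_module_BA: "dg_module A BA"
  by (rule dg_module_restrict[OF B.dg_module_regular])

sublocale BB: dg_tensor R A BA BA
  by (intro dg_tensor.intro dg_alg_module.intro A.dg_algebra_axioms dg_module_BA)

sublocale E: dg_group BB.T by (rule BB.dg_group_T)

lemma same_add_BA: "same_add BA B"
  by (simp add: same_add_def)

lemma ept_pt: "ept = BB.pt"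
  by (simp add: env_pure_def)

lemma ept_biadd: "biadd B B BB.T ept"
  using BB.pt_biadd biadd_struct_cong[OF same_add_BA same_add_BA, of BB.T BB.T] by (simp add: ept_pt same_add_def)

lemma ept_closed: "\<lbrakk>b \<in> carrier B; c \<in> carrier B\<rbrakk> \<Longrightarrow> ept b c \<in> carrier BB.T"
  by (rule biadd_closed[OF ept_biadd])

lemma ept_mem: "\<lbrakk>b \<in> hcomp B i; c \<in> hcomp B j\<rbrakk> \<Longrightarrow> ept b c \<in> hcomp BB.T (i + j)"
  using BB.pt_mem[of b i c j] by (simp add: ept_pt)

lemma ept_balanced:
  "\<lbrakk>b \<in> carrier B; s \<in> hcomp A i; c \<in> hcomp B j\<rbrakk>
    \<Longrightarrow> ept (b \<otimes>\<^bsub>B\<^esub> \<phi> s) c = ksign BB.T (i * j) (ept b (c \<otimes>\<^bsub>B\<^esub> \<phi> s))"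
  using BB.pt_balanced_hcomp[of b s i c j] by (simp add: ept_pt)

lemma ept_ksign:
  assumes "b \<in> carrier B" "c \<in> carrier B"
  shows "ept (ksign B k b) c = ksign BB.T k (ept b c)" "ept b (ksign B k c) = ksign BB.T k (ept b c)"
  using biadd_ksign[OF B.abelian B.abelian BB.abelian ept_biadd assms] by auto

lemma env_ahom_eqI:
  assumes "abelian_group G" "f \<in> ahom BB.T G" "g \<in> ahom BB.T G" "t \<in> carrier BB.T"
    "\<And>i j b c. \<lbrakk>b \<in> hcomp B i; c \<in> hcomp B j\<rbrakk> \<Longrightarrow> f (ept b c) = g (ept b c)"
  shows "f t = g t"
  by (rule BB.tensor_ahom_eqI[OF assms(1-4)]) (use assms(5) in \<open>simp add: ept_pt\<close>)

lemma env_lift: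
  assumes "abelian_group G" "biadd B B G g"
    "\<And>b s c i j k. \<lbrakk>b \<in> hcomp B i; s \<in> hcomp A j; c \<in> hcomp B k\<rbrakk>
      \<Longrightarrow> g (b \<otimes>\<^bsub>B\<^esub> \<phi> s) c = ksign G (j * k) (g b (c \<otimes>\<^bsub>B\<^esub> \<phi> s))"
  shows "tensor_lift G (\<lambda>(b, c). g b c) \<in> ahom BB.T G"
    "\<lbrakk>b \<in> carrier B; c \<in> carrier B\<rbrakk> \<Longrightarrow> tensor_lift G (\<lambda>(b, c). g b c) (ept b c) = g b c"
proof -
  have "biadd BA BA G g"
    using assms(2) biadd_struct_cong[OF same_add_BA same_add_BA, of G G] by (simp add: same_add_def)
  note tl = BB.tensor_lift[OF assms(1) this, simplified, OF assms(3)]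
  show "tensor_lift G (\<lambda>(b, c). g b c) \<in> ahom BB.T G"
    "\<lbrakk>b \<in> carrier B; c \<in> carrier B\<rbrakk> \<Longrightarrow> tensor_lift G (\<lambda>(b, c). g b c) (ept b c) = g b c"
    using tl by (simp_all add: ept_pt)
qed

text \<open>The summand inside the two nested lifts that define the product of the enveloping
  algebra. The lifts are analysed one at a time: the right factor in \<open>env_mult2\<close>, the
  left factor in \<open>env_mult_lift\<close>.\<close>

definition env_mult4 :: "'b \<Rightarrow> 'b \<Rightarrow> 'b \<Rightarrow> 'b \<Rightarrow> ('b, 'b) tensor" where
  "env_mult4 b c b' c' = (\<Oplus>\<^bsub>BB.T\<^esub>j\<in>hsupp B b'. ept (b \<otimes>\<^bsub>B\<^esub> hpart B j b') (twist B j c \<otimes>\<^bsub>B\<^esub> c'))"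

lemma env_mult4_biadd_right:
  assumes "b \<in> carrier B" "c \<in> carrier B"
  shows "biadd B B BB.T (env_mult4 b c)"
  unfolding env_mult4_def[abs_def]
  by (rule biadd_hsum_left[where F = "\<lambda>j b' c'. ept (b \<otimes>\<^bsub>B\<^esub> b') (twist B j c \<otimes>\<^bsub>B\<^esub> c')",
        OF B.graded_group_axioms BB.abelian _ B.abelian])
    (intro biadd_comp[OF ept_biadd] biadd_right[OF B.mult_biadd] assms B.twist_closed)

lemma env_mult4_hcomp:
  assumes "b \<in> carrier B" "c \<in> carrier B" "b' \<in> hcomp B j" "c' \<in> carrier B"
  shows "env_mult4 b c b' c' = ept (b \<otimes>\<^bsub>B\<^esub> b') (twist B j c \<otimes>\<^bsub>B\<^esub> c')"
  unfolding env_mult4_def[abs_def]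
  by (rule biadd_hsum_left_hcomp[where F = "\<lambda>j b' c'. ept (b \<otimes>\<^bsub>B\<^esub> b') (twist B j c \<otimes>\<^bsub>B\<^esub> c')",
        OF B.graded_group_axioms BB.abelian _ assms(3,4)])
    (intro biadd_comp[OF ept_biadd] biadd_right[OF B.mult_biadd] assms B.twist_closed)

text \<open>The sum runs over the components of \<open>b'\<close>, so for homogeneous
  \<open>b'\<close> it is a single term that is visibly biadditive in \<open>b\<close> and
  \<open>c\<close>; general \<open>b'\<close> follow by adding.\<close>

lemma env_mult4_biadd_left:
  assumes "b' \<in> carrier B" "c' \<in> carrier B"
  shows "biadd B B BB.T (\<lambda>b c. env_mult4 b c b' c')"
  using assms(1)
proof (induction b' rule: B.graded_induct)
  case (homogeneous j b')
  have "biadd B B BB.T (\<lambda>b c. ept (b \<otimes>\<^bsub>B\<^esub> b') (twist B j c \<otimes>\<^bsub>B\<^esub> c'))"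
    by (intro biadd_comp[OF ept_biadd] biadd_left[OF B.mult_biadd] ahom_comp[OF B.twist_ahom] assms
        B.hcomp_closed[OF homogeneous])
  then show ?case
    by (rule biadd_cong[OF B.abelian B.abelian]) (simp add: env_mult4_hcomp[OF _ _ homogeneous assms(2)])
next
  case (add x y)
  have eq: "env_mult4 b c (x \<oplus>\<^bsub>B\<^esub> y) c' = env_mult4 b c x c' \<oplus>\<^bsub>BB.T\<^esub> env_mult4 b c y c'"
    if "b \<in> carrier B" "c \<in> carrier B" for b c
    using ahom_add[OF biadd_left[OF env_mult4_biadd_right[OF that] assms(2)] add(1,2)] .
  have "biadd B B BB.T (\<lambda>b c. env_mult4 b c x c' \<oplus>\<^bsub>BB.T\<^esub> env_mult4 b c y c')"
    by (rule biadd_plus[OF BB.abelian add(3,4)])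
  then show ?case by (rule biadd_cong[OF B.abelian B.abelian]) (rule eq[symmetric])
qed

definition env_mult2 :: "'b \<Rightarrow> 'b \<Rightarrow> ('b, 'b) tensor \<Rightarrow> ('b, 'b) tensor" where
  "env_mult2 b c = tensor_lift BB.T (\<lambda>(b', c'). env_mult4 b c b' c')"

lemma env_mult2:
  assumes bc: "b \<in> carrier B" "c \<in> carrier B"
  shows "env_mult2 b c \<in> ahom BB.T BB.T"
    "\<lbrakk>b' \<in> carrier B; c' \<in> carrier B\<rbrakk> \<Longrightarrow> env_mult2 b c (ept b' c') = env_mult4 b c b' c'"
proof -
  have bal: "env_mult4 b c (b' \<otimes>\<^bsub>B\<^esub> \<phi> s) c' = ksign BB.T (j * k) (env_mult4 b c b' (c' \<otimes>\<^bsub>B\<^esub> \<phi> s))"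
    if h: "b' \<in> hcomp B i" "s \<in> hcomp A j" "c' \<in> hcomp B k" for b' s c' i j k
  proof -
    note hc = B.hcomp_closed[OF h(1)] A.hcomp_closed[OF h(2)] B.hcomp_closed[OF h(3)]
      B.hcomp_closed[OF \<phi>_hcomp[OF h(2)]]
    show ?thesis
    proof (rule B.graded_ahom_eqI[where f = "\<lambda>c. env_mult4 b c (b' \<otimes>\<^bsub>B\<^esub> \<phi> s) c'" and G = BB.T
          and g = "\<lambda>c. ksign BB.T (j * k) (env_mult4 b c b' (c' \<otimes>\<^bsub>B\<^esub> \<phi> s))", OF _ _ bc(2)])
      show "(\<lambda>c. env_mult4 b c (b' \<otimes>\<^bsub>B\<^esub> \<phi> s) c') \<in> ahom B BB.T"
        using biadd_right[OF env_mult4_biadd_left, OF B.m_closed] hc bc by blast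
      show "(\<lambda>c. ksign BB.T (j * k) (env_mult4 b c b' (c' \<otimes>\<^bsub>B\<^esub> \<phi> s))) \<in> ahom B BB.T"
        using ahom_ksign_fun[OF BB.abelian biadd_right[OF env_mult4_biadd_left, OF _ B.m_closed]] hc bc by blast
      fix n c assume c: "c \<in> hcomp B n"
      note cc = B.hcomp_closed[OF c]
      \<comment> \<open>Both sides are this tensor up to sign. Passing \<open>s\<close> across
        \<open>c\<close> is counted twice on the left, once in the product and once in the
        balancing, and so drops out.\<close>
      let ?x = "ept (b \<otimes>\<^bsub>B\<^esub> b') (c \<otimes>\<^bsub>B\<^esub> c' \<otimes>\<^bsub>B\<^esub> \<phi> s)"
      have x: "?x \<in> carrier BB.T" using hc bc cc by (simp add: ept_closed)
      have "env_mult4 b c (b' \<otimes>\<^bsub>B\<^esub> \<phi> s) c' = ksign BB.T ((i + j) * n) (ept ((b \<otimes>\<^bsub>B\<^esub> b') \<otimes>\<^bsub>B\<^esub> \<phi> s) (c \<otimes>\<^bsub>B\<^esub> c'))"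
        using hc bc cc by (simp add: env_mult4_hcomp[OF bc(1) cc B.mult_hcomp[OF h(1) \<phi>_hcomp[OF h(2)]]]
            B.twist_hcomp[OF c] B.ksign_mult ept_ksign B.m_assoc)
      also have "\<dots> = ksign BB.T ((i + j) * n + j * (n + k)) ?x"
        using hc bc x by (simp add: ept_balanced[OF _ h(2) B.mult_hcomp[OF c h(3)]] E.ksign_ksign)
      finally have l: "env_mult4 b c (b' \<otimes>\<^bsub>B\<^esub> \<phi> s) c' = ksign BB.T ((i + j) * n + j * (n + k)) ?x" .
      have "ksign BB.T (j * k) (env_mult4 b c b' (c' \<otimes>\<^bsub>B\<^esub> \<phi> s)) = ksign BB.T (j * k + i * n) ?x"
        using hc bc cc x by (simp add: env_mult4_hcomp[OF bc(1) cc h(1)] B.twist_hcomp[OF c] B.ksign_mult ept_ksign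
            B.m_assoc[symmetric] E.ksign_ksign)
      with l show "env_mult4 b c (b' \<otimes>\<^bsub>B\<^esub> \<phi> s) c' = ksign BB.T (j * k) (env_mult4 b c b' (c' \<otimes>\<^bsub>B\<^esub> \<phi> s))"
        by (auto intro!: ksign_cong)
    qed
  qed
  note tl = env_lift[OF BB.abelian env_mult4_biadd_right[OF bc] bal]
  show "env_mult2 b c \<in> ahom BB.T BB.T"
    "\<lbrakk>b' \<in> carrier B; c' \<in> carrier B\<rbrakk> \<Longrightarrow> env_mult2 b c (ept b' c') = env_mult4 b c b' c'"
    using tl by (simp_all add: env_mult2_def)
qed

lemma env_mult2_biadd:
  assumes t: "t \<in> carrier BB.T"
  shows "biadd B B BB.T (\<lambda>b c. env_mult2 b c t)"
proof (rule biaddI)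
  fix b b' c assume bc: "b \<in> carrier B" "b' \<in> carrier B" "c \<in> carrier B"
  show "env_mult2 (b \<oplus>\<^bsub>B\<^esub> b') c t = env_mult2 b c t \<oplus>\<^bsub>BB.T\<^esub> env_mult2 b' c t"
  proof (rule env_ahom_eqI[OF BB.abelian _ _ t])
    show "env_mult2 (b \<oplus>\<^bsub>B\<^esub> b') c \<in> ahom BB.T BB.T" using bc by (simp add: env_mult2)
    show "(\<lambda>t. env_mult2 b c t \<oplus>\<^bsub>BB.T\<^esub> env_mult2 b' c t) \<in> ahom BB.T BB.T"
      using bc by (intro ahom_plus BB.abelian) (auto simp: env_mult2)
    fix i j x y assume "x \<in> hcomp B i" "y \<in> hcomp B j"
    then show "env_mult2 (b \<oplus>\<^bsub>B\<^esub> b') c (ept x y) = env_mult2 b c (ept x y) \<oplus>\<^bsub>BB.T\<^esub> env_mult2 b' c (ept x y)"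
      using bc by (simp add: env_mult2 B.hcomp_closed ahom_add[OF biadd_left[OF env_mult4_biadd_left]])
  qed
next
  fix b c c' assume bc: "b \<in> carrier B" "c \<in> carrier B" "c' \<in> carrier B"
  show "env_mult2 b (c \<oplus>\<^bsub>B\<^esub> c') t = env_mult2 b c t \<oplus>\<^bsub>BB.T\<^esub> env_mult2 b c' t"
  proof (rule env_ahom_eqI[OF BB.abelian _ _ t])
    show "env_mult2 b (c \<oplus>\<^bsub>B\<^esub> c') \<in> ahom BB.T BB.T" using bc by (simp add: env_mult2)
    show "(\<lambda>t. env_mult2 b c t \<oplus>\<^bsub>BB.T\<^esub> env_mult2 b c' t) \<in> ahom BB.T BB.T"
      using bc by (intro ahom_plus BB.abelian) (auto simp: env_mult2)
    fix i j x y assume "x \<in> hcomp B i" "y \<in> hcomp B j"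
    then show "env_mult2 b (c \<oplus>\<^bsub>B\<^esub> c') (ept x y) = env_mult2 b c (ept x y) \<oplus>\<^bsub>BB.T\<^esub> env_mult2 b c' (ept x y)"
      using bc by (simp add: env_mult2 B.hcomp_closed ahom_add[OF biadd_right[OF env_mult4_biadd_left]])
  qed
qed (use ahom_closed[OF env_mult2(1) t] in blast)

lemma Be_simps [simp]:
  "carrier Be = carrier BB.T" "add Be = add BB.T" "zero Be = zero BB.T" "hcomp Be = hcomp BB.T" "diff Be = diff BB.T"
  "one Be = ept \<one>\<^bsub>B\<^esub> \<one>\<^bsub>B\<^esub>" "mult Be s t = tensor_lift BB.T (\<lambda>(b, c). env_mult2 b c t) s"
  by (simp_all add: enveloping_def Let_def dgrp.defs env_mult2_def env_mult4_def)

lemma same_add_Be: "same_add Be BB.T"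
  by (simp add: same_add_def)

lemma env_mult_lift:
  assumes t: "t \<in> carrier BB.T"
  shows "(\<lambda>s. s \<otimes>\<^bsub>Be\<^esub> t) \<in> ahom BB.T BB.T"
    "\<lbrakk>b \<in> carrier B; c \<in> carrier B\<rbrakk> \<Longrightarrow> ept b c \<otimes>\<^bsub>Be\<^esub> t = env_mult2 b c t"
proof -
  have bal: "env_mult2 (b \<otimes>\<^bsub>B\<^esub> \<phi> s) c t = ksign BB.T (j * k) (env_mult2 b (c \<otimes>\<^bsub>B\<^esub> \<phi> s) t)"
    if h: "b \<in> hcomp B i" "s \<in> hcomp A j" "c \<in> hcomp B k" for b s c i j k
  proof -
    note hc = B.hcomp_closed[OF h(1)] B.hcomp_closed[OF h(3)] B.hcomp_closed[OF \<phi>_hcomp[OF h(2)]]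
    show ?thesis
    proof (rule env_ahom_eqI[where f = "env_mult2 (b \<otimes>\<^bsub>B\<^esub> \<phi> s) c", OF BB.abelian _ _ t])
      show "env_mult2 (b \<otimes>\<^bsub>B\<^esub> \<phi> s) c \<in> ahom BB.T BB.T" using hc by (simp add: env_mult2)
      show "(\<lambda>t. ksign BB.T (j * k) (env_mult2 b (c \<otimes>\<^bsub>B\<^esub> \<phi> s) t)) \<in> ahom BB.T BB.T"
        using hc by (intro ahom_ksign_fun BB.abelian env_mult2) auto
      fix i' j' x y assume x: "x \<in> hcomp B i'" and y: "y \<in> hcomp B j'"
      note xy = B.hcomp_closed[OF x] B.hcomp_closed[OF y]
      let ?z = "ept (b \<otimes>\<^bsub>B\<^esub> x) (c \<otimes>\<^bsub>B\<^esub> y \<otimes>\<^bsub>B\<^esub> \<phi> s)"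
      have z: "?z \<in> carrier BB.T" using hc xy by (simp add: ept_closed)
      \<comment> \<open>Now \<open>\<phi> s\<close> sits to the left of the factors \<open>x\<close>
        and \<open>y\<close> of the second tensor; graded commutativity moves it to the end, where
        balancing over \<open>A\<close> applies.\<close>
      have sx: "b \<otimes>\<^bsub>B\<^esub> \<phi> s \<otimes>\<^bsub>B\<^esub> x = ksign B (i' * j) (b \<otimes>\<^bsub>B\<^esub> x \<otimes>\<^bsub>B\<^esub> \<phi> s)"
        using hc xy B.comm_ksign[OF x \<phi>_hcomp[OF h(2)]] by (simp add: B.m_assoc B.ksign_mult)
      have sy: "c \<otimes>\<^bsub>B\<^esub> \<phi> s \<otimes>\<^bsub>B\<^esub> y = ksign B (j' * j) (c \<otimes>\<^bsub>B\<^esub> y \<otimes>\<^bsub>B\<^esub> \<phi> s)"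
        using hc xy B.comm_ksign[OF y \<phi>_hcomp[OF h(2)]] by (simp add: B.m_assoc B.ksign_mult)
      have "env_mult2 (b \<otimes>\<^bsub>B\<^esub> \<phi> s) c (ept x y) = ksign BB.T (i' * k + i' * j + j * (k + j')) ?z"
        using hc xy z by (simp add: env_mult2 env_mult4_hcomp[OF _ _ x] B.twist_hcomp[OF h(3)] B.ksign_mult ept_ksign
            sx ept_balanced[OF _ h(2) B.mult_hcomp[OF h(3) y]] E.ksign_ksign B.ksign_closed ept_closed algebra_simps)
      moreover have "ksign BB.T (j * k) (env_mult2 b (c \<otimes>\<^bsub>B\<^esub> \<phi> s) (ept x y)) = ksign BB.T (j * k + i' * (k + j) + j' * j) ?z"
        using hc xy z by (simp add: env_mult2 env_mult4_hcomp[OF _ _ x] B.twist_hcomp[OF B.mult_hcomp[OF h(3) \<phi>_hcomp[OF h(2)]]] B.ksign_mult ept_ksign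
            sy E.ksign_ksign B.ksign_closed ept_closed algebra_simps)
      ultimately show "env_mult2 (b \<otimes>\<^bsub>B\<^esub> \<phi> s) c (ept x y) = ksign BB.T (j * k) (env_mult2 b (c \<otimes>\<^bsub>B\<^esub> \<phi> s) (ept x y))"
        by (simp add: algebra_simps)
    qed
  qed
  note tl = env_lift[OF BB.abelian env_mult2_biadd[OF t] bal]
  show "(\<lambda>s. s \<otimes>\<^bsub>Be\<^esub> t) \<in> ahom BB.T BB.T"
    "\<lbrakk>b \<in> carrier B; c \<in> carrier B\<rbrakk> \<Longrightarrow> ept b c \<otimes>\<^bsub>Be\<^esub> t = env_mult2 b c t"
    using tl by simp_all
qed

declare Be_simps(7) [simp del]

lemma env_mult_biadd: "biadd BB.T BB.T BB.T (mult Be)"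
proof (rule biaddI)
  fix s t t' assume s: "s \<in> carrier BB.T" and t: "t \<in> carrier BB.T" "t' \<in> carrier BB.T"
  show "s \<otimes>\<^bsub>Be\<^esub> (t \<oplus>\<^bsub>BB.T\<^esub> t') = s \<otimes>\<^bsub>Be\<^esub> t \<oplus>\<^bsub>BB.T\<^esub> s \<otimes>\<^bsub>Be\<^esub> t'"
  proof (rule env_ahom_eqI[where f = "\<lambda>s. s \<otimes>\<^bsub>Be\<^esub> (t \<oplus>\<^bsub>BB.T\<^esub> t')", OF BB.abelian _ _ s])
    show "(\<lambda>s. s \<otimes>\<^bsub>Be\<^esub> (t \<oplus>\<^bsub>BB.T\<^esub> t')) \<in> ahom BB.T BB.T" using t by (intro env_mult_lift E.a_closed)
    show "(\<lambda>s. s \<otimes>\<^bsub>Be\<^esub> t \<oplus>\<^bsub>BB.T\<^esub> s \<otimes>\<^bsub>Be\<^esub> t') \<in> ahom BB.T BB.T"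
      using t by (intro ahom_plus BB.abelian env_mult_lift)
    fix i j b c assume "b \<in> hcomp B i" "c \<in> hcomp B j"
    then show "ept b c \<otimes>\<^bsub>Be\<^esub> (t \<oplus>\<^bsub>BB.T\<^esub> t') = ept b c \<otimes>\<^bsub>Be\<^esub> t \<oplus>\<^bsub>BB.T\<^esub> ept b c \<otimes>\<^bsub>Be\<^esub> t'"
      using t by (simp add: env_mult_lift B.hcomp_closed ahom_add[OF env_mult2(1)])
  qed
qed (use ahom_closed[OF env_mult_lift(1)] ahom_add[OF env_mult_lift(1)] in auto)

lemmas env_mult_closed = biadd_closed[OF env_mult_biadd]

lemma env_mult_ksign:
  assumes "s \<in> carrier BB.T" "t \<in> carrier BB.T"
  shows "ksign BB.T k s \<otimes>\<^bsub>Be\<^esub> t = ksign BB.T k (s \<otimes>\<^bsub>Be\<^esub> t)" "s \<otimes>\<^bsub>Be\<^esub> ksign BB.T k t = ksign BB.T k (s \<otimes>\<^bsub>Be\<^esub> t)"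
  using biadd_ksign[OF BB.abelian BB.abelian BB.abelian env_mult_biadd assms] by auto

lemma env_mult_ept:
  assumes "b \<in> carrier B" "c \<in> hcomp B i" "b' \<in> hcomp B j" "c' \<in> carrier B"
  shows "ept b c \<otimes>\<^bsub>Be\<^esub> ept b' c' = ksign BB.T (i * j) (ept (b \<otimes>\<^bsub>B\<^esub> b') (c \<otimes>\<^bsub>B\<^esub> c'))"
  using assms B.hcomp_closed[OF assms(2)] B.hcomp_closed[OF assms(3)]
  by (simp add: env_mult_lift env_mult2 env_mult4_hcomp B.twist_hcomp B.ksign_mult ept_ksign ept_closed algebra_simps)

text \<open>On pure tensors both bracketings produce the same three crossings, \<open>c\<close> past
  \<open>b'\<close>, \<open>c\<close> past \<open>x\<close> and \<open>c'\<close> past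
  \<open>x\<close>, and hence the same sign.\<close>

lemma env_mult_assoc:
  assumes s: "s \<in> carrier BB.T" and t: "t \<in> carrier BB.T" and u: "u \<in> carrier BB.T"
  shows "s \<otimes>\<^bsub>Be\<^esub> (t \<otimes>\<^bsub>Be\<^esub> u) = (s \<otimes>\<^bsub>Be\<^esub> t) \<otimes>\<^bsub>Be\<^esub> u"
proof -
  note l = biadd_left[OF env_mult_biadd] and r = biadd_right[OF env_mult_biadd]
  note lc = ahom_comp[OF _ l] and rc = ahom_comp[OF _ r]
  show ?thesis
  proof (rule env_ahom_eqI[where f = "\<lambda>s. s \<otimes>\<^bsub>Be\<^esub> (t \<otimes>\<^bsub>Be\<^esub> u)" and g = "\<lambda>s. (s \<otimes>\<^bsub>Be\<^esub> t) \<otimes>\<^bsub>Be\<^esub> u", OF BB.abelian _ _ s])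
    fix i j b c assume h: "b \<in> hcomp B i" "c \<in> hcomp B j"
    note s' = ept_closed[OF B.hcomp_closed[OF h(1)] B.hcomp_closed[OF h(2)]]
    show "ept b c \<otimes>\<^bsub>Be\<^esub> (t \<otimes>\<^bsub>Be\<^esub> u) = (ept b c \<otimes>\<^bsub>Be\<^esub> t) \<otimes>\<^bsub>Be\<^esub> u"
    proof (rule env_ahom_eqI[where f = "\<lambda>t. ept b c \<otimes>\<^bsub>Be\<^esub> (t \<otimes>\<^bsub>Be\<^esub> u)" and g = "\<lambda>t. (ept b c \<otimes>\<^bsub>Be\<^esub> t) \<otimes>\<^bsub>Be\<^esub> u", OF BB.abelian _ _ t])
      fix i' j' b' c' assume h': "b' \<in> hcomp B i'" "c' \<in> hcomp B j'"
      note t' = ept_closed[OF B.hcomp_closed[OF h'(1)] B.hcomp_closed[OF h'(2)]]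
      show "ept b c \<otimes>\<^bsub>Be\<^esub> (ept b' c' \<otimes>\<^bsub>Be\<^esub> u) = (ept b c \<otimes>\<^bsub>Be\<^esub> ept b' c') \<otimes>\<^bsub>Be\<^esub> u"
      proof (rule env_ahom_eqI[where f = "\<lambda>u. ept b c \<otimes>\<^bsub>Be\<^esub> (ept b' c' \<otimes>\<^bsub>Be\<^esub> u)" and g = "\<lambda>u. (ept b c \<otimes>\<^bsub>Be\<^esub> ept b' c') \<otimes>\<^bsub>Be\<^esub> u", OF BB.abelian _ _ u])
        fix k l x y assume h'': "x \<in> hcomp B k" "y \<in> hcomp B l"
        note hc = h[THEN B.hcomp_closed] h'[THEN B.hcomp_closed] h''[THEN B.hcomp_closed]
        show "ept b c \<otimes>\<^bsub>Be\<^esub> (ept b' c' \<otimes>\<^bsub>Be\<^esub> ept x y) = (ept b c \<otimes>\<^bsub>Be\<^esub> ept b' c') \<otimes>\<^bsub>Be\<^esub> ept x y"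
          using hc by (simp add: env_mult_ept[OF hc(3) h'(2) h''(1) hc(6)] env_mult_ept[OF hc(1) h(2) h'(1) hc(4)]
              env_mult_ksign ept_closed env_mult_closed env_mult_ept[OF hc(1) h(2) B.mult_hcomp[OF h'(1) h''(1)]]
              env_mult_ept[OF _ B.mult_hcomp[OF h(2) h'(2)] h''(1)] E.ksign_ksign B.m_assoc algebra_simps)
      qed (use s' t' in \<open>auto intro: rc r env_mult_closed\<close>)
    qed (use s' u in \<open>auto intro: rc r lc l env_mult_closed\<close>)
  qed (use t u in \<open>auto intro: lc l env_mult_closed\<close>)
qed

lemma env_mult_one: 
  assumes "s \<in> carrier BB.T" shows "s \<otimes>\<^bsub>Be\<^esub> ept \<one>\<^bsub>B\<^esub> \<one>\<^bsub>B\<^esub> = s"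
proof (rule env_ahom_eqI[where f = "\<lambda>s. s \<otimes>\<^bsub>Be\<^esub> ept \<one>\<^bsub>B\<^esub> \<one>\<^bsub>B\<^esub>", OF BB.abelian _ ahom_id assms])
  show "(\<lambda>s. s \<otimes>\<^bsub>Be\<^esub> ept \<one>\<^bsub>B\<^esub> \<one>\<^bsub>B\<^esub>) \<in> ahom BB.T BB.T" by (rule biadd_left[OF env_mult_biadd ept_closed]) auto
  fix i j b c assume "b \<in> hcomp B i" "c \<in> hcomp B j"
  then show "ept b c \<otimes>\<^bsub>Be\<^esub> ept \<one>\<^bsub>B\<^esub> \<one>\<^bsub>B\<^esub> = ept b c"
    using env_mult_ept[of b c j "\<one>\<^bsub>B\<^esub>" 0 "\<one>\<^bsub>B\<^esub>"] B.one_hcomp by (simp add: B.hcomp_closed ksign_even)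
qed

lemma env_mult_mem:
  assumes s: "s \<in> hcomp BB.T i" and t: "t \<in> hcomp BB.T j"
  shows "s \<otimes>\<^bsub>Be\<^esub> t \<in> hcomp BB.T (i + j)"
proof (rule BB.hcomp_T_map[where f = "\<lambda>s. s \<otimes>\<^bsub>Be\<^esub> t", OF BB.abelian biadd_left[OF env_mult_biadd E.hcomp_closed[OF t]] E.hcomp_subgroup _ s])
  fix k m l assume h: "m \<in> hcomp BA k" "l \<in> hcomp BA (i - k)"
  then have ml: "m \<in> hcomp B k" "l \<in> hcomp B (i - k)" by auto
  note mlc = ml[THEN B.hcomp_closed]
  show "BB.pt m l \<otimes>\<^bsub>Be\<^esub> t \<in> hcomp BB.T (i + j)"
  proof (rule BB.hcomp_T_map[where f = "\<lambda>t. BB.pt m l \<otimes>\<^bsub>Be\<^esub> t", OF BB.abelian _ E.hcomp_subgroup _ t])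
    show "(\<otimes>\<^bsub>Be\<^esub>) (BB.pt m l) \<in> ahom BB.T BB.T"
      using biadd_right[OF env_mult_biadd ept_closed[OF mlc]] by (simp add: ept_pt)
    fix k' m' l' assume "m' \<in> hcomp BA k'" "l' \<in> hcomp BA (j - k')"
    then have ml': "m' \<in> hcomp B k'" "l' \<in> hcomp B (j - k')" by auto
    note mlc' = ml'[THEN B.hcomp_closed]
    show "BB.pt m l \<otimes>\<^bsub>Be\<^esub> BB.pt m' l' \<in> hcomp BB.T (i + j)"
      using env_mult_ept[OF mlc(1) ml(2) ml'(1) mlc'(2)] ept_mem[OF B.mult_hcomp[OF ml(1) ml'(1)] B.mult_hcomp[OF ml(2) ml'(2)]]
      by (simp add: ept_pt E.hcomp_ksign algebra_simps)
  qed
qed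

lemma diff_ept: "\<lbrakk>b \<in> hcomp B i; c \<in> carrier B\<rbrakk> \<Longrightarrow> diff BB.T (ept b c) = ept (diff B b) c \<oplus>\<^bsub>BB.T\<^esub> ksign BB.T i (ept b (diff B c))"
  using BB.diff_pt[of b i c] by (simp add: ept_pt)

lemma ept_add:
  "\<lbrakk>m \<in> carrier B; m' \<in> carrier B; l \<in> carrier B\<rbrakk> \<Longrightarrow> ept (m \<oplus>\<^bsub>B\<^esub> m') l = ept m l \<oplus>\<^bsub>BB.T\<^esub> ept m' l"
  "\<lbrakk>m \<in> carrier B; l \<in> carrier B; l' \<in> carrier B\<rbrakk> \<Longrightarrow> ept m (l \<oplus>\<^bsub>B\<^esub> l') = ept m l \<oplus>\<^bsub>BB.T\<^esub> ept m l'"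
  using ahom_add[OF biadd_left[OF ept_biadd]] ahom_add[OF biadd_right[OF ept_biadd]] by auto

lemma env_Leibniz:
  assumes s: "s \<in> carrier BB.T" and t: "t \<in> carrier BB.T"
  shows "diff BB.T (s \<otimes>\<^bsub>Be\<^esub> t) = diff BB.T s \<otimes>\<^bsub>Be\<^esub> t \<oplus>\<^bsub>BB.T\<^esub> twist BB.T 1 s \<otimes>\<^bsub>Be\<^esub> diff BB.T t"
proof (rule env_ahom_eqI[where f = "\<lambda>s. diff BB.T (s \<otimes>\<^bsub>Be\<^esub> t)", OF BB.abelian _ _ s])
  note l = biadd_left[OF env_mult_biadd] and r = biadd_right[OF env_mult_biadd]
  show "(\<lambda>s. diff BB.T (s \<otimes>\<^bsub>Be\<^esub> t)) \<in> ahom BB.T BB.T"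
    by (rule ahom_comp[OF l[OF t] E.diff_hom])
  show "(\<lambda>s. diff BB.T s \<otimes>\<^bsub>Be\<^esub> t \<oplus>\<^bsub>BB.T\<^esub> twist BB.T 1 s \<otimes>\<^bsub>Be\<^esub> diff BB.T t) \<in> ahom BB.T BB.T"
    by (intro ahom_plus BB.abelian ahom_comp[OF E.diff_hom l[OF t]] ahom_comp[OF E.twist_ahom l[OF E.diff_closed[OF t]]])
  fix i j b c assume h: "b \<in> hcomp B i" "c \<in> hcomp B j"
  note hc = h[THEN B.hcomp_closed]
  note s = ept_closed[OF hc]
  show "diff BB.T (ept b c \<otimes>\<^bsub>Be\<^esub> t) = diff BB.T (ept b c) \<otimes>\<^bsub>Be\<^esub> t \<oplus>\<^bsub>BB.T\<^esub> twist BB.T 1 (ept b c) \<otimes>\<^bsub>Be\<^esub> diff BB.T t"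
  proof (rule env_ahom_eqI[where f = "\<lambda>t. diff BB.T (ept b c \<otimes>\<^bsub>Be\<^esub> t)", OF BB.abelian _ _ t])
    show "(\<lambda>t. diff BB.T (ept b c \<otimes>\<^bsub>Be\<^esub> t)) \<in> ahom BB.T BB.T" by (rule ahom_comp[OF r[OF s] E.diff_hom])
    show "(\<lambda>t. diff BB.T (ept b c) \<otimes>\<^bsub>Be\<^esub> t \<oplus>\<^bsub>BB.T\<^esub> twist BB.T 1 (ept b c) \<otimes>\<^bsub>Be\<^esub> diff BB.T t) \<in> ahom BB.T BB.T"
      by (intro ahom_plus BB.abelian r[OF E.diff_closed[OF s]] ahom_comp[OF E.diff_hom r[OF E.twist_closed[OF s]]])
    fix i' j' x y assume h': "x \<in> hcomp B i'" "y \<in> hcomp B j'"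
    note hc' = h'[THEN B.hcomp_closed]
    note d = h[THEN B.diff_hcomp] h'[THEN B.diff_hcomp]
    note dc = d[THEN B.hcomp_closed]
    \<comment> \<open>One tensor for each of the four elements that can be differentiated; the two
      sides differ only in how the sign exponents are written, and these agree modulo 2.\<close>
    let ?p = "ept (diff B b \<otimes>\<^bsub>B\<^esub> x) (c \<otimes>\<^bsub>B\<^esub> y)" and ?q = "ept (b \<otimes>\<^bsub>B\<^esub> diff B x) (c \<otimes>\<^bsub>B\<^esub> y)"
      and ?r = "ept (b \<otimes>\<^bsub>B\<^esub> x) (diff B c \<otimes>\<^bsub>B\<^esub> y)" and ?s = "ept (b \<otimes>\<^bsub>B\<^esub> x) (c \<otimes>\<^bsub>B\<^esub> diff B y)"
    have pq: "?p \<in> carrier BB.T" "?q \<in> carrier BB.T" "?r \<in> carrier BB.T" "?s \<in> carrier BB.T"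
      using hc hc' dc by (auto intro!: ept_closed)
    have "diff BB.T (ept b c \<otimes>\<^bsub>Be\<^esub> ept x y) =
      (ksign BB.T (j * i') ?p \<oplus>\<^bsub>BB.T\<^esub> ksign BB.T (j * i' + i) ?q) \<oplus>\<^bsub>BB.T\<^esub>
      (ksign BB.T (j * i' + (i + i')) ?r \<oplus>\<^bsub>BB.T\<^esub> ksign BB.T (j * i' + (i + i') + j) ?s)"
      using hc hc' dc pq
      by (simp add: env_mult_ept[OF hc(1) h(2) h'(1) hc'(2)] E.diff_ksign ept_closed diff_ept[OF B.mult_hcomp[OF h(1) h'(1)]]
          B.Leibniz[OF h(1) h'(1)] B.Leibniz[OF h(2) h'(2)] ept_add ept_ksign B.ksign_closed E.ksign_add E.ksign_closed E.ksign_ksign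
          add.assoc)
    moreover have "diff BB.T (ept b c) \<otimes>\<^bsub>Be\<^esub> ept x y =
      ksign BB.T (j * i') ?p \<oplus>\<^bsub>BB.T\<^esub> ksign BB.T (i + (j - 1) * i') ?r"
      using hc hc' dc pq
      by (simp add: diff_ept[OF h(1)] ahom_add[OF l] ept_closed E.ksign_closed env_mult_ksign
          env_mult_ept[OF dc(1) h(2) h'(1) hc'(2)] env_mult_ept[OF hc(1) d(2) h'(1) hc'(2)] E.ksign_ksign)
    moreover have "twist BB.T 1 (ept b c) \<otimes>\<^bsub>Be\<^esub> diff BB.T (ept x y) =
      ksign BB.T (i + j + j * (i' - 1)) ?q \<oplus>\<^bsub>BB.T\<^esub> ksign BB.T (i + j + i' + j * i') ?s"
      using hc hc' dc pq
      by (simp add: diff_ept[OF h'(1)] E.twist_hcomp[OF ept_mem[OF h]] ahom_add[OF r] ept_closed E.ksign_closed env_mult_ksign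
          env_mult_ept[OF hc(1) h(2) d(3) hc'(2)] env_mult_ept[OF hc(1) h(2) h'(1) dc(4)] E.ksign_ksign E.ksign_add env_mult_closed
          E.a_closed E.diff_closed add.assoc add.commute add.left_commute)
    moreover have "ksign BB.T (j * i' + i) ?q = ksign BB.T (i + j + j * (i' - 1)) ?q"
      "ksign BB.T (j * i' + (i + i')) ?r = ksign BB.T (i + (j - 1) * i') ?r"
      "ksign BB.T (j * i' + (i + i') + j) ?s = ksign BB.T (i + j + i' + j * i') ?s"
      by (auto intro!: ksign_cong)
    ultimately show "diff BB.T (ept b c \<otimes>\<^bsub>Be\<^esub> ept x y) = diff BB.T (ept b c) \<otimes>\<^bsub>Be\<^esub> ept x y
        \<oplus>\<^bsub>BB.T\<^esub> twist BB.T 1 (ept b c) \<otimes>\<^bsub>Be\<^esub> diff BB.T (ept x y)"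
      using pq by (simp add: E.ksign_closed E.a_ac)
  qed
qed

section \<open>The two embeddings of \<open>B\<close> and the multiplication map\<close>

abbreviation "e1 \<equiv> \<lambda>b. ept b \<one>\<^bsub>B\<^esub>"
abbreviation "e2 \<equiv> \<lambda>b. ept \<one>\<^bsub>B\<^esub> b"

lemma env_mult_e1_e2: "\<lbrakk>b \<in> carrier B; c \<in> carrier B\<rbrakk> \<Longrightarrow> e1 b \<otimes>\<^bsub>Be\<^esub> e2 c = ept b c"
  using env_mult_ept[of b "\<one>\<^bsub>B\<^esub>" 0 "\<one>\<^bsub>B\<^esub>" 0 c] B.one_hcomp by (simp add: ksign_even)

lemma env_mult_e2_e1: "\<lbrakk>b \<in> hcomp B i; c \<in> hcomp B j\<rbrakk> \<Longrightarrow> e2 c \<otimes>\<^bsub>Be\<^esub> e1 b = ksign BB.T (i * j) (ept b c)"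
  using env_mult_ept[of "\<one>\<^bsub>B\<^esub>" c j b i "\<one>\<^bsub>B\<^esub>"] by (simp add: B.hcomp_closed mult.commute)

lemma e1_ahom: "e1 \<in> ahom B BB.T" and e2_ahom: "e2 \<in> ahom B BB.T"
  using biadd_left[OF ept_biadd] biadd_right[OF ept_biadd] by auto

lemma e1_dg: "dg_ring_hom B Be e1"
proof -
  have m: "e1 (b \<otimes>\<^bsub>B\<^esub> c) = e1 b \<otimes>\<^bsub>Be\<^esub> e1 c" if "b \<in> carrier B" "c \<in> carrier B" for b c
  proof (rule biadd_eqI[OF B.graded_group_axioms B.graded_group_axioms _ _ _ that, where g = "\<lambda>b c. e1 (b \<otimes>\<^bsub>B\<^esub> c)" and G = BB.T])
    show "biadd B B BB.T (\<lambda>b c. e1 (b \<otimes>\<^bsub>B\<^esub> c))" by (rule biadd_post[OF B.mult_biadd e1_ahom])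
    show "biadd B B BB.T (\<lambda>b c. e1 b \<otimes>\<^bsub>Be\<^esub> e1 c)" by (rule biadd_comp[OF env_mult_biadd e1_ahom e1_ahom])
    fix i j b c assume "b \<in> hcomp B i" "c \<in> hcomp B j"
    then show "e1 (b \<otimes>\<^bsub>B\<^esub> c) = e1 b \<otimes>\<^bsub>Be\<^esub> e1 c"
      using env_mult_ept[of b "\<one>\<^bsub>B\<^esub>" 0 c j "\<one>\<^bsub>B\<^esub>"] B.one_hcomp by (simp add: B.hcomp_closed ksign_even)
  qed
  have d: "e1 (diff B a) = diff BB.T (e1 a)" if "a \<in> carrier B" for a
  proof (rule B.graded_ahom_eqI[where f = "\<lambda>a. e1 (diff B a)", OF ahom_comp[OF B.diff_hom e1_ahom] ahom_comp[OF e1_ahom E.diff_hom] that])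
    fix i a assume a: "a \<in> hcomp B i"
    then show "e1 (diff B a) = diff BB.T (e1 a)"
      using ahom_zero[OF B.abelian BB.abelian biadd_right[OF ept_biadd B.hcomp_closed[OF a]]] 
      by (simp add: diff_ept B.diff_one E.ksign_zero ept_closed B.diff_closed B.hcomp_closed)
  qed
  show ?thesis
    using m d ahom_add[OF e1_ahom] ept_mem[OF _ B.one_hcomp]
    by (auto simp: dg_ring_hom_def ring_hom_def ept_closed) 
qed

lemma e2_dg: "dg_ring_hom B Be e2"
proof -
  have m: "e2 (b \<otimes>\<^bsub>B\<^esub> c) = e2 b \<otimes>\<^bsub>Be\<^esub> e2 c" if "b \<in> carrier B" "c \<in> carrier B" for b c
  proof (rule biadd_eqI[OF B.graded_group_axioms B.graded_group_axioms _ _ _ that, where g = "\<lambda>b c. e2 (b \<otimes>\<^bsub>B\<^esub> c)" and G = BB.T])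
    show "biadd B B BB.T (\<lambda>b c. e2 (b \<otimes>\<^bsub>B\<^esub> c))" by (rule biadd_post[OF B.mult_biadd e2_ahom])
    show "biadd B B BB.T (\<lambda>b c. e2 b \<otimes>\<^bsub>Be\<^esub> e2 c)" by (rule biadd_comp[OF env_mult_biadd e2_ahom e2_ahom])
    fix i j b c assume "b \<in> hcomp B i" "c \<in> hcomp B j"
    then show "e2 (b \<otimes>\<^bsub>B\<^esub> c) = e2 b \<otimes>\<^bsub>Be\<^esub> e2 c"
      using env_mult_ept[of "\<one>\<^bsub>B\<^esub>" b i "\<one>\<^bsub>B\<^esub>" 0 c] B.one_hcomp by (simp add: B.hcomp_closed ksign_even)
  qed
  have d: "e2 (diff B a) = diff BB.T (e2 a)" if "a \<in> carrier B" for a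
    using that ahom_zero[OF B.abelian BB.abelian biadd_left[OF ept_biadd that]] 
    by (simp add: diff_ept[OF B.one_hcomp] B.diff_one ksign_even ept_closed B.diff_closed)
  show ?thesis
    using m d ahom_add[OF e2_ahom] ept_mem[OF B.one_hcomp]
    by (auto simp: dg_ring_hom_def ring_hom_def ept_closed)
qed

abbreviation "\<pi> \<equiv> env_mult_map B"

lemma \<pi>_ahom: "\<pi> \<in> ahom BB.T B"
  and \<pi>_ept: "\<lbrakk>b \<in> carrier B; c \<in> carrier B\<rbrakk> \<Longrightarrow> \<pi> (ept b c) = b \<otimes>\<^bsub>B\<^esub> c"
proof -
  have bal: "b \<otimes>\<^bsub>B\<^esub> \<phi> s \<otimes>\<^bsub>B\<^esub> c = ksign B (j * k) (b \<otimes>\<^bsub>B\<^esub> (c \<otimes>\<^bsub>B\<^esub> \<phi> s))"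
    if h: "b \<in> hcomp B i" "s \<in> hcomp A j" "c \<in> hcomp B k" for b s c i j k
    using B.graded_comm[OF \<phi>_hcomp[OF h(2)] h(3)] h(1)[THEN B.hcomp_closed] h(3)[THEN B.hcomp_closed]
      \<phi>_hcomp[OF h(2), THEN B.hcomp_closed] by (simp add: B.m_assoc B.ksign_mult)
  show "\<pi> \<in> ahom BB.T B" "\<lbrakk>b \<in> carrier B; c \<in> carrier B\<rbrakk> \<Longrightarrow> \<pi> (ept b c) = b \<otimes>\<^bsub>B\<^esub> c"
    unfolding env_mult_map_def
    by (rule env_lift[OF B.abelian B.mult_biadd], erule (2) bal; assumption)+
qed

lemma \<pi>_hcomp:
  assumes "t \<in> hcomp BB.T n" shows "\<pi> t \<in> hcomp B n"
proof (rule BB.hcomp_T_map[OF B.abelian \<pi>_ahom B.hcomp_subgroup _ assms])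
  fix i b c assume "b \<in> hcomp BA i" "c \<in> hcomp BA (n - i)"
  then show "\<pi> (BB.pt b c) \<in> hcomp B n"
    using B.mult_hcomp[of b i c "n - i"] by (simp add: \<pi>_ept[unfolded ept_pt] B.hcomp_closed)
qed

text \<open>Interchanging the middle factors \<open>c\<close> and \<open>x\<close> in
  \<open>b c x y\<close> costs exactly the sign in the product of the enveloping algebra. Hence the
  kernel is an ideal.\<close>

lemma \<pi>_mult:
  assumes s: "s \<in> carrier BB.T" and t: "t \<in> carrier BB.T"
  shows "\<pi> (s \<otimes>\<^bsub>Be\<^esub> t) = \<pi> s \<otimes>\<^bsub>B\<^esub> \<pi> t"
proof (rule env_ahom_eqI[where f = "\<lambda>s. \<pi> (s \<otimes>\<^bsub>Be\<^esub> t)" and G = B, OF B.abelian _ _ s])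
  note l = biadd_left[OF env_mult_biadd] and r = biadd_right[OF env_mult_biadd]
  show "(\<lambda>s. \<pi> (s \<otimes>\<^bsub>Be\<^esub> t)) \<in> ahom BB.T B" by (rule ahom_comp[OF l[OF t] \<pi>_ahom])
  show "(\<lambda>s. \<pi> s \<otimes>\<^bsub>B\<^esub> \<pi> t) \<in> ahom BB.T B"
    by (rule ahom_comp[OF \<pi>_ahom biadd_left[OF B.mult_biadd ahom_closed[OF \<pi>_ahom t]]])
  fix i j b c assume h: "b \<in> hcomp B i" "c \<in> hcomp B j"
  note hc = h[THEN B.hcomp_closed]
  show "\<pi> (ept b c \<otimes>\<^bsub>Be\<^esub> t) = \<pi> (ept b c) \<otimes>\<^bsub>B\<^esub> \<pi> t"
  proof (rule env_ahom_eqI[where f = "\<lambda>t. \<pi> (ept b c \<otimes>\<^bsub>Be\<^esub> t)" and G = B, OF B.abelian _ _ t])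
    show "(\<lambda>t. \<pi> (ept b c \<otimes>\<^bsub>Be\<^esub> t)) \<in> ahom BB.T B" by (rule ahom_comp[OF r[OF ept_closed[OF hc]] \<pi>_ahom])
    show "(\<lambda>t. \<pi> (ept b c) \<otimes>\<^bsub>B\<^esub> \<pi> t) \<in> ahom BB.T B"
      by (rule ahom_comp[OF \<pi>_ahom biadd_right[OF B.mult_biadd ahom_closed[OF \<pi>_ahom ept_closed[OF hc]]]])
    fix k l x y assume h': "x \<in> hcomp B k" "y \<in> hcomp B l"
    note hc' = h'[THEN B.hcomp_closed]
    have "b \<otimes>\<^bsub>B\<^esub> c \<otimes>\<^bsub>B\<^esub> (x \<otimes>\<^bsub>B\<^esub> y) = ksign B (j * k) (b \<otimes>\<^bsub>B\<^esub> x \<otimes>\<^bsub>B\<^esub> (c \<otimes>\<^bsub>B\<^esub> y))"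
    proof -
      have "b \<otimes>\<^bsub>B\<^esub> c \<otimes>\<^bsub>B\<^esub> (x \<otimes>\<^bsub>B\<^esub> y) = b \<otimes>\<^bsub>B\<^esub> ((c \<otimes>\<^bsub>B\<^esub> x) \<otimes>\<^bsub>B\<^esub> y)"
        using hc hc' by (simp add: B.m_assoc)
      also have "\<dots> = ksign B (j * k) (b \<otimes>\<^bsub>B\<^esub> ((x \<otimes>\<^bsub>B\<^esub> c) \<otimes>\<^bsub>B\<^esub> y))"
        unfolding B.graded_comm[OF h(2) h'(1)] using hc hc' by (simp add: B.ksign_mult)
      finally show ?thesis using hc hc' by (simp add: B.m_assoc)
    qed
    then show "\<pi> (ept b c \<otimes>\<^bsub>Be\<^esub> ept x y) = \<pi> (ept b c) \<otimes>\<^bsub>B\<^esub> \<pi> (ept x y)"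
      using hc hc' ahom_ksign[OF BB.abelian B.abelian \<pi>_ahom]
      by (simp add: env_mult_ept[OF hc(1) h(2) h'(1) hc'(2)] \<pi>_ept ept_closed)
  qed
qed

lemma \<pi>_diff:
  assumes t: "t \<in> carrier BB.T" shows "\<pi> (diff BB.T t) = diff B (\<pi> t)"
proof (rule env_ahom_eqI[where f = "\<lambda>t. \<pi> (diff BB.T t)", OF B.abelian ahom_comp[OF E.diff_hom \<pi>_ahom] ahom_comp[OF \<pi>_ahom B.diff_hom] t])
  fix i j b c assume h: "b \<in> hcomp B i" "c \<in> hcomp B j"
  note hc = h[THEN B.hcomp_closed]
  show "\<pi> (diff BB.T (ept b c)) = diff B (\<pi> (ept b c))"
    using hc ahom_ksign[OF BB.abelian B.abelian \<pi>_ahom]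
    by (simp add: diff_ept[OF h(1)] \<pi>_ept B.Leibniz[OF h] ahom_add[OF \<pi>_ahom] ept_closed B.diff_closed E.ksign_closed)
qed

section \<open>The diagonal ideal\<close>

abbreviation "J \<equiv> diag_ideal A B \<phi>"

lemma J_simps [simp]:
  "carrier J = {t \<in> carrier BB.T. \<pi> t = \<zero>\<^bsub>B\<^esub>}" "add J = add BB.T" "zero J = zero BB.T"
  "hcomp J = (\<lambda>n. hcomp BB.T n \<inter> carrier J)" "diff J = diff BB.T" "ract J = mult Be"
  by (simp_all add: diag_ideal_def Let_def)

lemma J_inv_closed: "t \<in> carrier J \<Longrightarrow> \<ominus>\<^bsub>BB.T\<^esub> t \<in> carrier J"
  using ahom_a_inv[OF BB.abelian B.abelian \<pi>_ahom] by simp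

lemma J_abelian: "abelian_group J"
proof (rule abelian_groupI)
  fix t assume t: "t \<in> carrier J"
  then show "\<exists>y\<in>carrier J. y \<oplus>\<^bsub>J\<^esub> t = \<zero>\<^bsub>J\<^esub>"
    using J_inv_closed[OF t] by (intro bexI[of _ "\<ominus>\<^bsub>BB.T\<^esub> t"]) (auto simp: E.l_neg)
qed (auto simp: ahom_add[OF \<pi>_ahom] ahom_zero[OF BB.abelian B.abelian \<pi>_ahom] E.a_ac)

lemma J_inv: "t \<in> carrier J \<Longrightarrow> \<ominus>\<^bsub>J\<^esub> t = \<ominus>\<^bsub>BB.T\<^esub> t"
  using J_inv_closed by (intro abelian_group.minus_equality[OF J_abelian]) (auto simp: E.l_neg)

lemma J_ksign: "t \<in> carrier J \<Longrightarrow> ksign J k t = ksign BB.T k t"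
  by (simp add: ksign_def J_inv del: J_simps)

text \<open>The multiplication map preserves degrees and so commutes with taking components; its
  kernel is therefore closed under them.\<close>

lemma J_hpart:
  assumes "t \<in> carrier J" shows "hpart BB.T n t \<in> carrier J"
proof -
  have t: "t \<in> carrier BB.T" "\<pi> t = \<zero>\<^bsub>B\<^esub>" using assms by auto
  have "hpart B n (\<pi> t) = \<pi> (hpart BB.T n t)"
  proof (rule E.graded_ahom_eqI[where f = "\<lambda>t. hpart B n (\<pi> t)", OF ahom_comp[OF \<pi>_ahom B.hpart_ahom] ahom_comp[OF E.hpart_ahom \<pi>_ahom] t(1)])
    fix i x assume "x \<in> hcomp BB.T i"
    then show "hpart B n (\<pi> x) = \<pi> (hpart BB.T n x)"
      by (simp add: B.hpart_hcomp[OF \<pi>_hcomp] E.hpart_hcomp ahom_zero[OF BB.abelian B.abelian \<pi>_ahom])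
  qed
  then show ?thesis
    using t E.hpart_closed[OF t(1)] B.hpart_hcomp[OF B.hcomp_zero] by simp
qed

lemma J_graded: "graded_group J"
\<comment> \<open>The components are taken in the ambient tensor product, which is why the
  projections may have a target other than the group itself.\<close>
proof (rule graded_groupI[where G = BB.T and p = "hpart BB.T", OF J_abelian BB.abelian])
  fix n
  show "subgroup (hcomp J n) (add_monoid J)"
    using E.hcomp_add[of _ n] E.hcomp_zero[of n] E.hcomp_inv[of _ n]
    by (intro subgroup_add_monoidI[OF J_abelian]) 
      (auto simp: J_inv ahom_add[OF \<pi>_ahom] ahom_zero[OF BB.abelian B.abelian \<pi>_ahom] E.hcomp_closed
       ahom_a_inv[OF BB.abelian B.abelian \<pi>_ahom])
  show "hpart BB.T n \<in> ahom J BB.T"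
    using E.hpart_ahom by (auto simp: hom_def)
next
  fix P t assume t: "t \<in> carrier J" and h: "\<And>n x. x \<in> hcomp J n \<Longrightarrow> P x"
    and a: "\<And>x y. \<lbrakk>x \<in> carrier J; y \<in> carrier J; P x; P y\<rbrakk> \<Longrightarrow> P (x \<oplus>\<^bsub>J\<^esub> y)"
  have tT: "t \<in> carrier BB.T" using t by simp
  have "finite I \<Longrightarrow> (\<Oplus>\<^bsub>BB.T\<^esub>n\<in>I. hpart BB.T n t) \<in> carrier J \<and> P (\<Oplus>\<^bsub>BB.T\<^esub>n\<in>I. hpart BB.T n t)" for I
  proof (induction I rule: finite_induct)
    case empty
    have "\<zero>\<^bsub>BB.T\<^esub> \<in> hcomp J 0" using E.hcomp_zero by (auto simp: ahom_zero[OF BB.abelian B.abelian \<pi>_ahom])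
    then show ?case using h by auto
  next
    case (insert i I)
    have hi: "hpart BB.T i t \<in> carrier J" "P (hpart BB.T i t)"
      using J_hpart[OF t] E.hpart_mem[OF tT] h[of "hpart BB.T i t" i] by auto
    have "(\<Oplus>\<^bsub>BB.T\<^esub>n\<in>insert i I. hpart BB.T n t) = hpart BB.T i t \<oplus>\<^bsub>BB.T\<^esub> (\<Oplus>\<^bsub>BB.T\<^esub>n\<in>I. hpart BB.T n t)"
      using insert E.hpart_closed[OF tT] by (simp add: E.finsum_insert)
    then show ?case
      using insert.IH hi a[OF hi(1) _ hi(2)] abelian_groupE(1)[OF J_abelian hi(1)] by simp
  qed
  from this[OF E.hsupp_finite[OF tT]] show "P t" using E.hpart_sum[OF tT] by simp
qed (auto simp: E.hpart_hcomp)

lemma J_dg_module: "dg_module Be J"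
proof -
  interpret J: graded_group J by (rule J_graded)
  have z: "x \<otimes>\<^bsub>B\<^esub> \<zero>\<^bsub>B\<^esub> = \<zero>\<^bsub>B\<^esub>" "\<zero>\<^bsub>B\<^esub> \<otimes>\<^bsub>B\<^esub> x = \<zero>\<^bsub>B\<^esub>" if "x \<in> carrier B" for x using that by auto
  have mJ: "m \<otimes>\<^bsub>Be\<^esub> a \<in> carrier J" if "m \<in> carrier J" "a \<in> carrier BB.T" for m a
    using that ahom_closed[OF \<pi>_ahom that(2)] by (simp add: env_mult_closed \<pi>_mult)
  have dJ: "diff BB.T m \<in> carrier J" if "m \<in> carrier J" for m
    using that ahom_zero[OF B.abelian B.abelian B.diff_hom] by (simp add: \<pi>_diff E.diff_closed)
  have dg: "dg_group_axioms J"
  proof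
    show "diff J \<in> ahom J J"
      using dJ E.diff_add by (auto simp: hom_def simp del: J_simps(1)) (auto)
  next
    fix n show "diff J ` hcomp J n \<subseteq> hcomp J (n - 1)"
      using dJ E.diff_hcomp by (auto simp del: J_simps(1))
  qed (simp add: E.diff_diff)
  have gm: "graded_module_axioms Be J"
  proof
    fix m a assume "m \<in> carrier J" "a \<in> carrier Be"
    then show "ract J m a \<in> carrier J" using mJ by (simp del: J_simps(1))
  next
    fix m a i j assume "m \<in> hcomp J i" "a \<in> hcomp Be j"
    then show "ract J m a \<in> hcomp J (i + j)"
      using mJ E.hcomp_closed by (auto simp: env_mult_mem simp del: J_simps(1))
  qed (auto simp: ahom_add[OF biadd_left[OF env_mult_biadd]] ahom_add[OF biadd_right[OF env_mult_biadd]] env_mult_assoc env_mult_one)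
  have L: "dg_module_axioms Be J"
  proof
    fix m i a j assume m: "m \<in> hcomp J i" and a: "a \<in> hcomp Be j"
    have "m \<in> hcomp BB.T i" "m \<in> carrier BB.T" "m \<in> carrier J" "a \<in> carrier BB.T" using m a by (auto intro: E.hcomp_closed)
    then show "diff J (ract J m a) = ract J (diff J m) a \<oplus>\<^bsub>J\<^esub> ksign J i (ract J m (diff Be a))"
      using mJ[of m "diff BB.T a"]
      by (simp add: env_Leibniz E.twist_hcomp J_ksign env_mult_ksign E.diff_closed del: J_simps(1))
  qed
  show ?thesis
    by (intro dg_module.intro graded_module.intro J_graded dg_group.intro dg gm L)
qed

end

section \<open>The tensor product with a bimodule\<close>

locale dg_base = dg_extension R A B \<phi> + N: dg_alg_module R B N
  for R :: "'r ring" and A :: "('r, 'a) dg_alg" and B :: "('r, 'b) dg_alg" and \<phi> :: "'a \<Rightarrow> 'b"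
    and N :: "('b, 'n) dg_rmod"
begin

section \<open>The base change and its counit\<close>

abbreviation "NR \<equiv> restrict_scalars \<phi> N"
abbreviation "BC \<equiv> base_change A B \<phi> N"

lemma NR_module: "dg_module A NR"
  by (rule dg_module_restrict[OF N.dg_module_axioms])

sublocale NA: dg_tensor R A NR BA
  by (intro dg_tensor.intro dg_alg_module.intro A.dg_algebra_axioms dg_module_BA NR_module)

sublocale NAT: dg_group NA.T by (rule NA.dg_group_T)

lemma BC_simps [simp]:
  "carrier BC = carrier NA.T" "add BC = add NA.T" "zero BC = zero NA.T" "hcomp BC = hcomp NA.T" "diff BC = diff NA.T"
  "ract BC t b = tensor_lift NA.T (\<lambda>(n, c). NA.pt n (c \<otimes>\<^bsub>B\<^esub> b)) t"
  by (simp_all add: base_change_def Let_def dgrp.defs)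

declare BC_simps(6) [simp del]

lemma biadd_NB: "biadd N B G g \<Longrightarrow> biadd NR BA G g"
  using biadd_struct_cong[OF same_add_restrict[of \<phi> N] same_add_BA, of G G] by (simp add: same_add_def)

lemma npt_biadd: "biadd N B NA.T NA.pt"
  using NA.pt_biadd biadd_struct_cong[OF same_add_restrict[of \<phi> N] same_add_BA, of NA.T NA.T] by (simp add: same_add_def)

lemma npt_closed: "\<lbrakk>n \<in> carrier N; c \<in> carrier B\<rbrakk> \<Longrightarrow> NA.pt n c \<in> carrier NA.T"
  by (rule biadd_closed[OF npt_biadd])

lemma npt_balanced:
  "\<lbrakk>n \<in> carrier N; s \<in> hcomp A i; c \<in> hcomp B j\<rbrakk>
    \<Longrightarrow> NA.pt (ract N n (\<phi> s)) c = ksign NA.T (i * j) (NA.pt n (c \<otimes>\<^bsub>B\<^esub> \<phi> s))"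
  using NA.pt_balanced_hcomp[of n s i c j] by simp

lemma na_ahom_eqI:
  assumes "abelian_group G" "f \<in> ahom NA.T G" "g \<in> ahom NA.T G" "t \<in> carrier NA.T"
    "\<And>i j n c. \<lbrakk>n \<in> hcomp N i; c \<in> hcomp B j\<rbrakk> \<Longrightarrow> f (NA.pt n c) = g (NA.pt n c)"
  shows "f t = g t"
  by (rule NA.tensor_ahom_eqI[OF assms(1-4)]) (use assms(5) in simp)

lemma na_lift:
  assumes "abelian_group G" "biadd N B G g"
    "\<And>n s c i j k. \<lbrakk>n \<in> hcomp N i; s \<in> hcomp A j; c \<in> hcomp B k\<rbrakk>
      \<Longrightarrow> g (ract N n (\<phi> s)) c = ksign G (j * k) (g n (c \<otimes>\<^bsub>B\<^esub> \<phi> s))"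
  shows "tensor_lift G (\<lambda>(n, c). g n c) \<in> ahom NA.T G"
    "\<lbrakk>n \<in> carrier N; c \<in> carrier B\<rbrakk> \<Longrightarrow> tensor_lift G (\<lambda>(n, c). g n c) (NA.pt n c) = g n c"
  using NA.tensor_lift[OF assms(1) biadd_NB[OF assms(2)], simplified, OF assms(3)] by simp_all

text \<open>Balancing moves \<open>\<phi> s\<close> behind \<open>c b\<close>; commuting it back
  past \<open>b\<close> cancels the part of the sign that involves the degree of
  \<open>b\<close>.\<close>

lemma BC_ract:
  assumes b: "b \<in> carrier B"
  shows "(\<lambda>t. ract BC t b) \<in> ahom NA.T NA.T"
    "\<lbrakk>n \<in> carrier N; c \<in> carrier B\<rbrakk> \<Longrightarrow> ract BC (NA.pt n c) b = NA.pt n (c \<otimes>\<^bsub>B\<^esub> b)"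
proof -
  have g: "biadd N B NA.T (\<lambda>n c. NA.pt n (c \<otimes>\<^bsub>B\<^esub> b))"
    by (rule biadd_comp[OF npt_biadd ahom_id biadd_left[OF B.mult_biadd b]])
  have bal: "NA.pt (ract N n (\<phi> s)) (c \<otimes>\<^bsub>B\<^esub> b) = ksign NA.T (j * k) (NA.pt n (c \<otimes>\<^bsub>B\<^esub> \<phi> s \<otimes>\<^bsub>B\<^esub> b))"
    if h: "n \<in> hcomp N i" "s \<in> hcomp A j" "c \<in> hcomp B k" for n s c i j k
  proof -
    note hc = N.hcomp_closed[OF h(1)] \<phi>_hcomp[OF h(2), THEN B.hcomp_closed] B.hcomp_closed[OF h(3)]
    note r = biadd_right[OF npt_biadd]
    show ?thesis
    proof (rule B.graded_ahom_eqI[where f = "\<lambda>b. NA.pt (ract N n (\<phi> s)) (c \<otimes>\<^bsub>B\<^esub> b)" and G = NA.T, OF _ _ b])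
      show "(\<lambda>b. NA.pt (ract N n (\<phi> s)) (c \<otimes>\<^bsub>B\<^esub> b)) \<in> ahom B NA.T"
        by (rule ahom_comp[OF biadd_right[OF B.mult_biadd hc(3)] r[OF N.ract_closed[OF hc(1,2)]]])
      show "(\<lambda>b. ksign NA.T (j * k) (NA.pt n (c \<otimes>\<^bsub>B\<^esub> \<phi> s \<otimes>\<^bsub>B\<^esub> b))) \<in> ahom B NA.T"
        by (rule ahom_ksign_fun[OF NA.abelian ahom_comp[OF biadd_right[OF B.mult_biadd] r[OF hc(1)]]]) (use hc in simp)
      fix l b assume b: "b \<in> hcomp B l"
      have "c \<otimes>\<^bsub>B\<^esub> b \<otimes>\<^bsub>B\<^esub> \<phi> s = ksign B (j * l) (c \<otimes>\<^bsub>B\<^esub> \<phi> s \<otimes>\<^bsub>B\<^esub> b)"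
        using hc B.hcomp_closed[OF b] B.comm_ksign[OF \<phi>_hcomp[OF h(2)] b] by (simp add: B.m_assoc B.ksign_mult)
      then show "NA.pt (ract N n (\<phi> s)) (c \<otimes>\<^bsub>B\<^esub> b) = ksign NA.T (j * k) (NA.pt n (c \<otimes>\<^bsub>B\<^esub> \<phi> s \<otimes>\<^bsub>B\<^esub> b))"
        using hc B.hcomp_closed[OF b] biadd_ksign(2)[OF N.abelian B.abelian NA.abelian npt_biadd]
        by (simp add: npt_balanced[OF hc(1) h(2) B.mult_hcomp[OF h(3) b]] NAT.ksign_ksign npt_closed)
          (auto intro!: ksign_cong)
    qed
  qed
  show "(\<lambda>t. ract BC t b) \<in> ahom NA.T NA.T"
    unfolding BC_simps by (rule na_lift[OF NA.abelian g], erule (2) bal)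
  show "\<lbrakk>n \<in> carrier N; c \<in> carrier B\<rbrakk> \<Longrightarrow> ract BC (NA.pt n c) b = NA.pt n (c \<otimes>\<^bsub>B\<^esub> b)"
    unfolding BC_simps by (rule na_lift[OF NA.abelian g], erule (2) bal)
qed

abbreviation "\<epsilon> \<equiv> base_change_counit N"

lemma \<epsilon>_ahom: "\<epsilon> \<in> ahom NA.T N"
  and \<epsilon>_npt: "\<lbrakk>n \<in> carrier N; c \<in> carrier B\<rbrakk> \<Longrightarrow> \<epsilon> (NA.pt n c) = ract N n c"
proof -
  have bal: "ract N (ract N n (\<phi> s)) c = ksign N (j * k) (ract N n (c \<otimes>\<^bsub>B\<^esub> \<phi> s))"
    if h: "n \<in> hcomp N i" "s \<in> hcomp A j" "c \<in> hcomp B k" for n s c i j k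
    using B.graded_comm[OF \<phi>_hcomp[OF h(2)] h(3)] h(1)[THEN N.hcomp_closed] h(3)[THEN B.hcomp_closed]
      \<phi>_hcomp[OF h(2), THEN B.hcomp_closed] by (simp add: N.ract_mult[symmetric] N.ract_ksign)
  show "\<epsilon> \<in> ahom NA.T N" "\<lbrakk>n \<in> carrier N; c \<in> carrier B\<rbrakk> \<Longrightarrow> \<epsilon> (NA.pt n c) = ract N n c"
    unfolding base_change_counit_def
    by (rule na_lift[OF N.abelian N.ract_biadd], erule (2) bal; assumption)+
qed

end

locale dg_bimodule = dg_base R A B \<phi> N + X: dg_module "enveloping A B \<phi>" X
  for R :: "'r ring" and A :: "('r, 'a) dg_alg" and B :: "('r, 'b) dg_alg" and \<phi> :: "'a \<Rightarrow> 'b"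
    and N :: "('b, 'n) dg_rmod" and X :: "(('b, 'b) tensor, 'x) dg_rmod"
begin

section \<open>The bimodule structure of \<open>X\<close> and the tensor product over
  \<open>B\<close>\<close>

abbreviation "OX \<equiv> outer A B \<phi> X"
abbreviation "IX \<equiv> inner A B \<phi> X"
abbreviation "BT \<equiv> bitensor A B \<phi> N X"

lemma OX_simps [simp]:
  "carrier OX = carrier X" "add OX = add X" "zero OX = zero X" "hcomp OX = hcomp X" "diff OX = diff X"
  "ract OX x b = ract X x (e1 b)"
  by (simp_all add: outer_def)

lemma IX_simps [simp]:
  "carrier IX = carrier X" "add IX = add X" "zero IX = zero X" "hcomp IX = hcomp X" "diff IX = diff X"
  "ract IX x b = ract X x (e2 b)"
  by (simp_all add: inner_def)

lemma OX_twist [simp]: "twist OX k x = twist X k x" "ksign OX k x = ksign X k x"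
  by (simp_all add: outer_def)

lemma IX_twist [simp]: "twist IX k x = twist X k x" "ksign IX k x = ksign X k x"
  by (simp_all add: inner_def)

lemma OX_module: "dg_module B OX"
  unfolding outer_def by (rule dg_module_restrict_scalars[OF X.dg_module_axioms e1_dg B.hcomp_closed])

lemma IX_module: "dg_module B IX"
  unfolding inner_def by (rule dg_module_restrict_scalars[OF X.dg_module_axioms e2_dg B.hcomp_closed])

sublocale OX: dg_alg_module R B OX
  by (intro dg_alg_module.intro B.dg_algebra_axioms OX_module)

sublocale IX: dg_alg_module R B IX
  by (intro dg_alg_module.intro B.dg_algebra_axioms IX_module)

sublocale NX: dg_tensor R B N OX
  by (intro dg_tensor.intro B.dg_algebra_axioms N.dg_alg_module_axioms OX.dg_alg_module_axioms)

sublocale NXT: dg_group NX.T by (rule NX.dg_group_T)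

abbreviation lx (infixl "\<star>" 75) where "b \<star> x \<equiv> left_action B OX b x"
abbreviation rx (infixl "\<bullet>" 75) where "x \<bullet> b \<equiv> ract X x (ept \<one>\<^bsub>B\<^esub> b)"

lemma lx_biadd: "biadd B X X (\<star>)"
  using OX.left_biadd biadd_struct_cong[of B B OX X OX X] by (simp add: same_add_def)

lemma rx_biadd: "biadd X B X (\<bullet>)"
  using IX.ract_biadd[unfolded inner_def restrict_scalars_simps(6)]
    biadd_struct_cong[of "restrict_scalars e2 X" X B B "restrict_scalars e2 X" X] by (simp add: same_add_def)

lemmas rx_closed = biadd_closed[OF rx_biadd] and lx_closed = biadd_closed[OF lx_biadd]

lemma rx_ksign:
  assumes "x \<in> carrier X" "b \<in> carrier B"
  shows "ksign X k x \<bullet> b = ksign X k (x \<bullet> b)" "x \<bullet> ksign B k b = ksign X k (x \<bullet> b)"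
  using biadd_ksign[OF X.abelian B.abelian X.abelian rx_biadd assms] by auto

text \<open>In the enveloping algebra \<open>1 \<otimes> c\<close> and \<open>b \<otimes> 1\<close>
  commute up to the sign of \<open>|b||c|\<close>, and this is the extra sign that the left action
  of \<open>b\<close> picks up on \<open>x c\<close> compared with \<open>x\<close>.\<close>

lemma lx_rx:
  assumes b: "b \<in> carrier B" and x: "x \<in> carrier X" and c: "c \<in> carrier B"
  shows "b \<star> (x \<bullet> c) = (b \<star> x) \<bullet> c"
proof (rule X.graded_ahom_eqI[where f = "\<lambda>x. b \<star> (x \<bullet> c)" and G = X, OF _ _ x])
  show "(\<lambda>x. b \<star> (x \<bullet> c)) \<in> ahom X X"
    by (rule ahom_comp[OF biadd_left[OF rx_biadd c] biadd_right[OF lx_biadd b]])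
  show "(\<lambda>x. (b \<star> x) \<bullet> c) \<in> ahom X X"
    by (rule ahom_comp[OF biadd_right[OF lx_biadd b] biadd_left[OF rx_biadd c]])
  fix k x assume x: "x \<in> hcomp X k"
  note xc = X.hcomp_closed[OF x]
  show "b \<star> (x \<bullet> c) = (b \<star> x) \<bullet> c"
  proof (rule biadd_eqI[OF B.graded_group_axioms B.graded_group_axioms _ _ _ b c, where g = "\<lambda>b c. b \<star> (x \<bullet> c)"])
    show "biadd B B X (\<lambda>b c. b \<star> (x \<bullet> c))"
      by (rule biadd_comp[OF lx_biadd ahom_id biadd_right[OF rx_biadd xc]])
    show "biadd B B X (\<lambda>b c. (b \<star> x) \<bullet> c)"
      by (rule biadd_comp[OF rx_biadd biadd_left[OF lx_biadd xc] ahom_id])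
    fix i j b c assume h: "b \<in> hcomp B i" "c \<in> hcomp B j"
    note hc = h[THEN B.hcomp_closed]
    have e: "e1 b \<in> carrier Be" "e2 c \<in> carrier Be" "ept b c \<in> carrier Be" using hc by (auto intro: ept_closed)
    have y: "ract X x (ept b c) \<in> carrier X" using xc e by (simp add: X.ract_closed)
    have 1: "ract X (x \<bullet> c) (e1 b) = ksign X (i * j) (ract X x (ept b c))"
      using X.ract_mult[OF xc e(2,1)] env_mult_e2_e1[OF h] biadd_ksign(2)[OF X.abelian BB.abelian X.abelian _ xc]
        X.ract_biadd biadd_struct_cong[of X X Be BB.T X X] e
      by (simp add: same_add_def)
    have 2: "ract X x (e1 b) \<bullet> c = ract X x (ept b c)"
      using X.ract_mult[OF xc e(1,2)] env_mult_e1_e2[OF hc] by simp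
    have "b \<star> (x \<bullet> c) = ksign X (i * (k + j)) (ract X (x \<bullet> c) (e1 b))"
      using OX.left_hcomp[OF h(1), of "x \<bullet> c" "k + j"] IX.ract_hcomp[of x k c j] x h by simp
    also have "\<dots> = ksign X (i * k) (ract X x (ept b c))"
      using y by (simp add: 1 X.ksign_ksign) (auto intro!: ksign_cong)
    also have "\<dots> = (b \<star> x) \<bullet> c"
      using OX.left_hcomp[OF h(1), of x k] x xc hc e by (simp add: rx_ksign X.ract_closed 2)
    finally show "b \<star> (x \<bullet> c) = (b \<star> x) \<bullet> c" .
  qed
qed

lemma xpt_biadd: "biadd N X NX.T NX.pt"
  using NX.pt_biadd biadd_struct_cong[of N N OX X NX.T NX.T] by (simp add: same_add_def)

lemma xpt_closed: "\<lbrakk>n \<in> carrier N; x \<in> carrier X\<rbrakk> \<Longrightarrow> NX.pt n x \<in> carrier NX.T"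
  by (rule biadd_closed[OF xpt_biadd])

lemma xpt_ksign:
  assumes "n \<in> carrier N" "x \<in> carrier X"
  shows "NX.pt (ksign N k n) x = ksign NX.T k (NX.pt n x)" "NX.pt n (ksign X k x) = ksign NX.T k (NX.pt n x)"
  using biadd_ksign[OF N.abelian X.abelian NX.abelian xpt_biadd assms] by auto

lemma xpt_balanced:
  "\<lbrakk>n \<in> carrier N; b \<in> carrier B; x \<in> carrier X\<rbrakk> \<Longrightarrow> NX.pt (ract N n b) x = NX.pt n (b \<star> x)"
  using NX.pt_balanced[of n b x] by simp

lemma nx_ahom_eqI:
  assumes "abelian_group G" "f \<in> ahom NX.T G" "g \<in> ahom NX.T G" "t \<in> carrier NX.T"
    "\<And>i j n x. \<lbrakk>n \<in> hcomp N i; x \<in> hcomp X j\<rbrakk> \<Longrightarrow> f (NX.pt n x) = g (NX.pt n x)"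
  shows "f t = g t"
  by (rule NX.tensor_ahom_eqI[OF assms(1-4)]) (use assms(5) in simp)

lemma nx_lift:
  assumes "abelian_group G" "biadd N X G g"
    "\<And>n b x i j k. \<lbrakk>n \<in> hcomp N i; b \<in> hcomp B j; x \<in> hcomp X k\<rbrakk>
      \<Longrightarrow> g (ract N n b) x = g n (b \<star> x)"
  shows "tensor_lift G (\<lambda>(n, x). g n x) \<in> ahom NX.T G"
    "\<lbrakk>n \<in> carrier N; x \<in> carrier X\<rbrakk> \<Longrightarrow> tensor_lift G (\<lambda>(n, x). g n x) (NX.pt n x) = g n x"
proof -
  have g: "biadd N OX G g" using assms(2) biadd_struct_cong[of N N OX X G G] by (simp add: same_add_def)
  have bal: "g (ract N n b) x = ksign G (j * k) (g n (ract OX x b))"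
    if "n \<in> hcomp N i" "b \<in> hcomp B j" "x \<in> hcomp OX k" for n b x i j k
    using assms(3)[of n i b j x k] that OX.left_hcomp[OF that(2,3)]
      ahom_ksign[OF OX.abelian assms(1) biadd_right[OF g N.hcomp_closed[OF that(1)]] OX.ract_closed[OF OX.hcomp_closed[OF that(3)] B.hcomp_closed[OF that(2)]]]
    by simp
  show "tensor_lift G (\<lambda>(n, x). g n x) \<in> ahom NX.T G"
    by (rule NX.tensor_lift[OF assms(1) g], erule (2) bal)
  show "\<lbrakk>n \<in> carrier N; x \<in> carrier X\<rbrakk> \<Longrightarrow> tensor_lift G (\<lambda>(n, x). g n x) (NX.pt n x) = g n x"
    by (rule NX.tensor_lift[OF assms(1) g], erule (2) bal) auto
qed

lemma BT_simps [simp]: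
  "carrier BT = carrier NX.T" "add BT = add NX.T" "zero BT = zero NX.T" "hcomp BT = hcomp NX.T" "diff BT = diff NX.T"
  "ract BT t b = tensor_lift NX.T (\<lambda>(n, x). NX.pt n (x \<bullet> b)) t"
  by (simp_all add: bitensor_def Let_def dgrp.defs)

declare BT_simps(6) [simp del]

lemma BT_twist [simp]: "twist BT k t = twist NX.T k t" "ksign BT k t = ksign NX.T k t"
  by (rule twist_struct_cong ksign_struct_cong; simp add: same_add_def)+

lemma BT_ract:
  assumes b: "b \<in> carrier B"
  shows "(\<lambda>t. ract BT t b) \<in> ahom NX.T NX.T"
    "\<lbrakk>n \<in> carrier N; x \<in> carrier X\<rbrakk> \<Longrightarrow> ract BT (NX.pt n x) b = NX.pt n (x \<bullet> b)"
proof -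
  have g: "biadd N X NX.T (\<lambda>n x. NX.pt n (x \<bullet> b))"
    by (rule biadd_comp[OF xpt_biadd ahom_id biadd_left[OF rx_biadd b]])
  \<comment> \<open>Well defined because the left and the right action on \<open>X\<close>
    commute.\<close>
  have bal: "NX.pt (ract N n s) (x \<bullet> b) = NX.pt n (s \<star> x \<bullet> b)"
    if h: "n \<in> hcomp N i" "s \<in> hcomp B j" "x \<in> hcomp X k" for n s x i j k
    using N.hcomp_closed[OF h(1)] B.hcomp_closed[OF h(2)] X.hcomp_closed[OF h(3)] b
    by (simp add: xpt_balanced rx_closed lx_rx)
  show "(\<lambda>t. ract BT t b) \<in> ahom NX.T NX.T"
    unfolding BT_simps by (rule nx_lift[OF NX.abelian g], erule (2) bal)
  show "\<lbrakk>n \<in> carrier N; x \<in> carrier X\<rbrakk> \<Longrightarrow> ract BT (NX.pt n x) b = NX.pt n (x \<bullet> b)"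
    unfolding BT_simps by (rule nx_lift[OF NX.abelian g], erule (2) bal)
qed

abbreviation "bleft \<equiv> bitensor_left A B \<phi> N X"

lemma bleft:
  assumes b: "b \<in> carrier B"
  shows "bleft b \<in> ahom NX.T NX.T"
    "\<lbrakk>n \<in> carrier N; x \<in> carrier X\<rbrakk> \<Longrightarrow> bleft b (NX.pt n x) = NX.pt (left_action B N b n) x"
proof -
  have g: "biadd N X NX.T (\<lambda>n x. NX.pt (left_action B N b n) x)"
    by (rule biadd_comp[OF xpt_biadd biadd_right[OF N.left_biadd b] ahom_id])
  \<comment> \<open>Well defined because the left and the right action on \<open>N\<close>
    commute.\<close>
  have bal: "NX.pt (left_action B N b (ract N n s)) x = NX.pt (left_action B N b n) (s \<star> x)"
    if h: "n \<in> hcomp N i" "s \<in> hcomp B j" "x \<in> hcomp X k" for n s x i j k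
    using N.hcomp_closed[OF h(1)] B.hcomp_closed[OF h(2)] X.hcomp_closed[OF h(3)] b
    by (simp add: N.left_ract N.left_closed xpt_balanced)
  have eq: "bleft b t = tensor_lift NX.T (\<lambda>(n, x). NX.pt (left_action B N b n) x) t" for t
    unfolding bitensor_left_def by (rule tensor_lift_struct_cong) (simp add: same_add_def)
  then have eq': "bleft b = tensor_lift NX.T (\<lambda>(n, x). NX.pt (left_action B N b n) x)" by blast
  show "bleft b \<in> ahom NX.T NX.T"
    unfolding eq' by (rule nx_lift[OF NX.abelian g], erule (2) bal)
  show "\<lbrakk>n \<in> carrier N; x \<in> carrier X\<rbrakk> \<Longrightarrow> bleft b (NX.pt n x) = NX.pt (left_action B N b n) x"
    unfolding eq' by (rule nx_lift[OF NX.abelian g], erule (2) bal)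
qed

lemma IXR_module: "dg_module A (restrict_scalars \<phi> IX)"
  by (rule dg_module_restrict[OF IX_module])

sublocale DC: hom_complex A BA "restrict_scalars \<phi> IX"
proof (intro hom_complex.intro hom_complex_axioms.intro)
  interpret BA: dg_module A BA by (rule dg_module_BA)
  interpret IXR: dg_module A "restrict_scalars \<phi> IX" by (rule IXR_module)
  show "dg_group BA" "dg_group (restrict_scalars \<phi> IX)" by unfold_locales
  show "(\<lambda>t. ract (restrict_scalars \<phi> IX) t a) \<in> ahom (restrict_scalars \<phi> IX) (restrict_scalars \<phi> IX)" if "a \<in> carrier A" for a
    by (rule biadd_left[OF IXR.ract_biadd that])
  show "ract BA m a \<in> carrier BA" if "m \<in> carrier BA" "a \<in> carrier A" for m a
    by (rule BB.M.ract_closed[OF that])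
qed

lemma dg_group_BTR: "dg_group (restrict_scalars \<phi> BT)"
  by (rule dg_group_cong[OF _ _ _ NX.dg_group_T]) (simp_all add: same_add_def)

sublocale CC: hom_complex A NR "restrict_scalars \<phi> BT"
proof (intro hom_complex.intro hom_complex_axioms.intro dg_group_BTR)
  interpret NR: dg_module A NR by (rule NR_module)
  show "dg_group NR" by unfold_locales
  have s: "ahom (restrict_scalars \<phi> BT) (restrict_scalars \<phi> BT) = ahom NX.T NX.T"
    by (rule ahom_struct_cong) (simp_all add: same_add_def)
  show "(\<lambda>t. ract (restrict_scalars \<phi> BT) t a) \<in> ahom (restrict_scalars \<phi> BT) (restrict_scalars \<phi> BT)" if "a \<in> carrier A" for a
    unfolding s using BT_ract(1)[OF \<phi>_closed[OF that]] by simp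
  show "ract NR m a \<in> carrier NR" if "m \<in> carrier NR" "a \<in> carrier A" for m a
    by (rule NA.M.ract_closed[OF that])
qed

lemma der_ambient_eq: "der_ambient A B \<phi> X = DC.C" and conn_ambient_eq: "conn_ambient A B \<phi> N X = CC.C"
  by (simp_all add: der_ambient_def conn_ambient_def)

end

section \<open>Derivations and connections\<close>

lemma RDirProd_simps [simp]:
  "carrier (RDirProd G H) = carrier G \<times> carrier H"
  "zero (RDirProd G H) = (\<zero>\<^bsub>G\<^esub>, \<zero>\<^bsub>H\<^esub>)"
  "(a, b) \<oplus>\<^bsub>RDirProd G H\<^esub> (c, d) = (a \<oplus>\<^bsub>G\<^esub> c, b \<oplus>\<^bsub>H\<^esub> d)"
  by (simp_all add: RDirProd_def DirProd_def monoid.defs)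

lemma RDirProd_abelian:
  assumes "abelian_group G" "abelian_group H"
  shows "abelian_group (RDirProd G H)"
proof -
  interpret G: abelian_group G by fact
  interpret H: abelian_group H by fact
  show ?thesis
  proof (rule abelian_groupI)
    fix x assume "x \<in> carrier (RDirProd G H)"
    then show "\<exists>y\<in>carrier (RDirProd G H). y \<oplus>\<^bsub>RDirProd G H\<^esub> x = \<zero>\<^bsub>RDirProd G H\<^esub>"
      by (intro bexI[of _ "(\<ominus>\<^bsub>G\<^esub> fst x, \<ominus>\<^bsub>H\<^esub> snd x)"]) (auto simp: G.l_neg H.l_neg)
  qed (auto simp: G.a_ac H.a_ac)
qed

lemma RDirProd_inv:
  assumes "abelian_group G" "abelian_group H" "x \<in> carrier G" "y \<in> carrier H"
  shows "\<ominus>\<^bsub>RDirProd G H\<^esub> (x, y) = (\<ominus>\<^bsub>G\<^esub> x, \<ominus>\<^bsub>H\<^esub> y)"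
proof -
  interpret G: abelian_group G by fact
  interpret H: abelian_group H by fact
  show ?thesis
    using assms by (intro abelian_group.minus_equality[OF RDirProd_abelian]) (auto simp: G.l_neg H.l_neg)
qed

lemma star_Der_simps [simp]:
  "carrier (star_Der A B \<phi> X) = carrier (direct_sum (der_ambient A B \<phi> X) (Der A B \<phi> X))"
  "add (star_Der A B \<phi> X) = add (der_ambient A B \<phi> X)" "zero (star_Der A B \<phi> X) = zero (der_ambient A B \<phi> X)"
  "hcomp (star_Der A B \<phi> X) = Der A B \<phi> X" "diff (star_Der A B \<phi> X) = diff (der_ambient A B \<phi> X)"
  "lact (star_Der A B \<phi> X) b D = (\<lambda>c\<in>carrier B. left_action B (outer A B \<phi> X) b (D c))"
  by (simp_all add: star_Der_def graded.defs)

lemma star_Conn_simps [simp]: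
  "carrier (star_Conn A B \<phi> N X) = carrier (direct_sum (RDirProd (der_ambient A B \<phi> X) (conn_ambient A B \<phi> N X))
     (\<lambda>n. {(D, \<psi>). is_connection A B \<phi> N X n D \<psi>}))"
  "add (star_Conn A B \<phi> N X) = add (RDirProd (der_ambient A B \<phi> X) (conn_ambient A B \<phi> N X))"
  "zero (star_Conn A B \<phi> N X) = zero (RDirProd (der_ambient A B \<phi> X) (conn_ambient A B \<phi> N X))"
  "hcomp (star_Conn A B \<phi> N X) = (\<lambda>n. {(D, \<psi>). is_connection A B \<phi> N X n D \<psi>})"
  "diff (star_Conn A B \<phi> N X) (D, \<psi>) = (diff (der_ambient A B \<phi> X) D, diff (conn_ambient A B \<phi> N X) \<psi>)"
  "lact (star_Conn A B \<phi> N X) b (D, \<psi>) = (lact (star_Der A B \<phi> X) b D, \<lambda>x\<in>carrier N. bitensor_left A B \<phi> N X b (\<psi> x))"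
  by (simp_all add: star_Conn_def graded.defs)

context dg_bimodule
begin

abbreviation "Am \<equiv> der_ambient A B \<phi> X"
abbreviation "Cm \<equiv> conn_ambient A B \<phi> N X"

lemma ahom_BX: "ahom BA (restrict_scalars \<phi> IX) = ahom B X"
  by (rule ahom_struct_cong) (simp_all add: same_add_def)

lemma ahom_NT: "ahom NR (restrict_scalars \<phi> BT) = ahom N NX.T"
  by (rule ahom_struct_cong) (simp_all add: same_add_def)

lemma Am_add: "D \<oplus>\<^bsub>Am\<^esub> D' = (\<lambda>c\<in>carrier B. D c \<oplus>\<^bsub>X\<^esub> D' c)"
  and Am_zero: "\<zero>\<^bsub>Am\<^esub> = (\<lambda>c\<in>carrier B. \<zero>\<^bsub>X\<^esub>)"
  and Cm_add: "\<psi> \<oplus>\<^bsub>Cm\<^esub> \<psi>' = (\<lambda>x\<in>carrier N. \<psi> x \<oplus>\<^bsub>NX.T\<^esub> \<psi>' x)"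
  and Cm_zero: "\<zero>\<^bsub>Cm\<^esub> = (\<lambda>x\<in>carrier N. \<zero>\<^bsub>NX.T\<^esub>)"
  by (simp_all add: der_ambient_eq conn_ambient_eq)

lemma Der_iff: "D \<in> Der A B \<phi> X n \<longleftrightarrow> D \<in> gr_hom A BA (restrict_scalars \<phi> IX) n \<and>
     (\<forall>i j. \<forall>b\<in>hcomp B i. \<forall>c\<in>hcomp B j. D (b \<otimes>\<^bsub>B\<^esub> c) = D b \<bullet> c \<oplus>\<^bsub>X\<^esub> ksign X (n * i) (b \<star> D c))"
  by (simp add: Der_def der_ambient_eq)

lemma Der_gr_hom: "D \<in> Der A B \<phi> X n \<Longrightarrow> D \<in> gr_hom A BA (restrict_scalars \<phi> IX) n"
  unfolding Der_iff by blast

lemma Der_ahom: "D \<in> Der A B \<phi> X n \<Longrightarrow> D \<in> ahom B X"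
  using DC.gr_homD(1)[OF Der_gr_hom] unfolding ahom_BX .

lemma Der_closed: "\<lbrakk>D \<in> Der A B \<phi> X n; b \<in> carrier B\<rbrakk> \<Longrightarrow> D b \<in> carrier X"
  using ahom_closed[OF Der_ahom] .

text \<open>The sign involves the degree of the first factor only, so the Leibniz rule extends
  additively to arbitrary second factors.\<close>

lemma Der_mult:
  assumes D: "D \<in> Der A B \<phi> X n" and c: "c \<in> hcomp B i" and b: "b \<in> carrier B"
  shows "D (c \<otimes>\<^bsub>B\<^esub> b) = D c \<bullet> b \<oplus>\<^bsub>X\<^esub> ksign X (n * i) (c \<star> D b)"
proof (rule B.graded_ahom_eqI[where f = "\<lambda>b. D (c \<otimes>\<^bsub>B\<^esub> b)" and G = X, OF _ _ b])
  note cc = B.hcomp_closed[OF c]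
  show "(\<lambda>b. D (c \<otimes>\<^bsub>B\<^esub> b)) \<in> ahom B X" by (rule ahom_comp[OF biadd_right[OF B.mult_biadd cc] Der_ahom[OF D]])
  show "(\<lambda>b. D c \<bullet> b \<oplus>\<^bsub>X\<^esub> ksign X (n * i) (c \<star> D b)) \<in> ahom B X"
    by (intro ahom_plus X.abelian ahom_ksign_fun biadd_right[OF rx_biadd Der_closed[OF D cc]]
        ahom_comp[OF Der_ahom[OF D] biadd_right[OF lx_biadd cc]])
qed (use D c in \<open>simp add: Der_iff\<close>)

lemma Der_subgroup: "subgroup (Der A B \<phi> X n) (add_monoid Am)"
proof (rule subgroup_add_monoidI)
  show "abelian_group Am" by (simp only: der_ambient_eq DC.C_abelian)
  show "Der A B \<phi> X n \<subseteq> carrier Am" using DC.C_hcomp_closed by (auto simp: der_ambient_eq Der_iff simp del: DC.C_simps)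
  note sg = subgroup_add_monoid[OF DC.C_hcomp_subgroup[of n], folded der_ambient_eq]
  show "\<zero>\<^bsub>Am\<^esub> \<in> Der A B \<phi> X n"
    using sg(2) by (auto simp: Der_iff Am_zero B.hcomp_closed X.ksign_zero
        ahom_zero[OF X.abelian X.abelian biadd_left[OF rx_biadd]] ahom_zero[OF X.abelian X.abelian biadd_right[OF lx_biadd]])
  fix D assume D: "D \<in> Der A B \<phi> X n"
  note Dc = Der_closed[OF D]
  {
    fix D' assume D': "D' \<in> Der A B \<phi> X n"
    note D'c = Der_closed[OF D']
    show "D \<oplus>\<^bsub>Am\<^esub> D' \<in> Der A B \<phi> X n"
      unfolding Der_iff
    proof (intro conjI allI ballI)
      show "D \<oplus>\<^bsub>Am\<^esub> D' \<in> gr_hom A BA (restrict_scalars \<phi> IX) n" using sg(3) D D' by (simp add: Der_iff)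
      fix i j b c assume "b \<in> hcomp B i" "c \<in> hcomp B j"
      moreover from this have "b \<in> carrier B" "c \<in> carrier B" by (simp_all add: B.hcomp_closed)
      ultimately show "(D \<oplus>\<^bsub>Am\<^esub> D') (b \<otimes>\<^bsub>B\<^esub> c) = (D \<oplus>\<^bsub>Am\<^esub> D') b \<bullet> c \<oplus>\<^bsub>X\<^esub> ksign X (n * i) (b \<star> (D \<oplus>\<^bsub>Am\<^esub> D') c)"
        by (simp add: Am_add Der_mult[OF D] Der_mult[OF D'] ahom_add[OF biadd_left[OF rx_biadd]] ahom_add[OF biadd_right[OF lx_biadd]]
            Dc D'c X.ksign_add lx_closed rx_closed X.ksign_closed X.a_ac)
    qed
  }
  have DA: "D \<in> carrier DC.C" by (rule DC.C_hcomp_closed[OF Der_gr_hom[OF D]])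
  show "\<ominus>\<^bsub>Am\<^esub> D \<in> Der A B \<phi> X n"
    unfolding Der_iff
  proof (intro conjI allI ballI)
    show "\<ominus>\<^bsub>Am\<^esub> D \<in> gr_hom A BA (restrict_scalars \<phi> IX) n" using sg(4) D by (simp add: Der_iff)
    have inv: "(\<ominus>\<^bsub>Am\<^esub> D) b = ksign X 1 (D b)" if "b \<in> carrier B" for b
    proof -
      have "\<ominus>\<^bsub>IX\<^esub> D b = \<ominus>\<^bsub>X\<^esub> D b" "\<ominus>\<^bsub>restrict_scalars \<phi> IX\<^esub> D b = \<ominus>\<^bsub>X\<^esub> D b"
        by (rule a_inv_cong; simp add: same_add_def)+
      then show ?thesis using DC.C_inv[OF DA] that by (simp add: ksign_def der_ambient_eq)
    qed
    fix i j b c assume "b \<in> hcomp B i" "c \<in> hcomp B j"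
    moreover from this have "b \<in> carrier B" "c \<in> carrier B" by (simp_all add: B.hcomp_closed)
    ultimately show "(\<ominus>\<^bsub>Am\<^esub> D) (b \<otimes>\<^bsub>B\<^esub> c) = (\<ominus>\<^bsub>Am\<^esub> D) b \<bullet> c \<oplus>\<^bsub>X\<^esub> ksign X (n * i) (b \<star> (\<ominus>\<^bsub>Am\<^esub> D) c)"
      using biadd_ksign(2)[OF B.abelian X.abelian X.abelian lx_biadd]
      by (simp add: inv Der_mult[OF D] rx_ksign Dc X.ksign_add lx_closed rx_closed X.ksign_closed X.ksign_ksign add.commute)
  qed
qed

sublocale DF: subgroup_family Am "Der A B \<phi> X"
  by (intro subgroup_family.intro subgroup_family_axioms.intro Der_subgroup) (simp only: der_ambient_eq DC.C_abelian)

section \<open>The group of connections\<close>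

lemma conn_iff: "is_connection A B \<phi> N X n D \<psi> \<longleftrightarrow> D \<in> Der A B \<phi> X n \<and> \<psi> \<in> gr_hom A NR (restrict_scalars \<phi> BT) n \<and>
     (\<forall>i. \<forall>x\<in>hcomp N i. \<forall>b\<in>carrier B.
        \<psi> (ract N x b) = ract BT (\<psi> x) b \<oplus>\<^bsub>NX.T\<^esub> ksign NX.T (n * i) (NX.pt x (D b)))"
  by (simp add: is_connection_def conn_ambient_eq)

lemma conn_ahom: "is_connection A B \<phi> N X n D \<psi> \<Longrightarrow> \<psi> \<in> ahom N NX.T"
  using CC.gr_homD(1)[of \<psi> n] unfolding conn_iff ahom_NT by blast

lemma conn_subgroup: "subgroup {(D, \<psi>). is_connection A B \<phi> N X n D \<psi>} (add_monoid (RDirProd Am Cm))"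
proof (rule subgroup_add_monoidI)
  note Cab = CC.C_abelian[folded conn_ambient_eq]
  note sgD = subgroup_add_monoid[OF Der_subgroup[of n]]
  note sg = subgroup_add_monoid[OF CC.C_hcomp_subgroup[of n], folded conn_ambient_eq]
  show "abelian_group (RDirProd Am Cm)" by (intro RDirProd_abelian DF.G.abelian_group_axioms Cab)
  show "{(D, \<psi>). is_connection A B \<phi> N X n D \<psi>} \<subseteq> carrier (RDirProd Am Cm)"
    using sgD(1) sg(1) by (auto simp: conn_iff)
  show "\<zero>\<^bsub>RDirProd Am Cm\<^esub> \<in> {(D, \<psi>). is_connection A B \<phi> N X n D \<psi>}"
    using sgD(2) sg(2) ahom_zero[OF NX.abelian NX.abelian BT_ract(1)] 
    by (auto simp: conn_iff) (auto simp: Cm_zero Am_zero N.hcomp_closed N.ract_closed ahom_zero[OF X.abelian NX.abelian biadd_right[OF xpt_biadd]] NXT.ksign_zero)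
  fix p assume "p \<in> {(D, \<psi>). is_connection A B \<phi> N X n D \<psi>}"
  then obtain D \<psi> where p: "p = (D, \<psi>)" and c: "is_connection A B \<phi> N X n D \<psi>" by blast
  then have D: "D \<in> Der A B \<phi> X n" and \<psi>: "\<psi> \<in> gr_hom A NR (restrict_scalars \<phi> BT) n" by (auto simp: conn_iff)
  note Dc = Der_closed[OF D] and \<psi>c = ahom_closed[OF conn_ahom[OF c]]
  note rc = ahom_closed[OF BT_ract(1)]
  {
    fix q assume "q \<in> {(D, \<psi>). is_connection A B \<phi> N X n D \<psi>}"
    then obtain D' \<psi>' where q: "q = (D', \<psi>')" and c': "is_connection A B \<phi> N X n D' \<psi>'" by blast
    then have D': "D' \<in> Der A B \<phi> X n" and \<psi>': "\<psi>' \<in> gr_hom A NR (restrict_scalars \<phi> BT) n" by (auto simp: conn_iff)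
    note D'c = Der_closed[OF D'] and \<psi>'c = ahom_closed[OF conn_ahom[OF c']]
    have "is_connection A B \<phi> N X n (D \<oplus>\<^bsub>Am\<^esub> D') (\<psi> \<oplus>\<^bsub>Cm\<^esub> \<psi>')"
      unfolding conn_iff
    proof (intro conjI allI ballI sgD(3) D D' sg(3) \<psi> \<psi>')
      fix i x b assume x: "x \<in> hcomp N i" and b: "b \<in> carrier B"
      have e: "\<psi> (ract N x b) = ract BT (\<psi> x) b \<oplus>\<^bsub>NX.T\<^esub> ksign NX.T (n * i) (NX.pt x (D b))"
        "\<psi>' (ract N x b) = ract BT (\<psi>' x) b \<oplus>\<^bsub>NX.T\<^esub> ksign NX.T (n * i) (NX.pt x (D' b))"
        using c c' x b by (auto simp: conn_iff)
      show "(\<psi> \<oplus>\<^bsub>Cm\<^esub> \<psi>') (ract N x b) = ract BT ((\<psi> \<oplus>\<^bsub>Cm\<^esub> \<psi>') x) b \<oplus>\<^bsub>NX.T\<^esub> ksign NX.T (n * i) (NX.pt x ((D \<oplus>\<^bsub>Am\<^esub> D') b))"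
        using b N.hcomp_closed[OF x]
        by (simp add: Cm_add Am_add e N.ract_closed ahom_add[OF BT_ract(1)] ahom_add[OF biadd_right[OF xpt_biadd]] \<psi>c \<psi>'c Dc D'c rc
           NXT.ksign_add xpt_closed NXT.ksign_closed NXT.a_ac)
    qed
    then show "p \<oplus>\<^bsub>RDirProd Am Cm\<^esub> q \<in> {(D, \<psi>). is_connection A B \<phi> N X n D \<psi>}" by (simp add: p q)
  }
  have DA: "D \<in> carrier DC.C" and \<psi>A: "\<psi> \<in> carrier CC.C"
    by (rule DC.C_hcomp_closed[OF Der_gr_hom[OF D]], rule CC.C_hcomp_closed[OF \<psi>])
  have "is_connection A B \<phi> N X n (\<ominus>\<^bsub>Am\<^esub> D) (\<ominus>\<^bsub>Cm\<^esub> \<psi>)"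
    unfolding conn_iff
  proof (intro conjI allI ballI sgD(4) D sg(4) \<psi>)
    have inv: "(\<ominus>\<^bsub>Am\<^esub> D) b = ksign X 1 (D b)" if "b \<in> carrier B" for b
    proof -
      have "\<ominus>\<^bsub>IX\<^esub> D b = \<ominus>\<^bsub>X\<^esub> D b" "\<ominus>\<^bsub>restrict_scalars \<phi> IX\<^esub> D b = \<ominus>\<^bsub>X\<^esub> D b"
        by (rule a_inv_cong; simp add: same_add_def)+
      then show ?thesis using DC.C_inv[OF DA] that by (simp add: ksign_def der_ambient_eq)
    qed
    have inv': "(\<ominus>\<^bsub>Cm\<^esub> \<psi>) x = ksign NX.T 1 (\<psi> x)" if "x \<in> carrier N" for x
    proof -
      have "\<ominus>\<^bsub>restrict_scalars \<phi> BT\<^esub> \<psi> x = \<ominus>\<^bsub>NX.T\<^esub> \<psi> x"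
        by (rule a_inv_cong; simp add: same_add_def)+
      then show ?thesis using CC.C_inv[OF \<psi>A] that by (simp add: ksign_def conn_ambient_eq)
    qed
    fix i x b assume x: "x \<in> hcomp N i" and b: "b \<in> carrier B"
    have e: "\<psi> (ract N x b) = ract BT (\<psi> x) b \<oplus>\<^bsub>NX.T\<^esub> ksign NX.T (n * i) (NX.pt x (D b))"
      using c x b by (auto simp: conn_iff)
    show "(\<ominus>\<^bsub>Cm\<^esub> \<psi>) (ract N x b) = ract BT ((\<ominus>\<^bsub>Cm\<^esub> \<psi>) x) b \<oplus>\<^bsub>NX.T\<^esub> ksign NX.T (n * i) (NX.pt x ((\<ominus>\<^bsub>Am\<^esub> D) b))"
      using b N.hcomp_closed[OF x] ahom_ksign[OF NX.abelian NX.abelian BT_ract(1)]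
      by (simp add: inv inv' e N.ract_closed xpt_ksign \<psi>c Dc rc NXT.ksign_add xpt_closed NXT.ksign_closed NXT.ksign_ksign add.commute)
  qed
  moreover have "\<ominus>\<^bsub>RDirProd Am Cm\<^esub> p = (\<ominus>\<^bsub>Am\<^esub> D, \<ominus>\<^bsub>Cm\<^esub> \<psi>)"
    using DA \<psi>A unfolding p
    by (intro RDirProd_inv DF.G.abelian_group_axioms Cab) (simp_all add: der_ambient_eq conn_ambient_eq)
  ultimately show "\<ominus>\<^bsub>RDirProd Am Cm\<^esub> p \<in> {(D, \<psi>). is_connection A B \<phi> N X n D \<psi>}" by simp
qed

sublocale CF: subgroup_family "RDirProd Am Cm" "\<lambda>n. {(D, \<psi>). is_connection A B \<phi> N X n D \<psi>}"
  by (intro subgroup_family.intro subgroup_family_axioms.intro conn_subgroup RDirProd_abelian DF.G.abelian_group_axioms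
      CC.C_abelian[folded conn_ambient_eq])

section \<open>Derivations acting through a section of the counit\<close>

text \<open>What makes \<open>n \<otimes> c \<mapsto> n \<otimes> D c\<close> well defined over
  \<open>A\<close>. Unlike the Leibniz rule of a fixed degree, it holds for all elements of the
  ambient complex, in particular for inhomogeneous sums of derivations and for their
  differentials.\<close>

definition A_linear :: "('b \<Rightarrow> 'x) \<Rightarrow> bool" where
  "A_linear D \<longleftrightarrow> D \<in> ahom B X \<and> (\<forall>c\<in>carrier B. \<forall>a\<in>carrier A. D (c \<otimes>\<^bsub>B\<^esub> \<phi> a) = D c \<bullet> \<phi> a)"

lemma A_linear_ambient: "D \<in> carrier DC.C \<Longrightarrow> A_linear D"
  using DC.C_ahom[of D, unfolded ahom_BX] DC.C_linear[of D] by (auto simp: A_linear_def simp del: DC.C_simps)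

lemma A_linear_Der: "D \<in> Der A B \<phi> X n \<Longrightarrow> A_linear D"
  by (rule A_linear_ambient[OF DC.C_hcomp_closed[OF Der_gr_hom]])

text \<open>Balancing applied to \<open>1 \<otimes> 1\<close>: scalars from \<open>A\<close> act on
  \<open>X\<close> in the same way through either factor.\<close>

lemma e1_\<phi>: "a \<in> hcomp A j \<Longrightarrow> e1 (\<phi> a) = e2 (\<phi> a)"
  using ept_balanced[of "\<one>\<^bsub>B\<^esub>" a j "\<one>\<^bsub>B\<^esub>" 0] B.one_hcomp \<phi>_hcomp[of a j] by (simp add: B.hcomp_closed ksign_even)

text \<open>On homogeneous \<open>D\<close> and \<open>n\<close> this is \<open>(-1)\<^sup>|\<^sup>D\<^sup>|\<^sup>|\<^sup>n\<^sup>| n \<otimes> D c\<close>; conjugating by \<open>twist\<close> makes the formula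
  meaningful for inhomogeneous \<open>D\<close>.\<close>

definition der_pt :: "('b \<Rightarrow> 'x) \<Rightarrow> 'n \<Rightarrow> 'b \<Rightarrow> ('n, 'x) tensor" where
  "der_pt D n c = (\<Oplus>\<^bsub>NX.T\<^esub>i\<in>hsupp N n. NX.pt (hpart N i n) (twist X i (D (twist B i c))))"

definition der_map :: "('b \<Rightarrow> 'x) \<Rightarrow> ('n, 'b) tensor \<Rightarrow> ('n, 'x) tensor" where
  "der_map D = tensor_lift NX.T (\<lambda>(n, c). der_pt D n c)"

lemma conj_ahom: "D \<in> ahom B X \<Longrightarrow> (\<lambda>c. twist X i (D (twist B i c))) \<in> ahom B X"
  by (intro ahom_comp[OF B.twist_ahom] ahom_comp[OF _ X.twist_ahom])

lemma der_pt:
  assumes D: "D \<in> ahom B X"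
  shows "biadd N B NX.T (der_pt D)"
    "\<lbrakk>n \<in> hcomp N i; c \<in> carrier B\<rbrakk> \<Longrightarrow> der_pt D n c = NX.pt n (twist X i (D (twist B i c)))"
proof -
  have b: "biadd N B NX.T (\<lambda>n c. NX.pt n (twist X i (D (twist B i c))))" for i
    by (rule biadd_comp[OF xpt_biadd ahom_id conj_ahom[OF D]])
  show "biadd N B NX.T (der_pt D)"
    unfolding der_pt_def[abs_def]
    by (rule biadd_hsum_left[where F = "\<lambda>i n c. NX.pt n (twist X i (D (twist B i c)))", OF N.graded_group_axioms NX.abelian b B.abelian])
  show "\<lbrakk>n \<in> hcomp N i; c \<in> carrier B\<rbrakk> \<Longrightarrow> der_pt D n c = NX.pt n (twist X i (D (twist B i c)))"
    unfolding der_pt_def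
    by (rule biadd_hsum_left_hcomp[where F = "\<lambda>i n c. NX.pt n (twist X i (D (twist B i c)))", OF N.graded_group_axioms NX.abelian b])
qed

text \<open>Balancing over \<open>A\<close> holds since \<open>\<phi> s\<close> can be pulled out of
  \<open>D\<close> on the right, and since it acts on \<open>X\<close> equally through both factors
  of the enveloping algebra; what remains is a count of signs.\<close>

lemma der_map:
  assumes D: "A_linear D"
  shows "der_map D \<in> ahom NA.T NX.T"
    "\<lbrakk>n \<in> hcomp N i; c \<in> carrier B\<rbrakk> \<Longrightarrow> der_map D (NA.pt n c) = NX.pt n (twist X i (D (twist B i c)))"
proof -
  have Dh: "D \<in> ahom B X" using D by (simp add: A_linear_def)
  note Dc = ahom_closed[OF Dh]
  have bal: "der_pt D (ract N n (\<phi> s)) c = ksign NX.T (j * k) (der_pt D n (c \<otimes>\<^bsub>B\<^esub> \<phi> s))"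
    if h: "n \<in> hcomp N i" "s \<in> hcomp A j" "c \<in> hcomp B k" for n s c i j k
  proof -
    note hc = N.hcomp_closed[OF h(1)] B.hcomp_closed[OF h(3)] \<phi>_hcomp[OF h(2), THEN B.hcomp_closed] A.hcomp_closed[OF h(2)]
    let ?y = "twist X i (D c)"
    have y: "?y \<in> carrier X" "?y \<bullet> \<phi> s \<in> carrier X" using hc by (simp_all add: Dc X.twist_closed rx_closed)
    have Dks: "D (ksign B l b) = ksign X l (D b)" if "b \<in> carrier B" for l b
      by (rule ahom_ksign[OF B.abelian X.abelian Dh that])
    have tks: "twist X l (ksign X m x) = ksign X m (twist X l x)" if "x \<in> carrier X" for l m x
      by (rule ahom_ksign[OF X.abelian X.abelian X.twist_ahom that])
    have "der_pt D (ract N n (\<phi> s)) c = NX.pt (ract N n (\<phi> s)) (twist X (i + j) (D (twist B (i + j) c)))"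
      by (rule der_pt(2)[OF Dh N.ract_hcomp[OF h(1) \<phi>_hcomp[OF h(2)]] hc(2)])
    also have "\<dots> = ksign NX.T ((i + j) * k) (NX.pt n (\<phi> s \<star> twist X (i + j) (D c)))"
      using hc by (simp add: B.twist_hcomp[OF h(3)] Dks tks Dc X.twist_closed xpt_ksign xpt_balanced N.ract_closed)
    also have "\<phi> s \<star> twist X (i + j) (D c) = twist X j (twist X (i + j) (D c)) \<bullet> \<phi> s"
      using OX.left_hcomp_left[OF \<phi>_hcomp[OF h(2)], of "twist X (i + j) (D c)"] hc
      by (simp add: X.twist_closed Dc e1_\<phi>[OF h(2)])
    \<comment> \<open>The exponent \<open>j + (i + j)\<close> has the parity of \<open>i\<close>,
      and \<open>twist\<close> depends on parity only.\<close>
    also have "twist X j (twist X (i + j) (D c)) = ?y"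
      using hc by (simp add: X.twist_add Dc) (auto intro!: twist_cong)
    finally have l: "der_pt D (ract N n (\<phi> s)) c = ksign NX.T ((i + j) * k) (NX.pt n (?y \<bullet> \<phi> s))" .
    have "D (twist B i (c \<otimes>\<^bsub>B\<^esub> \<phi> s)) = ksign X (i * (k + j)) (D c \<bullet> \<phi> s)"
      using hc D B.twist_hcomp[OF B.mult_hcomp[OF h(3) \<phi>_hcomp[OF h(2)]], of i] by (simp add: Dks A_linear_def)
    moreover have "twist X i (D c \<bullet> \<phi> s) = ksign X (i * j) (?y \<bullet> \<phi> s)"
      using IX.ract_twist[of "D c" "\<phi> s" i] hc by (simp add: Dc B.twist_hcomp[OF \<phi>_hcomp[OF h(2)]] rx_ksign X.twist_closed)
    ultimately have "der_pt D n (c \<otimes>\<^bsub>B\<^esub> \<phi> s) = ksign NX.T (i * (k + j) + i * j) (NX.pt n (?y \<bullet> \<phi> s))"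
      using hc y by (simp add: der_pt(2)[OF Dh h(1)] tks rx_closed Dc xpt_ksign X.ksign_ksign X.ksign_closed)
    with l show ?thesis
      using y hc by (simp add: NXT.ksign_ksign xpt_closed) (auto intro!: ksign_cong)
  qed
  show "der_map D \<in> ahom NA.T NX.T"
    unfolding der_map_def by (rule na_lift[OF NX.abelian der_pt(1)[OF Dh]], erule (2) bal)
  have "\<lbrakk>n \<in> carrier N; c \<in> carrier B\<rbrakk> \<Longrightarrow> der_map D (NA.pt n c) = der_pt D n c"
    unfolding der_map_def by (rule na_lift[OF NX.abelian der_pt(1)[OF Dh]], erule (2) bal)
  then show "\<lbrakk>n \<in> hcomp N i; c \<in> carrier B\<rbrakk> \<Longrightarrow> der_map D (NA.pt n c) = NX.pt n (twist X i (D (twist B i c)))"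
    using der_pt(2)[OF Dh] N.hcomp_closed by simp
qed

lemma der_map_add:
  assumes "A_linear D" "A_linear D'" "A_linear E" "\<And>c. c \<in> carrier B \<Longrightarrow> E c = D c \<oplus>\<^bsub>X\<^esub> D' c" "t \<in> carrier NA.T"
  shows "der_map E t = der_map D t \<oplus>\<^bsub>NX.T\<^esub> der_map D' t"
proof (rule na_ahom_eqI[OF NX.abelian der_map(1)[OF assms(3)] ahom_plus[OF NX.abelian der_map(1)[OF assms(1)] der_map(1)[OF assms(2)]] assms(5)])
  have Dc: "D c \<in> carrier X" "D' c \<in> carrier X" if "c \<in> carrier B" for c
    using assms(1,2) that ahom_closed by (force simp: A_linear_def)+
  fix i j n c assume h: "n \<in> hcomp N i" "c \<in> hcomp B j"
  then show "der_map E (NA.pt n c) = der_map D (NA.pt n c) \<oplus>\<^bsub>NX.T\<^esub> der_map D' (NA.pt n c)"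
    using N.hcomp_closed[OF h(1)] B.hcomp_closed[OF h(2)]
    by (simp add: der_map(2)[OF assms(1) h(1)] der_map(2)[OF assms(2) h(1)] der_map(2)[OF assms(3) h(1)] assms(4) B.twist_closed
        ahom_add[OF X.twist_ahom] Dc ahom_add[OF biadd_right[OF xpt_biadd]] X.twist_closed)
qed

text \<open>Conjugation by \<open>twist\<close> replaces \<open>b\<close> by its own twist in the
  degree of \<open>n\<close>. Moved across the tensor sign this is the Koszul sign of the left
  action on \<open>n\<close>, so \<open>b D\<close> is sent to \<open>b\<close> times the map of
  \<open>D\<close>.\<close>

lemma der_map_lact:
  assumes D: "A_linear D" and b: "b \<in> carrier B" and E: "\<And>c. c \<in> carrier B \<Longrightarrow> E c = b \<star> D c"
  shows "A_linear E" "t \<in> carrier NA.T \<Longrightarrow> der_map E t = bleft b (der_map D t)"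
proof -
  have Dh: "D \<in> ahom B X" using D by (simp add: A_linear_def)
  note Dc = ahom_closed[OF Dh]
  have "E \<in> ahom B X"
    by (rule ahom_cong[OF B.abelian ahom_comp[OF Dh biadd_right[OF lx_biadd b]] E[symmetric]])
  then show El: "A_linear E"
    using D E b by (simp add: A_linear_def \<phi>_closed lx_rx Dc)
  show "der_map E t = bleft b (der_map D t)" if t: "t \<in> carrier NA.T"
  proof (rule na_ahom_eqI[OF NX.abelian der_map(1)[OF El] ahom_comp[OF der_map(1)[OF D] bleft(1)[OF b]] t])
    fix i j n c assume h: "n \<in> hcomp N i" "c \<in> hcomp B j"
    note hc = N.hcomp_closed[OF h(1)] B.hcomp_closed[OF h(2)]
    have "der_map E (NA.pt n c) = NX.pt n (twist B i b \<star> twist X i (D (twist B i c)))"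
      using hc b OX.left_twist[of "D (twist B i c)" b i]
      by (simp add: der_map(2)[OF El h(1)] E B.twist_closed Dc)
    also have "\<dots> = NX.pt (left_action B N b n) (twist X i (D (twist B i c)))"
      using hc b by (simp add: N.left_hcomp_right[OF h(1)] xpt_balanced B.twist_closed X.twist_closed Dc)
    finally show "der_map E (NA.pt n c) = bleft b (der_map D (NA.pt n c))"
      using hc b by (simp add: der_map(2)[OF D h(1)] bleft X.twist_closed B.twist_closed Dc)
  qed
qed

lemma \<phi>_twist: "a \<in> carrier A \<Longrightarrow> twist B k (\<phi> a) = \<phi> (twist A k a)"
  using A.twist_commute[OF B.graded_group_axioms dg_ring_hom_ahom[OF \<phi>_dg], where n = 0] \<phi>_hcomp
  by (simp add: ksign_even)

lemma B_module: "dg_alg_module R B (regular B)"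
  by (intro dg_alg_module.intro B.dg_algebra_axioms B.dg_module_regular)

lemma B_Leibniz_twist:
  "\<lbrakk>b \<in> carrier B; c \<in> carrier B\<rbrakk> \<Longrightarrow> diff B (b \<otimes>\<^bsub>B\<^esub> c) = diff B b \<otimes>\<^bsub>B\<^esub> c \<oplus>\<^bsub>B\<^esub> twist B 1 b \<otimes>\<^bsub>B\<^esub> diff B c"
  using dg_alg_module.Leibniz_twist[OF B_module, of b c] by simp

lemma B_mult_twist:
  "\<lbrakk>b \<in> carrier B; c \<in> carrier B\<rbrakk> \<Longrightarrow> twist B k (b \<otimes>\<^bsub>B\<^esub> c) = twist B k b \<otimes>\<^bsub>B\<^esub> twist B k c"
  using dg_alg_module.ract_twist[OF B_module, of b c k] by simp

lemma rx_twist: "\<lbrakk>x \<in> carrier X; b \<in> carrier B\<rbrakk> \<Longrightarrow> twist X k (x \<bullet> b) = twist X k x \<bullet> twist B k b"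
  using IX.ract_twist[of x b k] by simp

lemma rx_Leibniz: "\<lbrakk>x \<in> carrier X; b \<in> carrier B\<rbrakk> \<Longrightarrow> diff X (x \<bullet> b) = diff X x \<bullet> b \<oplus>\<^bsub>X\<^esub> twist X 1 x \<bullet> diff B b"
  using IX.Leibniz_twist[of x b] by simp

text \<open>The premise on \<open>E\<close> is the differential of \<open>D\<close> in the Hom
  complex, in the form valid for inhomogeneous maps, and the conclusion is the same formula for
  \<open>der_map D\<close>; thus \<open>D \<mapsto> der_map D\<close> is a chain map.\<close>

lemma der_map_diff:
  assumes D: "A_linear D"
    and E: "\<And>c. c \<in> carrier B \<Longrightarrow> E c = diff X (D c) \<ominus>\<^bsub>X\<^esub> twist X 1 (D (twist B 1 (diff B c)))"
  shows "A_linear E"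
    "t \<in> carrier NA.T \<Longrightarrow> der_map E t = diff NX.T (der_map D t) \<ominus>\<^bsub>NX.T\<^esub> twist NX.T 1 (der_map D (twist NA.T 1 (diff NA.T t)))"
proof -
  have Dh: "D \<in> ahom B X" and Dl: "\<And>c a. \<lbrakk>c \<in> carrier B; a \<in> carrier A\<rbrakk> \<Longrightarrow> D (c \<otimes>\<^bsub>B\<^esub> \<phi> a) = D c \<bullet> \<phi> a"
    using D by (auto simp: A_linear_def)
  note Dc = ahom_closed[OF Dh]
  have "(\<lambda>c. diff X (D c) \<ominus>\<^bsub>X\<^esub> twist X 1 (D (twist B 1 (diff B c)))) \<in> ahom B X"
    by (intro ahom_diff X.abelian ahom_comp[OF Dh X.diff_hom]
        ahom_comp[OF ahom_comp[OF ahom_comp[OF B.diff_hom B.twist_ahom] Dh] X.twist_ahom])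
  then have Eh: "E \<in> ahom B X" by (rule ahom_cong[OF B.abelian _ E[symmetric]])
  have "E (c \<otimes>\<^bsub>B\<^esub> \<phi> a) = E c \<bullet> \<phi> a" if c: "c \<in> carrier B" and a: "a \<in> carrier A" for c a
  proof -
    let ?y = "\<phi> a"
    have y: "?y \<in> carrier B" using \<phi>_closed[OF a] .
    have dy: "diff B ?y = \<phi> (diff A a)" using \<phi>_dg a by (simp add: dg_ring_hom_def)
    have "diff X (D (c \<otimes>\<^bsub>B\<^esub> ?y)) = diff X (D c) \<bullet> ?y \<oplus>\<^bsub>X\<^esub> twist X 1 (D c) \<bullet> diff B ?y"
      using c a y by (simp add: Dl rx_Leibniz Dc)
    moreover have "twist B 1 (diff B (c \<otimes>\<^bsub>B\<^esub> ?y)) = twist B 1 (diff B c) \<otimes>\<^bsub>B\<^esub> \<phi> (twist A 1 a) \<oplus>\<^bsub>B\<^esub> c \<otimes>\<^bsub>B\<^esub> \<phi> (twist A 1 (diff A a))"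
      using c y a by (simp add: B_Leibniz_twist ahom_add[OF B.twist_ahom] B_mult_twist B.twist_twist B.twist_closed B.diff_closed
          \<phi>_twist dy A.diff_closed \<phi>_closed)
    then have "D (twist B 1 (diff B (c \<otimes>\<^bsub>B\<^esub> ?y))) = D (twist B 1 (diff B c)) \<bullet> twist B 1 ?y \<oplus>\<^bsub>X\<^esub> D c \<bullet> twist B 1 (diff B ?y)"
      using c y a by (simp add: ahom_add[OF Dh] Dl B.twist_closed B.diff_closed A.twist_closed A.diff_closed \<phi>_closed \<phi>_twist dy)
    then have "twist X 1 (D (twist B 1 (diff B (c \<otimes>\<^bsub>B\<^esub> ?y)))) = twist X 1 (D (twist B 1 (diff B c))) \<bullet> ?y \<oplus>\<^bsub>X\<^esub> twist X 1 (D c) \<bullet> diff B ?y"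
      using c y by (simp add: B.twist_closed B.diff_closed ahom_add[OF X.twist_ahom] rx_closed Dc rx_twist B.twist_twist)
    ultimately have "E (c \<otimes>\<^bsub>B\<^esub> ?y) = diff X (D c) \<bullet> ?y \<ominus>\<^bsub>X\<^esub> twist X 1 (D (twist B 1 (diff B c))) \<bullet> ?y"
      using c y by (simp add: E X.add_diff_cancel rx_closed Dc X.diff_closed X.twist_closed B.twist_closed B.diff_closed)
    also have "\<dots> = E c \<bullet> ?y"
      using c y ahom_a_minus[OF X.abelian X.abelian biadd_left[OF rx_biadd y]]
      by (simp add: E Dc X.diff_closed X.twist_closed B.twist_closed B.diff_closed)
    finally show ?thesis .
  qed
  with Eh show El: "A_linear E" by (simp add: A_linear_def)
  show "der_map E t = diff NX.T (der_map D t) \<ominus>\<^bsub>NX.T\<^esub> twist NX.T 1 (der_map D (twist NA.T 1 (diff NA.T t)))" if t: "t \<in> carrier NA.T"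
  proof (rule na_ahom_eqI[OF NX.abelian der_map(1)[OF El] _ t])
    note H = der_map(1)[OF D]
    show "(\<lambda>t. diff NX.T (der_map D t) \<ominus>\<^bsub>NX.T\<^esub> twist NX.T 1 (der_map D (twist NA.T 1 (diff NA.T t)))) \<in> ahom NA.T NX.T"
      by (intro ahom_diff NX.abelian ahom_comp[OF H NXT.diff_hom]
        ahom_comp[OF ahom_comp[OF ahom_comp[OF NAT.diff_hom NAT.twist_ahom] H] NXT.twist_ahom])
    fix i k n c assume h: "n \<in> hcomp N i" "c \<in> hcomp B k"
    note hc = N.hcomp_closed[OF h(1)] B.hcomp_closed[OF h(2)]
    note d = N.diff_hcomp[OF h(1)] B.diff_hcomp[OF h(2)]
    note dc = N.hcomp_closed[OF d(1)] B.hcomp_closed[OF d(2)]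
    have Dks: "D (ksign B l b) = ksign X l (D b)" if "b \<in> carrier B" for l b
      by (rule ahom_ksign[OF B.abelian X.abelian Dh that])
    have Eks: "E (ksign B l b) = ksign X l (E b)" if "b \<in> carrier B" for l b
      by (rule ahom_ksign[OF B.abelian X.abelian Eh that])
    have tks: "twist X l (ksign X m x) = ksign X m (twist X l x)" if "x \<in> carrier X" for l m x
      by (rule ahom_ksign[OF X.abelian X.abelian X.twist_ahom that])
    let ?u = "D c" and ?v = "D (diff B c)"
    have uv: "?u \<in> carrier X" "?v \<in> carrier X" using hc dc by (simp_all add: Dc)
    \<comment> \<open>\<open>?P\<close> differentiates the value \<open>D c\<close>,
      \<open>?Q\<close> differentiates \<open>n\<close> and \<open>?W\<close> differentiates
      \<open>c\<close>. The \<open>?Q\<close> terms of the two parts of the right-hand side cancel,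
      and \<open>?P\<close> and \<open>?W\<close> are the two parts of \<open>E\<close>.\<close>
    let ?P = "NX.pt n (diff X (twist X i ?u))" and ?Q = "NX.pt (diff N n) (twist X i ?u)" and ?W = "NX.pt n (twist X (i + 1) ?v)"
    have PQW: "?P \<in> carrier NX.T" "?Q \<in> carrier NX.T" "?W \<in> carrier NX.T"
      using hc dc uv by (auto intro!: xpt_closed X.diff_closed X.twist_closed)
    have Ec: "twist X i (E c) = ksign X i (diff X (twist X i ?u)) \<ominus>\<^bsub>X\<^esub> ksign X (k - 1) (twist X (i + 1) ?v)"
      using hc dc uv
      by (simp add: E B.twist_hcomp[OF d(2)] Dks tks ahom_a_minus[OF X.abelian X.abelian X.twist_ahom] X.diff_closed X.twist_closed
          X.ksign_closed X.diff_twist X.twist_add)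
    have L: "der_map E (NA.pt n c) = ksign NX.T (i * k + i) ?P \<ominus>\<^bsub>NX.T\<^esub> ksign NX.T (i * k + (k - 1)) ?W"
      using hc dc uv PQW ahom_closed[OF Eh]
      by (simp add: der_map(2)[OF El h(1)] B.twist_hcomp[OF h(2)] Eks tks xpt_ksign X.twist_closed Ec
          ahom_a_minus[OF X.abelian NX.abelian biadd_right[OF xpt_biadd hc(1)]] X.diff_closed X.ksign_closed
          ahom_a_minus[OF NX.abelian NX.abelian NXT.ksign_ahom] NXT.ksign_closed NXT.ksign_ksign)
    have hD: "der_map D (NA.pt n c) = ksign NX.T (i * k) (NX.pt n (twist X i ?u))"
      "der_map D (NA.pt n (diff B c)) = ksign NX.T (i * (k - 1)) (NX.pt n (twist X i ?v))"
      "der_map D (NA.pt (diff N n) c) = ksign NX.T ((i - 1) * k) (NX.pt (diff N n) (twist X (i - 1) ?u))"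
      using hc dc uv
      by (simp_all add: der_map(2)[OF D h(1)] der_map(2)[OF D d(1)] B.twist_hcomp[OF h(2)] B.twist_hcomp[OF d(2)] Dks tks xpt_ksign X.twist_closed)
    have r1: "diff NX.T (der_map D (NA.pt n c)) = ksign NX.T (i * k) ?Q \<oplus>\<^bsub>NX.T\<^esub> ksign NX.T (i * k + i) ?P"
      using hc dc uv PQW NX.diff_pt[OF h(1), of "twist X i ?u"]
      by (simp add: hD NXT.diff_ksign xpt_closed X.twist_closed NXT.ksign_add NXT.ksign_closed NXT.ksign_ksign)
    have "twist NA.T 1 (diff NA.T (NA.pt n c)) = ksign NA.T (i + k - 1) (NA.pt (diff N n) c) \<oplus>\<^bsub>NA.T\<^esub> ksign NA.T (i + k - 1 + i) (NA.pt n (diff B c))"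
      using hc dc NA.diff_pt[of n i c] h NA.pt_mem[of "diff N n" "i - 1" c k] NA.pt_mem[of n i "diff B c" "k - 1"] d
      by (simp add: ahom_add[OF NAT.twist_ahom] npt_closed NAT.ksign_closed ahom_ksign[OF NA.abelian NA.abelian NAT.twist_ahom]
          NAT.twist_hcomp[of _ "i - 1 + k"] NAT.twist_hcomp[of _ "i + (k - 1)"] NAT.ksign_ksign algebra_simps)
    then have "der_map D (twist NA.T 1 (diff NA.T (NA.pt n c))) = ksign NX.T (i + k - 1) (ksign NX.T ((i - 1) * k) (NX.pt (diff N n) (twist X (i - 1) ?u)))
      \<oplus>\<^bsub>NX.T\<^esub> ksign NX.T (i + k - 1 + i) (ksign NX.T (i * (k - 1)) (NX.pt n (twist X i ?v)))"
      using hc dc by (simp add: ahom_add[OF H] npt_closed NAT.ksign_closed ahom_ksign[OF NA.abelian NX.abelian H] hD)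
    moreover have tq: "twist X (1 + (i - 1)) ?u = twist X i ?u" "twist X (1 + i) ?v = twist X (i + 1) ?v"
      by (simp_all add: add.commute)
    ultimately have "twist NX.T 1 (der_map D (twist NA.T 1 (diff NA.T (NA.pt n c)))) =
        ksign NX.T (i + k - 1 + (i - 1) * k + (i - 1)) ?Q \<oplus>\<^bsub>NX.T\<^esub> ksign NX.T (i + k - 1 + i + i * (k - 1) + i) ?W"
      using hc dc uv PQW
      by (simp add: NXT.ksign_ksign xpt_closed X.twist_closed ahom_add[OF NXT.twist_ahom] NXT.ksign_closed
          ahom_ksign[OF NX.abelian NX.abelian NXT.twist_ahom] NX.twist_pt N.twist_hcomp[OF h(1)] N.twist_hcomp[OF d(1)] xpt_ksign
          X.twist_add tq)
    also have "\<dots> = ksign NX.T (i * k) ?Q \<oplus>\<^bsub>NX.T\<^esub> ksign NX.T (i * k + (k - 1)) ?W"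
      by (intro arg_cong2[where f = "add NX.T"] ksign_cong) auto
    finally show "der_map E (NA.pt n c) = diff NX.T (der_map D (NA.pt n c)) \<ominus>\<^bsub>NX.T\<^esub> twist NX.T 1 (der_map D (twist NA.T 1 (diff NA.T (NA.pt n c))))"
      unfolding L r1 using PQW by (simp add: NXT.add_diff_cancel NXT.ksign_closed)
  qed
qed

lemma Der_mem: "\<lbrakk>D \<in> Der A B \<phi> X d; b \<in> hcomp B i\<rbrakk> \<Longrightarrow> D b \<in> hcomp X (i + d)"
  using DC.gr_homD(3)[OF Der_gr_hom, of D d b i] by simp

text \<open>For a map of degree \<open>d\<close> the conjugation by \<open>twist\<close> reduces to
  a global sign.\<close>

lemma der_map_Der:
  assumes D: "D \<in> Der A B \<phi> X d" and n: "n \<in> hcomp N i" and c: "c \<in> carrier B"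
  shows "der_map D (NA.pt n c) = ksign NX.T (d * i) (NX.pt n (D c))"
proof -
  have "twist X i (D (twist B i c)) = ksign X (i * d) (D c)"
    using B.twist_commute[OF X.graded_group_axioms Der_ahom[OF D] Der_mem[OF D] B.twist_closed[OF c], where k = i] c
    by (simp add: B.twist_twist)
  then show ?thesis
    using c N.hcomp_closed[OF n] by (simp add: der_map(2)[OF A_linear_Der[OF D] n] xpt_ksign Der_closed[OF D] mult.commute)
qed

text \<open>On \<open>n \<otimes> c\<close> the Leibniz rule adds the term
  \<open>n \<otimes> c D(b)\<close>, which equals \<open>n c \<otimes> D b\<close>, and
  \<open>n c\<close> is the counit of \<open>n \<otimes> c\<close>. This defect of
  \<open>B\<close>-linearity is the source of the connection.\<close>

lemma der_map_ract:
  assumes D: "D \<in> Der A B \<phi> X d" and b: "b \<in> carrier B" and t: "t \<in> carrier NA.T"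
  shows "der_map D (ract BC t b) = ract BT (der_map D t) b \<oplus>\<^bsub>NX.T\<^esub> NX.pt (twist N d (\<epsilon> t)) (D b)"
proof (rule na_ahom_eqI[where f = "\<lambda>t. der_map D (ract BC t b)", OF NX.abelian _ _ t])
  note H = der_map(1)[OF A_linear_Der[OF D]] and Dc = Der_closed[OF D]
  show "(\<lambda>t. der_map D (ract BC t b)) \<in> ahom NA.T NX.T" by (rule ahom_comp[OF BC_ract(1)[OF b] H])
  show "(\<lambda>t. ract BT (der_map D t) b \<oplus>\<^bsub>NX.T\<^esub> NX.pt (twist N d (\<epsilon> t)) (D b)) \<in> ahom NA.T NX.T"
    by (intro ahom_plus NX.abelian ahom_comp[OF H BT_ract(1)[OF b]]
        ahom_comp[OF ahom_comp[OF \<epsilon>_ahom N.twist_ahom] biadd_left[OF xpt_biadd Dc[OF b]]])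
  fix i k n c assume h: "n \<in> hcomp N i" "c \<in> hcomp B k"
  note hc = N.hcomp_closed[OF h(1)] B.hcomp_closed[OF h(2)]
  show "der_map D (ract BC (NA.pt n c) b) = ract BT (der_map D (NA.pt n c)) b \<oplus>\<^bsub>NX.T\<^esub> NX.pt (twist N d (\<epsilon> (NA.pt n c))) (D b)"
    using hc b
    by (simp add: BC_ract der_map_Der[OF D h(1)] Der_mult[OF D h(2) b] ahom_ksign[OF NX.abelian NX.abelian BT_ract(1)[OF b]] BT_ract
        xpt_closed Dc rx_closed lx_closed X.ksign_closed ahom_add[OF biadd_right[OF xpt_biadd]] NXT.ksign_add NXT.ksign_closed xpt_ksign NXT.ksign_ksign
        \<epsilon>_npt N.twist_hcomp[OF N.ract_hcomp[OF h]] N.ract_closed xpt_balanced algebra_simps)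
qed

text \<open>There is no defect for scalars from \<open>A\<close>, because \<open>D\<close> itself is
  \<open>A\<close>-linear; connections have to be \<open>A\<close>-linear maps.\<close>

lemma der_map_ract_\<phi>:
  assumes D: "D \<in> Der A B \<phi> X d" and a: "a \<in> carrier A" and t: "t \<in> carrier NA.T"
  shows "der_map D (ract BC t (\<phi> a)) = ract BT (der_map D t) (\<phi> a)"
proof (rule na_ahom_eqI[where f = "\<lambda>t. der_map D (ract BC t (\<phi> a))", OF NX.abelian _ _ t])
  note H = der_map(1)[OF A_linear_Der[OF D]] and Dc = Der_closed[OF D] and b = \<phi>_closed[OF a]
  show "(\<lambda>t. der_map D (ract BC t (\<phi> a))) \<in> ahom NA.T NX.T" by (rule ahom_comp[OF BC_ract(1)[OF b] H])
  show "(\<lambda>t. ract BT (der_map D t) (\<phi> a)) \<in> ahom NA.T NX.T" by (rule ahom_comp[OF H BT_ract(1)[OF b]])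
  fix i k n c assume h: "n \<in> hcomp N i" "c \<in> hcomp B k"
  note hc = N.hcomp_closed[OF h(1)] B.hcomp_closed[OF h(2)]
  show "der_map D (ract BC (NA.pt n c) (\<phi> a)) = ract BT (der_map D (NA.pt n c)) (\<phi> a)"
    using hc b a A_linear_Der[OF D]
    by (simp add: BC_ract der_map_Der[OF D h(1)] A_linear_def ahom_ksign[OF NX.abelian NX.abelian BT_ract(1)[OF b]] BT_ract xpt_closed Dc)
qed

lemma der_map_mem:
  assumes D: "D \<in> Der A B \<phi> X d" and t: "t \<in> hcomp NA.T n"
  shows "der_map D t \<in> hcomp NX.T (n + d)"
proof (rule NA.hcomp_T_map[OF NX.abelian der_map(1)[OF A_linear_Der[OF D]] NXT.hcomp_subgroup _ t])
  fix i m l assume "m \<in> hcomp NR i" "l \<in> hcomp BA (n - i)"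
  then have h: "m \<in> hcomp N i" "l \<in> hcomp B (n - i)" by auto
  show "der_map D (NA.pt m l) \<in> hcomp NX.T (n + d)"
    using NX.pt_mem[OF h(1), of "D l" "n - i + d"] Der_mem[OF D h(2)] B.hcomp_closed[OF h(2)]
    by (simp add: der_map_Der[OF D h(1)] NXT.hcomp_ksign algebra_simps)
qed

definition section_conn :: "('n \<Rightarrow> ('n, 'b) tensor) \<Rightarrow> ('b \<Rightarrow> 'x) \<Rightarrow> 'n \<Rightarrow> ('n, 'x) tensor" where
  "section_conn s D = (\<lambda>x\<in>carrier N. der_map D (s x))"

text \<open>At \<open>t = s x\<close> the defect in \<open>der_map_ract\<close> has counit
  \<open>x\<close>, and so it becomes the Leibniz term of a connection.\<close>

lemma section_conn_is_connection:
  assumes s: "s \<in> dg_hom B N BC" and \<epsilon>s: "\<And>x. x \<in> carrier N \<Longrightarrow> \<epsilon> (s x) = x" and D: "D \<in> Der A B \<phi> X d"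
  shows "is_connection A B \<phi> N X d D (section_conn s D)"
proof -
  have "s \<in> ahom N BC" and sl: "\<And>x b. \<lbrakk>x \<in> carrier N; b \<in> carrier B\<rbrakk> \<Longrightarrow> s (ract N x b) = ract BC (s x) b"
    and sh: "\<And>x i. x \<in> hcomp N i \<Longrightarrow> s x \<in> hcomp NA.T i"
    using s by (auto simp: dg_hom_def gr_hom_def image_subset_iff)
  moreover have "ahom N BC = ahom N NA.T" by (rule ahom_struct_cong) (simp_all add: same_add_def)
  ultimately have sa: "s \<in> ahom N NA.T" by simp
  note sc = ahom_closed[OF sa]
  have g: "(\<lambda>x. der_map D (s x)) \<in> ahom N NX.T"
    by (rule ahom_comp[OF sa der_map(1)[OF A_linear_Der[OF D]]])
  have "restrict (\<lambda>x. der_map D (s x)) (carrier NR) \<in> gr_hom A NR (restrict_scalars \<phi> BT) d"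
    by (rule CC.gr_homI[OF g[folded ahom_NT]])
      (use sl sh sc in \<open>simp_all add: \<phi>_closed der_map_ract_\<phi>[OF D] der_map_mem[OF D]\<close>)
  then have gr: "section_conn s D \<in> gr_hom A NR (restrict_scalars \<phi> BT) d" by (simp add: section_conn_def)
  show ?thesis
    unfolding conn_iff
  proof (intro conjI D gr allI ballI)
    fix i x b assume x: "x \<in> hcomp N i" and b: "b \<in> carrier B"
    note xc = N.hcomp_closed[OF x]
    show "section_conn s D (ract N x b) = ract BT (section_conn s D x) b \<oplus>\<^bsub>NX.T\<^esub> ksign NX.T (d * i) (NX.pt x (D b))"
      using xc b by (simp add: section_conn_def N.ract_closed sl der_map_ract[OF D b] sc \<epsilon>s N.twist_hcomp[OF x] xpt_ksign Der_closed[OF D])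
  qed
qed

section \<open>Splittings and connections on all derivations\<close>

lemma Am_diff:
  assumes "D \<in> carrier Am" "c \<in> carrier B"
  shows "diff Am D c = diff X (D c) \<ominus>\<^bsub>X\<^esub> twist X 1 (D (twist B 1 (diff B c)))"
proof -
  have "x \<ominus>\<^bsub>restrict_scalars \<phi> IX\<^esub> y = x \<ominus>\<^bsub>X\<^esub> y" for x y
    by (rule a_minus_cong) (simp add: same_add_def)
  then show ?thesis
    using DC.C_diff[of D c] assms unfolding der_ambient_eq by (simp del: DC.C_simps)
qed

lemma Cm_diff:
  assumes "\<psi> \<in> carrier Cm" "x \<in> carrier N"
  shows "diff Cm \<psi> x = diff NX.T (\<psi> x) \<ominus>\<^bsub>NX.T\<^esub> twist NX.T 1 (\<psi> (twist N 1 (diff N x)))"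
proof -
  have "x \<ominus>\<^bsub>restrict_scalars \<phi> BT\<^esub> y = x \<ominus>\<^bsub>NX.T\<^esub> y" for x y
    by (rule a_minus_cong) (simp add: same_add_def)
  then show ?thesis
    using CC.C_diff[of \<psi> x] assms unfolding conn_ambient_eq by (simp del: CC.C_simps)
qed

lemma splits_of_section:
  assumes s: "s \<in> dg_hom B N BC" and \<epsilon>s: "\<And>x. x \<in> carrier N \<Longrightarrow> \<epsilon> (s x) = x"
  shows "splits B (fundamental_sequence A B \<phi> N X)"
proof -
  define \<Psi> where "\<Psi> D = (D, section_conn s D)" for D
  let ?L = "star_Der A B \<phi> X" and ?C = "star_Conn A B \<phi> N X"
  have "s \<in> ahom N BC" and sh: "\<And>x i. x \<in> hcomp N i \<Longrightarrow> s x \<in> hcomp NA.T i" 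
    and sd: "\<And>x. x \<in> carrier N \<Longrightarrow> s (diff N x) = diff NA.T (s x)"
    using s by (auto simp: dg_hom_def gr_hom_def image_subset_iff)
  moreover have "ahom N BC = ahom N NA.T" by (rule ahom_struct_cong) (simp_all add: same_add_def)
  ultimately have sa: "s \<in> ahom N NA.T" by simp
  note sc = ahom_closed[OF sa]
  \<comment> \<open>A map of degree 0 commutes with \<open>twist\<close>; needed because the
    differential of a Hom complex is written with twists.\<close>
  have st: "s (twist N 1 x) = twist NA.T 1 (s x)" if "x \<in> carrier N" for x
    using N.twist_commute[OF NAT.graded_group_axioms sa, where n = 0 and k = 1] sh that by (simp add: ksign_even)
  \<comment> \<open>An element of the direct sum need not satisfy a Leibniz rule of a single degree,
    but \<open>A\<close>-linearity survives sums.\<close>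
  have lin: "A_linear D" if "D \<in> carrier ?L" for D
    using A_linear_ambient[of D] DF.sum_subset[of D] that by (simp add: der_ambient_eq)
  have hom: "\<Psi> D \<in> hcomp ?C n" if "D \<in> Der A B \<phi> X n" for D n
    using section_conn_is_connection[OF s \<epsilon>s that] by (simp add: \<Psi>_def)
  have add: "\<Psi> (D \<oplus>\<^bsub>Am\<^esub> D') = \<Psi> D \<oplus>\<^bsub>RDirProd Am Cm\<^esub> \<Psi> D'" if "D \<in> carrier ?L" "D' \<in> carrier ?L" for D D'
  proof -
    have "D \<oplus>\<^bsub>Am\<^esub> D' \<in> carrier ?L" using that DF.sum_add_closed by simp
    then have "der_map (D \<oplus>\<^bsub>Am\<^esub> D') (s x) = der_map D (s x) \<oplus>\<^bsub>NX.T\<^esub> der_map D' (s x)" if "x \<in> carrier N" for x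
      using lin that sc \<open>D \<in> carrier ?L\<close> \<open>D' \<in> carrier ?L\<close> by (intro der_map_add) (auto simp: Am_add)
    then show ?thesis by (auto simp: \<Psi>_def section_conn_def Cm_add fun_eq_iff)
  qed
  have closed: "\<Psi> D \<in> carrier ?C" if "D \<in> carrier ?L" for D
    using that unfolding star_Der_simps
  proof (induction D rule: DF.sum_induct)
    case (homogeneous n D)
    then show ?case using CF.sum_mem[of "\<Psi> D" n] hom by simp
  next
    case (add D D')
    then show ?case using CF.sum_add_closed[of "\<Psi> D" "\<Psi> D'"] \<open>\<And>D' D. \<lbrakk>D \<in> carrier ?L; D' \<in> carrier ?L\<rbrakk> \<Longrightarrow> \<Psi> (D \<oplus>\<^bsub>Am\<^esub> D') = _\<close> by simp
  qed
  have "left_dg_hom B ?L ?C \<Psi>"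
    unfolding left_dg_hom_def
  proof (intro conjI allI ballI)
    show "\<Psi> \<in> ahom ?L ?C" by (rule ahomI) (use closed add in \<open>simp_all\<close>)
    show "\<Psi> ` hcomp ?L n \<subseteq> hcomp ?C n" for n
      unfolding image_subset_iff star_Der_simps using hom by blast
  next
    fix b D assume b: "b \<in> carrier B" and D: "D \<in> carrier ?L"
    have "der_map (lact ?L b D) (s x) = bleft b (der_map D (s x))" if "x \<in> carrier N" for x
      using der_map_lact(2)[OF lin[OF D] b _ sc[OF that], of "lact ?L b D"] by simp
    then show "\<Psi> (lact ?L b D) = lact ?C b (\<Psi> D)" by (auto simp: \<Psi>_def section_conn_def fun_eq_iff)
  next
    fix D assume D: "D \<in> carrier ?L"
    have DA: "D \<in> carrier Am" using D DF.sum_subset by simp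
    have "\<Psi> D \<in> carrier (RDirProd Am Cm)" using closed[OF D] CF.sum_subset by simp
    then have \<psi>: "section_conn s D \<in> carrier Cm" by (simp add: \<Psi>_def)
    have "section_conn s (diff Am D) x = diff Cm (section_conn s D) x" for x
    \<comment> \<open>Elements of the complexes are extensional functions, so the two sides must
      also agree outside the carrier.\<close>
    proof (cases "x \<in> carrier N")
      case True
      then show ?thesis
        using der_map_diff(2)[OF lin[OF D] Am_diff[OF DA] sc[OF True]]
        unfolding Cm_diff[OF \<psi> True] by (simp add: section_conn_def N.twist_closed N.diff_closed st sd True)
    next
      case False
      then show ?thesis using CC.C_diff_extensional by (simp add: section_conn_def conn_ambient_eq extensional_def)
    qed
    then show "\<Psi> (diff ?L D) = diff ?C (\<Psi> D)" by (simp add: \<Psi>_def fun_eq_iff)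
  qed
  then show ?thesis by (auto simp: splits_def fundamental_sequence_def \<Psi>_def)
qed

text \<open>An \<open>L\<close>-connection asks for first component \<open>D\<close> on homogeneous
  \<open>D\<close> only, a splitting on all \<open>D\<close>. Additivity gives one direction; in the
  other, preservation of degree puts \<open>\<Delta> D\<close> among the homogeneous
  connections.\<close>

lemma admits_connection_iff_splits:
  "admits_connection A B \<phi> N X (carrier (star_Der A B \<phi> X)) \<longleftrightarrow> splits B (fundamental_sequence A B \<phi> N X)"
proof -
  let ?L = "star_Der A B \<phi> X" and ?C = "star_Conn A B \<phi> N X"
  have sub: "Der A B \<phi> X n \<inter> carrier ?L = Der A B \<phi> X n" for n using DF.sum_mem by auto
  have "left_dg_hom B (?L\<lparr>carrier := carrier ?L, hcomp := (\<lambda>n. Der A B \<phi> X n \<inter> carrier ?L)\<rparr>) ?C \<Delta> \<longleftrightarrow> left_dg_hom B ?L ?C \<Delta>" for \<Delta>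
    unfolding sub by (simp add: left_dg_hom_def hom_def)
  moreover have "(\<forall>n. \<forall>D\<in>Der A B \<phi> X n. \<exists>\<psi>. \<Delta> D = (D, \<psi>) \<and> is_connection A B \<phi> N X n D \<psi>)
      \<longleftrightarrow> (\<forall>D\<in>carrier ?L. fst (\<Delta> D) = D)" (is "?l = ?r") if \<Delta>: "left_dg_hom B ?L ?C \<Delta>" for \<Delta>
  proof
    assume l: ?l
    have "fst (\<Delta> D) = D" if "D \<in> carrier ?L" for D
      using that unfolding star_Der_simps
    proof (induction D rule: DF.sum_induct)
      case (homogeneous n D)
      then show ?case using l by force
    next
      case (add D D')
      then have "\<Delta> (D \<oplus>\<^bsub>Am\<^esub> D') = \<Delta> D \<oplus>\<^bsub>RDirProd Am Cm\<^esub> \<Delta> D'"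
        using \<Delta> ahom_add[of \<Delta> ?L ?C D D'] by (simp add: left_dg_hom_def)
      then show ?case using add(3,4) by (cases "\<Delta> D"; cases "\<Delta> D'") simp
    qed
    then show ?r by blast
  next
    assume r: ?r
    show ?l
    proof (intro allI ballI)
      fix n D assume D: "D \<in> Der A B \<phi> X n"
      then have "\<Delta> D \<in> hcomp ?C n" using \<Delta> unfolding left_dg_hom_def image_subset_iff star_Der_simps by blast
      moreover have "fst (\<Delta> D) = D" using r DF.sum_mem[OF D] by simp
      ultimately show "\<exists>\<psi>. \<Delta> D = (D, \<psi>) \<and> is_connection A B \<phi> N X n D \<psi>" by (cases "\<Delta> D") auto
    qed
  qed
  ultimately show ?thesis
    unfolding admits_connection_def splits_def fundamental_sequence_def sub by (simp cong: conj_cong)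
qed

end

section \<open>Connections along copies of the diagonal ideal\<close>

context dg_extension
begin

text \<open>The universal derivation before restriction to the carrier, with values in the whole of
  \<open>B \<otimes>\<^sub>A B\<close>.\<close>

definition ud :: "'b \<Rightarrow> ('b, 'b) tensor" where
  "ud b = e1 b \<ominus>\<^bsub>BB.T\<^esub> e2 b"

lemma univ_derivation_eq: "univ_derivation A B \<phi> = restrict ud (carrier B)"
  by (auto simp: univ_derivation_def fun_eq_iff ud_def a_minus_cong[OF same_add_Be])

lemma ud_ahom: "ud \<in> ahom B BB.T"
  using ahom_diff[OF BB.abelian e1_ahom e2_ahom] by (simp add: ud_def[abs_def])

lemma ud_closed: "b \<in> carrier B \<Longrightarrow> ud b \<in> carrier BB.T"
  using ahom_closed[OF ud_ahom] .

lemma ud_J: "b \<in> carrier B \<Longrightarrow> ud b \<in> carrier J"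
  using ud_closed[of b] ahom_a_minus[OF BB.abelian B.abelian \<pi>_ahom ept_closed ept_closed]
  by (simp add: ud_def \<pi>_ept a_minus_def B.r_neg)

lemma ud_mem: "b \<in> hcomp B i \<Longrightarrow> ud b \<in> hcomp BB.T i"
  using ept_mem[OF _ B.one_hcomp, of b i] ept_mem[OF B.one_hcomp, of b i] by (simp add: ud_def a_minus_def E.hcomp_add E.hcomp_inv)

lemma ud_diff: "b \<in> carrier B \<Longrightarrow> diff BB.T (ud b) = ud (diff B b)"
  using e1_dg e2_dg ahom_a_minus[OF BB.abelian BB.abelian E.diff_hom ept_closed ept_closed]
  by (simp add: ud_def dg_ring_hom_def)

text \<open>Moving \<open>\<phi> a\<close> across the tensor sign past 1 costs no sign. It yields
  \<open>A\<close>-linearity of the universal derivation.\<close>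

lemma ept_\<phi>:
  assumes "b \<in> carrier B" "a \<in> carrier A" shows "e1 (b \<otimes>\<^bsub>B\<^esub> \<phi> a) = ept b (\<phi> a)"
proof (rule A.graded_ahom_eqI[where f = "\<lambda>a. e1 (b \<otimes>\<^bsub>B\<^esub> \<phi> a)", OF _ _ assms(2)])
  note \<phi>a = dg_ring_hom_ahom[OF \<phi>_dg]
  show "(\<lambda>a. e1 (b \<otimes>\<^bsub>B\<^esub> \<phi> a)) \<in> ahom A BB.T"
    by (rule ahom_comp[OF ahom_comp[OF \<phi>a biadd_right[OF B.mult_biadd assms(1)]] e1_ahom])
  show "(\<lambda>a. ept b (\<phi> a)) \<in> ahom A BB.T" by (rule ahom_comp[OF \<phi>a biadd_right[OF ept_biadd assms(1)]])
  fix i a assume a: "a \<in> hcomp A i"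
  show "e1 (b \<otimes>\<^bsub>B\<^esub> \<phi> a) = ept b (\<phi> a)"
    using ept_balanced[OF assms(1) a B.one_hcomp] \<phi>_closed[OF A.hcomp_closed[OF a]] by (simp add: ksign_even)
qed

text \<open>Graded commutativity of the enveloping algebra in the one case that is needed, where
  left multiplication by \<open>b \<otimes> 1\<close> is compared with the signed right
  action.\<close>

lemma e1_mult_twist:
  assumes b: "b \<in> hcomp B i" and t: "t \<in> carrier BB.T"
  shows "t \<otimes>\<^bsub>Be\<^esub> e1 b = e1 b \<otimes>\<^bsub>Be\<^esub> twist BB.T i t"
proof (rule env_ahom_eqI[where f = "\<lambda>t. t \<otimes>\<^bsub>Be\<^esub> e1 b", OF BB.abelian _ _ t])
  note bc = B.hcomp_closed[OF b]
  have e: "e1 b \<in> carrier BB.T" using bc by (simp add: ept_closed)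
  show "(\<lambda>t. t \<otimes>\<^bsub>Be\<^esub> e1 b) \<in> ahom BB.T BB.T" by (rule biadd_left[OF env_mult_biadd e])
  show "(\<lambda>t. e1 b \<otimes>\<^bsub>Be\<^esub> twist BB.T i t) \<in> ahom BB.T BB.T"
    by (rule ahom_comp[OF E.twist_ahom biadd_right[OF env_mult_biadd e]])
  fix k l x y assume h: "x \<in> hcomp B k" "y \<in> hcomp B l"
  note hc = h[THEN B.hcomp_closed]
  have "ept x y \<otimes>\<^bsub>Be\<^esub> e1 b = ksign BB.T (l * i) (ept (x \<otimes>\<^bsub>B\<^esub> b) y)"
    using hc by (simp add: env_mult_ept[OF hc(1) h(2) b])
  moreover have "e1 b \<otimes>\<^bsub>Be\<^esub> twist BB.T i (ept x y) = ksign BB.T (i * (k + l) + i * k) (ept (x \<otimes>\<^bsub>B\<^esub> b) y)"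
    using hc bc by (simp add: E.twist_hcomp[OF ept_mem[OF h]] env_mult_ksign ept_closed env_mult_ept[OF bc B.one_hcomp h(1) hc(2)]
        B.graded_comm[OF b h(1)] ept_ksign E.ksign_ksign)
  ultimately show "ept x y \<otimes>\<^bsub>Be\<^esub> e1 b = e1 b \<otimes>\<^bsub>Be\<^esub> twist BB.T i (ept x y)"
    by (auto intro!: ksign_cong)
qed

end

section \<open>From \<open>N \<otimes>\<^sub>B B\<^sup>e\<close> to the base change\<close>

context dg_base
begin

text \<open>The right action of \<open>B\<^sup>e\<close> seen through \<open>N \<otimes>\<^sub>A B \<cong> N \<otimes>\<^sub>B B\<^sup>e\<close>: \<open>n\<close> and \<open>b \<otimes> c\<close> give \<open>n b \<otimes> c\<close>.\<close>

definition env_act :: "'n \<Rightarrow> ('b, 'b) tensor \<Rightarrow> ('n, 'b) tensor" where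
  "env_act n = tensor_lift NA.T (\<lambda>(b, c). NA.pt (ract N n b) c)"

lemma env_act_lift:
  assumes n: "n \<in> carrier N"
  shows "env_act n \<in> ahom BB.T NA.T"
    "\<lbrakk>b \<in> carrier B; c \<in> carrier B\<rbrakk> \<Longrightarrow> env_act n (ept b c) = NA.pt (ract N n b) c"
proof -
  have g: "biadd B B NA.T (\<lambda>b c. NA.pt (ract N n b) c)"
    by (rule biadd_comp[OF npt_biadd biadd_right[OF N.ract_biadd n] ahom_id])
  have bal: "NA.pt (ract N n (b \<otimes>\<^bsub>B\<^esub> \<phi> s)) c = ksign NA.T (j * k) (NA.pt (ract N n b) (c \<otimes>\<^bsub>B\<^esub> \<phi> s))"
    if h: "b \<in> hcomp B i" "s \<in> hcomp A j" "c \<in> hcomp B k" for b s c i j k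
    using n B.hcomp_closed[OF h(1)] \<phi>_hcomp[OF h(2), THEN B.hcomp_closed]
    by (simp add: N.ract_mult npt_balanced[OF _ h(2,3)] N.ract_closed)
  show "env_act n \<in> ahom BB.T NA.T" unfolding env_act_def by (rule env_lift[OF NA.abelian g], erule (2) bal)
  show "\<lbrakk>b \<in> carrier B; c \<in> carrier B\<rbrakk> \<Longrightarrow> env_act n (ept b c) = NA.pt (ract N n b) c"
    unfolding env_act_def by (rule env_lift[OF NA.abelian g], erule (2) bal)
qed

lemma env_act_biadd: "biadd N BB.T NA.T env_act"
proof (rule biaddI)
  fix n n' t assume n: "n \<in> carrier N" "n' \<in> carrier N" and t: "t \<in> carrier BB.T"
  show "env_act (n \<oplus>\<^bsub>N\<^esub> n') t = env_act n t \<oplus>\<^bsub>NA.T\<^esub> env_act n' t"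
  proof (rule env_ahom_eqI[OF NA.abelian env_act_lift(1)[OF N.a_closed[OF n]] ahom_plus[OF NA.abelian env_act_lift(1)[OF n(1)] env_act_lift(1)[OF n(2)]] t])
    fix i j b c assume h: "b \<in> hcomp B i" "c \<in> hcomp B j"
    show "env_act (n \<oplus>\<^bsub>N\<^esub> n') (ept b c) = env_act n (ept b c) \<oplus>\<^bsub>NA.T\<^esub> env_act n' (ept b c)"
      using n h[THEN B.hcomp_closed] ahom_add[OF biadd_left[OF npt_biadd]]
      by (simp add: env_act_lift N.ract_add_left N.ract_closed)
  qed
qed (use ahom_closed[OF env_act_lift(1)] ahom_add[OF env_act_lift(1)] in auto)

text \<open>The balancing over \<open>B\<close> that lets \<open>env_act\<close> descend to a tensor
  product over \<open>B\<close>.\<close>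

lemma env_act_e1:
  assumes n: "n \<in> carrier N" and b: "b \<in> carrier B" and t: "t \<in> carrier BB.T"
  shows "env_act (ract N n b) t = env_act n (e1 b \<otimes>\<^bsub>Be\<^esub> t)"
proof (rule env_ahom_eqI[where f = "env_act (ract N n b)", OF NA.abelian _ _ t])
  have e: "e1 b \<in> carrier BB.T" using b by (simp add: ept_closed)
  show "env_act (ract N n b) \<in> ahom BB.T NA.T" using n b by (intro env_act_lift N.ract_closed)
  show "(\<lambda>t. env_act n (e1 b \<otimes>\<^bsub>Be\<^esub> t)) \<in> ahom BB.T NA.T"
    by (rule ahom_comp[OF biadd_right[OF env_mult_biadd e] env_act_lift(1)[OF n]])
  fix k l x y assume h: "x \<in> hcomp B k" "y \<in> hcomp B l"
  note hc = h[THEN B.hcomp_closed]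
  show "env_act (ract N n b) (ept x y) = env_act n (e1 b \<otimes>\<^bsub>Be\<^esub> ept x y)"
    using hc n b by (simp add: env_mult_ept[OF b B.one_hcomp h(1) hc(2)] ksign_even env_act_lift N.ract_closed N.ract_mult)
qed

text \<open>The factor \<open>1 \<otimes> b\<close> acts on the second tensor factor, which is where
  \<open>B\<close> acts on the base change.\<close>

lemma env_act_e2:
  assumes n: "n \<in> carrier N" and b: "b \<in> carrier B" and t: "t \<in> carrier BB.T"
  shows "env_act n (t \<otimes>\<^bsub>Be\<^esub> e2 b) = ract BC (env_act n t) b"
proof (rule env_ahom_eqI[where f = "\<lambda>t. env_act n (t \<otimes>\<^bsub>Be\<^esub> e2 b)", OF NA.abelian _ _ t])
  have e: "e2 b \<in> carrier BB.T" using b by (simp add: ept_closed)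
  show "(\<lambda>t. env_act n (t \<otimes>\<^bsub>Be\<^esub> e2 b)) \<in> ahom BB.T NA.T"
    by (rule ahom_comp[OF biadd_left[OF env_mult_biadd e] env_act_lift(1)[OF n]])
  show "(\<lambda>t. ract BC (env_act n t) b) \<in> ahom BB.T NA.T"
    by (rule ahom_comp[OF env_act_lift(1)[OF n] BC_ract(1)[OF b]])
  fix k l x y assume h: "x \<in> hcomp B k" "y \<in> hcomp B l"
  note hc = h[THEN B.hcomp_closed]
  show "env_act n (ept x y \<otimes>\<^bsub>Be\<^esub> e2 b) = ract BC (env_act n (ept x y)) b"
    using hc n b by (simp add: env_mult_ept[OF hc(1) h(2) B.one_hcomp b] ksign_even env_act_lift N.ract_closed BC_ract)
qed

text \<open>Multiplying \<open>n b\<close> by \<open>c\<close> is acting on \<open>n\<close> by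
  \<open>b c\<close>; consequently the counit vanishes once \<open>t\<close> lies in
  \<open>J\<close>.\<close>

lemma \<epsilon>_env_act:
  assumes n: "n \<in> carrier N" and t: "t \<in> carrier BB.T"
  shows "\<epsilon> (env_act n t) = ract N n (\<pi> t)"
proof (rule env_ahom_eqI[where f = "\<lambda>t. \<epsilon> (env_act n t)" and G = N, OF N.abelian _ _ t])
  show "(\<lambda>t. \<epsilon> (env_act n t)) \<in> ahom BB.T N" by (rule ahom_comp[OF env_act_lift(1)[OF n] \<epsilon>_ahom])
  show "(\<lambda>t. ract N n (\<pi> t)) \<in> ahom BB.T N" by (rule ahom_comp[OF \<pi>_ahom biadd_right[OF N.ract_biadd n]])
qed (use n in \<open>simp add: B.hcomp_closed env_act_lift \<epsilon>_npt N.ract_closed \<pi>_ept N.ract_mult\<close>)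

lemma diff_npt: "\<lbrakk>n \<in> hcomp N i; c \<in> carrier B\<rbrakk> \<Longrightarrow> diff NA.T (NA.pt n c) = NA.pt (diff N n) c \<oplus>\<^bsub>NA.T\<^esub> ksign NA.T i (NA.pt n (diff B c))"
  using NA.diff_pt[of n i c] by simp

lemma diff_env_act:
  assumes n: "n \<in> hcomp N i" and t: "t \<in> carrier BB.T"
  shows "diff NA.T (env_act n t) = env_act (diff N n) t \<oplus>\<^bsub>NA.T\<^esub> ksign NA.T i (env_act n (diff BB.T t))"
proof (rule env_ahom_eqI[where f = "\<lambda>t. diff NA.T (env_act n t)", OF NA.abelian _ _ t])
  note nc = N.hcomp_closed[OF n]
  note dn = N.diff_closed[OF nc]
  show "(\<lambda>t. diff NA.T (env_act n t)) \<in> ahom BB.T NA.T" by (rule ahom_comp[OF env_act_lift(1)[OF nc] NAT.diff_hom])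
  show "(\<lambda>t. env_act (diff N n) t \<oplus>\<^bsub>NA.T\<^esub> ksign NA.T i (env_act n (diff BB.T t))) \<in> ahom BB.T NA.T"
    by (intro ahom_plus ahom_ksign_fun NA.abelian env_act_lift(1)[OF dn] ahom_comp[OF E.diff_hom env_act_lift(1)[OF nc]])
  fix k l x y assume h: "x \<in> hcomp B k" "y \<in> hcomp B l"
  note hc = h[THEN B.hcomp_closed]
  note dc = hc[THEN B.diff_closed]
  show "diff NA.T (env_act n (ept x y)) = env_act (diff N n) (ept x y) \<oplus>\<^bsub>NA.T\<^esub> ksign NA.T i (env_act n (diff BB.T (ept x y)))"
    using hc dc nc dn biadd_ksign(1)[OF N.abelian B.abelian NA.abelian npt_biadd]
    by (simp add: env_act_lift diff_npt[OF N.ract_hcomp[OF n h(1)]] N.module_Leibniz[OF n h(1)] diff_ept[OF h(1)]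
        ahom_add[OF biadd_left[OF npt_biadd]] ahom_add[OF env_act_lift(1)] N.ract_closed N.ksign_closed ept_closed E.ksign_closed
        ahom_ksign[OF BB.abelian NA.abelian env_act_lift(1)] NAT.ksign_add NAT.ksign_ksign npt_closed NAT.ksign_closed NAT.a_assoc)
qed

lemma env_act_mem:
  assumes n: "n \<in> hcomp N i" and t: "t \<in> hcomp BB.T j"
  shows "env_act n t \<in> hcomp NA.T (i + j)"
proof (rule BB.hcomp_T_map[OF NA.abelian env_act_lift(1)[OF N.hcomp_closed[OF n]] NAT.hcomp_subgroup _ t])
  fix k b c assume "b \<in> hcomp BA k" "c \<in> hcomp BA (j - k)"
  then have h: "b \<in> hcomp B k" "c \<in> hcomp B (j - k)" by auto
  show "env_act n (BB.pt b c) \<in> hcomp NA.T (i + j)"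
    using NA.pt_mem[of "ract N n b" "i + k" c "j - k"] N.ract_hcomp[OF n h(1)] h h[THEN B.hcomp_closed]
    by (simp add: env_act_lift(2)[OF N.hcomp_closed[OF n], unfolded ept_pt])
qed

end

text \<open>A DG module \<open>X\<close> embedded in \<open>B\<^sup>e\<close> via \<open>\<gamma>\<close> with image in \<open>J\<close>, together with a lift \<open>\<Delta>\<close> of the universal
  derivation.  Besides \<open>J\<close> itself this covers copies of \<open>J\<close> carried by other types.\<close>

locale diag_copy = dg_bimodule R A B \<phi> N X
  for R :: "'r ring" and A :: "('r, 'a) dg_alg" and B :: "('r, 'b) dg_alg" and \<phi> :: "'a \<Rightarrow> 'b"
    and N :: "('b, 'n) dg_rmod" and X :: "(('b, 'b) tensor, 'x) dg_rmod" +
  fixes \<gamma> :: "'x \<Rightarrow> ('b, 'b) tensor" and \<Delta> :: "'b \<Rightarrow> 'x"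
  assumes \<gamma>_ahom: "\<gamma> \<in> ahom X BB.T"
    and \<gamma>_inj: "inj_on \<gamma> (carrier X)"
    and \<gamma>_J: "x \<in> carrier X \<Longrightarrow> \<gamma> x \<in> carrier J"
    and \<gamma>_ract: "\<lbrakk>x \<in> carrier X; u \<in> carrier BB.T\<rbrakk> \<Longrightarrow> \<gamma> (ract X x u) = \<gamma> x \<otimes>\<^bsub>Be\<^esub> u"
    and \<gamma>_hcomp: "x \<in> carrier X \<Longrightarrow> x \<in> hcomp X n \<longleftrightarrow> \<gamma> x \<in> hcomp BB.T n"
    and \<gamma>_diff: "x \<in> carrier X \<Longrightarrow> \<gamma> (diff X x) = diff BB.T (\<gamma> x)"
    and \<Delta>_closed: "\<Delta> \<in> carrier B \<rightarrow>\<^sub>E carrier X"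
    and \<gamma>_\<Delta>: "b \<in> carrier B \<Longrightarrow> \<gamma> (\<Delta> b) = ud b"
begin

lemma \<gamma>_closed: "x \<in> carrier X \<Longrightarrow> \<gamma> x \<in> carrier BB.T"
  using ahom_closed[OF \<gamma>_ahom] .

lemma \<Delta>_mem: "b \<in> carrier B \<Longrightarrow> \<Delta> b \<in> carrier X"
  using \<Delta>_closed by auto

lemma \<gamma>_eqI: "\<lbrakk>x \<in> carrier X; y \<in> carrier X; \<gamma> x = \<gamma> y\<rbrakk> \<Longrightarrow> x = y"
  using \<gamma>_inj by (auto dest: inj_onD)

text \<open>The signed right action of \<open>b \<otimes> 1\<close> is left multiplication by
  \<open>b \<otimes> 1\<close>, by commutativity in the enveloping algebra. Note that
  \<open>\<gamma>\<close> is assumed compatible with right actions only.\<close>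

lemma \<gamma>_lx:
  assumes b: "b \<in> carrier B" and x: "x \<in> carrier X"
  shows "\<gamma> (b \<star> x) = e1 b \<otimes>\<^bsub>Be\<^esub> \<gamma> x"
proof (rule biadd_eqI[OF B.graded_group_axioms X.graded_group_axioms _ _ _ b x, where g = "\<lambda>b x. \<gamma> (b \<star> x)"])
  show "biadd B X BB.T (\<lambda>b x. \<gamma> (b \<star> x))" by (rule biadd_post[OF lx_biadd \<gamma>_ahom])
  show "biadd B X BB.T (\<lambda>b x. e1 b \<otimes>\<^bsub>Be\<^esub> \<gamma> x)" by (rule biadd_comp[OF env_mult_biadd e1_ahom \<gamma>_ahom])
  fix i k b x assume h: "b \<in> hcomp B i" "x \<in> hcomp X k"
  note hc = B.hcomp_closed[OF h(1)] X.hcomp_closed[OF h(2)]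
  have e: "e1 b \<in> carrier BB.T" using hc by (simp add: ept_closed)
  have "\<gamma> (b \<star> x) = ksign BB.T (i * k) (\<gamma> x \<otimes>\<^bsub>Be\<^esub> e1 b)"
    using OX.left_hcomp[OF h(1), of x k] h(2) hc e
    by (simp add: ahom_ksign[OF X.abelian BB.abelian \<gamma>_ahom] X.ract_closed \<gamma>_ract)
  also have "\<dots> = e1 b \<otimes>\<^bsub>Be\<^esub> \<gamma> x"
    using e1_mult_twist[OF h(1) \<gamma>_closed[OF hc(2)]] e E.twist_hcomp[of "\<gamma> x" k i] \<gamma>_hcomp[OF hc(2)] h(2) \<gamma>_closed[OF hc(2)]
    by (simp add: env_mult_ksign E.ksign_ksign env_mult_closed ksign_even)
  finally show "\<gamma> (b \<star> x) = e1 b \<otimes>\<^bsub>Be\<^esub> \<gamma> x" .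
qed

lemma \<gamma>_rx: "\<lbrakk>x \<in> carrier X; b \<in> carrier B\<rbrakk> \<Longrightarrow> \<gamma> (x \<bullet> b) = \<gamma> x \<otimes>\<^bsub>Be\<^esub> e2 b"
  by (simp add: \<gamma>_ract ept_closed)

text \<open>With the companion below this rewrites both terms of the Leibniz rule so that the mixed
  tensor \<open>b \<otimes> c\<close> appears with opposite signs.\<close>

lemma ud_mult_left: "\<lbrakk>b \<in> carrier B; c \<in> carrier B\<rbrakk> \<Longrightarrow> e1 b \<otimes>\<^bsub>Be\<^esub> ud c = e1 (b \<otimes>\<^bsub>B\<^esub> c) \<ominus>\<^bsub>BB.T\<^esub> ept b c"
  using e1_dg by (simp add: ud_def ahom_a_minus[OF BB.abelian BB.abelian biadd_right[OF env_mult_biadd]] ept_closed env_mult_e1_e2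
     dg_ring_hom_def ring_hom_def)

lemma ud_mult_right: "\<lbrakk>b \<in> carrier B; c \<in> carrier B\<rbrakk> \<Longrightarrow> ud b \<otimes>\<^bsub>Be\<^esub> e2 c = ept b c \<ominus>\<^bsub>BB.T\<^esub> e2 (b \<otimes>\<^bsub>B\<^esub> c)"
  using e2_dg by (simp add: ud_def ahom_a_minus[OF BB.abelian BB.abelian biadd_left[OF env_mult_biadd]] ept_closed env_mult_e1_e2
     dg_ring_hom_def ring_hom_def)

lemma \<Delta>_ahom: "\<Delta> \<in> ahom B X"
  by (rule ahomI)
    (auto intro!: \<gamma>_eqI simp: \<Delta>_mem \<gamma>_\<Delta> ahom_add[OF \<gamma>_ahom] ahom_add[OF ud_ahom])

text \<open>Since \<open>\<gamma>\<close> is injective, every identity may be checked after mapping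
  to the enveloping algebra, where \<open>\<Delta>\<close> becomes \<open>ud\<close> and the Leibniz
  rule telescopes.\<close>

lemma \<Delta>_Der: "\<Delta> \<in> Der A B \<phi> X 0"
  unfolding Der_iff
proof (intro conjI allI ballI)
  have "\<Delta> (b \<otimes>\<^bsub>B\<^esub> \<phi> a) = \<Delta> b \<bullet> \<phi> a" if "b \<in> carrier B" "a \<in> carrier A" for b a
    using that ept_\<phi>[OF that] \<phi>_closed[OF that(2)]
    by (intro \<gamma>_eqI) (simp_all add: \<Delta>_mem rx_closed \<gamma>_rx \<gamma>_\<Delta> ud_mult_right, simp add: ud_def)
  moreover have "\<Delta> x \<in> hcomp X i" if "x \<in> hcomp B i" for x i
    using that \<gamma>_hcomp[OF \<Delta>_mem[OF B.hcomp_closed[OF that]]] by (simp add: \<gamma>_\<Delta> B.hcomp_closed ud_mem)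
  ultimately have "restrict \<Delta> (carrier BA) \<in> gr_hom A BA (restrict_scalars \<phi> IX) 0"
    by (intro DC.gr_homI[OF \<Delta>_ahom[folded ahom_BX]]) simp_all
  moreover have "restrict \<Delta> (carrier BA) = \<Delta>" using \<Delta>_closed by (simp add: PiE_restrict)
  ultimately show "\<Delta> \<in> gr_hom A BA (restrict_scalars \<phi> IX) 0" by simp
  fix i j b c assume h: "b \<in> hcomp B i" "c \<in> hcomp B j"
  note hc = h[THEN B.hcomp_closed]
  have x: "e1 (b \<otimes>\<^bsub>B\<^esub> c) \<in> carrier BB.T" "ept b c \<in> carrier BB.T" "e2 (b \<otimes>\<^bsub>B\<^esub> c) \<in> carrier BB.T"
    using hc by (auto intro: ept_closed)
  have "ept b c \<ominus>\<^bsub>BB.T\<^esub> e2 (b \<otimes>\<^bsub>B\<^esub> c) \<oplus>\<^bsub>BB.T\<^esub> (e1 (b \<otimes>\<^bsub>B\<^esub> c) \<ominus>\<^bsub>BB.T\<^esub> ept b c) = e1 (b \<otimes>\<^bsub>B\<^esub> c) \<ominus>\<^bsub>BB.T\<^esub> e2 (b \<otimes>\<^bsub>B\<^esub> c)"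
    by (rule E.minus_telescope) (fact x)+
  then show "\<Delta> (b \<otimes>\<^bsub>B\<^esub> c) = \<Delta> b \<bullet> c \<oplus>\<^bsub>X\<^esub> ksign X (0 * i) (b \<star> \<Delta> c)"
    using hc by (intro \<gamma>_eqI) (simp_all add: ksign_even \<Delta>_mem rx_closed lx_closed ahom_add[OF \<gamma>_ahom] \<gamma>_rx \<gamma>_lx \<gamma>_\<Delta>
        ud_mult_left ud_mult_right, simp add: ud_def)
qed

lemma \<Delta>_diff: "c \<in> carrier B \<Longrightarrow> diff X (\<Delta> c) = \<Delta> (diff B c)"
  by (rule \<gamma>_eqI) (simp_all add: \<gamma>_diff \<gamma>_\<Delta> \<Delta>_mem X.diff_closed B.diff_closed ud_diff)

text \<open>\<open>\<Delta>\<close> has degree 0 and commutes with the differentials, so it is a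
  cycle in the complex of derivations.\<close>

lemma \<Delta>_closed_der: "diff Am \<Delta> = \<zero>\<^bsub>Am\<^esub>"
proof
  fix c
  show "diff Am \<Delta> c = \<zero>\<^bsub>Am\<^esub> c"
  proof (cases "c \<in> carrier B")
    case True
    have "x \<ominus>\<^bsub>restrict_scalars \<phi> IX\<^esub> y = x \<ominus>\<^bsub>X\<^esub> y" for x y
      by (rule a_minus_cong) (simp add: same_add_def)
    then show ?thesis
      using DC.C_diff_hcomp[OF Der_gr_hom[OF \<Delta>_Der], of c] True
      by (simp add: Am_zero ksign_even \<Delta>_diff \<Delta>_mem B.diff_closed a_minus_def X.r_neg flip: der_ambient_eq)
  next
    case False
    then show ?thesis using DC.C_diff_extensional[of \<Delta>] by (simp add: Am_zero extensional_def flip: der_ambient_eq)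
  qed
qed

text \<open>A splitting respects degrees and differentials, so it sends the cycle
  \<open>\<Delta>\<close> of degree 0 to a cycle of degree 0 whose first component is
  \<open>\<Delta>\<close>.\<close>

lemma closed_conn_of_splits:
  assumes "splits B (fundamental_sequence A B \<phi> N X)"
  shows "\<exists>\<psi>. is_connection A B \<phi> N X 0 \<Delta> \<psi> \<and> diff (star_Conn A B \<phi> N X) (\<Delta>, \<psi>) = \<zero>\<^bsub>star_Conn A B \<phi> N X\<^esub>"
proof -
  let ?L = "star_Der A B \<phi> X" and ?C = "star_Conn A B \<phi> N X"
  obtain \<Psi> where \<Psi>: "left_dg_hom B ?L ?C \<Psi>" and fst: "\<And>q. q \<in> carrier ?L \<Longrightarrow> fst (\<Psi> q) = q"
    using assms by (auto simp: splits_def fundamental_sequence_def)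
  have \<Delta>L: "\<Delta> \<in> carrier ?L" using DF.sum_mem[OF \<Delta>_Der] by simp
  have "\<Psi> \<Delta> \<in> hcomp ?C 0"
    using \<Psi> \<Delta>_Der unfolding left_dg_hom_def image_subset_iff star_Der_simps by blast
  then obtain \<psi> where \<psi>: "\<Psi> \<Delta> = (\<Delta>, \<psi>)" "is_connection A B \<phi> N X 0 \<Delta> \<psi>"
    using fst[OF \<Delta>L] by (cases "\<Psi> \<Delta>") auto
  have "abelian_group ?L" by (rule abelian_group_cong[OF _ DF.sum_abelian]) (simp add: same_add_def)
  moreover have "abelian_group ?C" by (rule abelian_group_cong[OF _ CF.sum_abelian]) (simp add: same_add_def)
  moreover have "\<Psi> \<in> ahom ?L ?C" using \<Psi> unfolding left_dg_hom_def by blast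
  ultimately have "\<Psi> \<zero>\<^bsub>?L\<^esub> = \<zero>\<^bsub>?C\<^esub>" by (rule ahom_zero)
  moreover have "\<Psi> (diff ?L \<Delta>) = diff ?C (\<Psi> \<Delta>)" using \<Psi> \<Delta>L unfolding left_dg_hom_def by blast
  ultimately show ?thesis using \<psi> \<Delta>_closed_der by auto
qed

definition collapse :: "('n, 'x) tensor \<Rightarrow> ('n, 'b) tensor" where
  "collapse = tensor_lift NA.T (\<lambda>(n, x). env_act n (\<gamma> x))"

lemma collapse:
  shows "collapse \<in> ahom NX.T NA.T"
    "\<lbrakk>n \<in> carrier N; x \<in> carrier X\<rbrakk> \<Longrightarrow> collapse (NX.pt n x) = env_act n (\<gamma> x)"
proof -
  have g: "biadd N X NA.T (\<lambda>n x. env_act n (\<gamma> x))" by (rule biadd_comp[OF env_act_biadd ahom_id \<gamma>_ahom])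
  \<comment> \<open>Acting by \<open>b\<close> on \<open>n\<close> and multiplying
    \<open>\<gamma> x\<close> by \<open>b \<otimes> 1\<close> from the left have the same effect,
    and the latter is \<open>\<gamma>\<close> of the left action on \<open>x\<close>.\<close>
  have bal: "env_act (ract N n b) (\<gamma> x) = env_act n (\<gamma> (b \<star> x))"
    if h: "n \<in> hcomp N i" "b \<in> hcomp B j" "x \<in> hcomp X k" for n b x i j k
    using N.hcomp_closed[OF h(1)] B.hcomp_closed[OF h(2)] X.hcomp_closed[OF h(3)] by (simp add: env_act_e1 \<gamma>_lx \<gamma>_closed)
  show "collapse \<in> ahom NX.T NA.T" unfolding collapse_def by (rule nx_lift[OF NA.abelian g], erule (2) bal)
  show "\<lbrakk>n \<in> carrier N; x \<in> carrier X\<rbrakk> \<Longrightarrow> collapse (NX.pt n x) = env_act n (\<gamma> x)"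
    unfolding collapse_def by (rule nx_lift[OF NA.abelian g], erule (2) bal)
qed

lemma collapse_ract:
  assumes b: "b \<in> carrier B" and t: "t \<in> carrier NX.T"
  shows "collapse (ract BT t b) = ract BC (collapse t) b"
  by (rule nx_ahom_eqI[where f = "\<lambda>t. collapse (ract BT t b)", OF NA.abelian ahom_comp[OF BT_ract(1)[OF b] collapse(1)]
        ahom_comp[OF collapse(1) BC_ract(1)[OF b]] t])
    (use b in \<open>simp add: N.hcomp_closed X.hcomp_closed BT_ract collapse rx_closed \<gamma>_rx env_act_e2 \<gamma>_closed\<close>)

text \<open>The values of \<open>\<gamma>\<close> lie in \<open>J\<close>, on which multiplication
  is zero. Hence the correction by \<open>\<psi>\<close> does not disturb the section
  property.\<close>

lemma \<epsilon>_collapse: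
  assumes t: "t \<in> carrier NX.T"
  shows "\<epsilon> (collapse t) = \<zero>\<^bsub>N\<^esub>"
proof (rule nx_ahom_eqI[where f = "\<lambda>t. \<epsilon> (collapse t)" and G = N, OF N.abelian ahom_comp[OF collapse(1) \<epsilon>_ahom] ahom_const_zero[OF N.abelian] t])
  fix i j n x assume "n \<in> hcomp N i" "x \<in> hcomp X j"
  then have h: "n \<in> carrier N" "x \<in> carrier X" by (auto intro: N.hcomp_closed X.hcomp_closed)
  then show "\<epsilon> (collapse (NX.pt n x)) = \<zero>\<^bsub>N\<^esub>"
    using \<gamma>_J[OF h(2)] ahom_zero[OF B.abelian N.abelian biadd_right[OF N.ract_biadd h(1)]] by (simp add: collapse \<epsilon>_env_act)
qed

lemma diff_collapse:
  assumes t: "t \<in> carrier NX.T"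
  shows "diff NA.T (collapse t) = collapse (diff NX.T t)"
proof (rule nx_ahom_eqI[where f = "\<lambda>t. diff NA.T (collapse t)", OF NA.abelian ahom_comp[OF collapse(1) NAT.diff_hom] ahom_comp[OF NXT.diff_hom collapse(1)] t])
  fix i j n x assume h: "n \<in> hcomp N i" "x \<in> hcomp X j"
  note hc = N.hcomp_closed[OF h(1)] X.hcomp_closed[OF h(2)]
  have "diff NX.T (NX.pt n x) = NX.pt (diff N n) x \<oplus>\<^bsub>NX.T\<^esub> ksign NX.T i (NX.pt n (diff X x))"
    using NX.diff_pt[OF h(1), of x] hc by simp
  then show "diff NA.T (collapse (NX.pt n x)) = collapse (diff NX.T (NX.pt n x))"
    using hc by (simp add: collapse diff_env_act[OF h(1)] \<gamma>_closed ahom_add[OF collapse(1)] xpt_closed N.diff_closed X.diff_closed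
        NXT.ksign_closed ahom_ksign[OF NX.abelian NA.abelian collapse(1)] \<gamma>_diff)
qed

lemma collapse_mem:
  assumes t: "t \<in> hcomp NX.T n" shows "collapse t \<in> hcomp NA.T n"
proof (rule NX.hcomp_T_map[OF NA.abelian collapse(1) NAT.hcomp_subgroup _ t])
  fix i m x assume h: "m \<in> hcomp N i" "x \<in> hcomp OX (n - i)"
  then have "x \<in> hcomp X (n - i)" "x \<in> carrier X" by (auto intro: X.hcomp_closed)
  then show "collapse (NX.pt m x) \<in> hcomp NA.T n"
    using env_act_mem[OF h(1), of "\<gamma> x" "n - i"] \<gamma>_hcomp[of x "n - i"] by (simp add: collapse N.hcomp_closed[OF h(1)])
qed

lemma liftable_of_closed_conn:
  assumes conn: "is_connection A B \<phi> N X 0 \<Delta> \<psi>"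
    and closed: "diff (star_Conn A B \<phi> N X) (\<Delta>, \<psi>) = \<zero>\<^bsub>star_Conn A B \<phi> N X\<^esub>"
  shows "naively_liftable A B \<phi> N"
proof -
  have \<psi>gr: "\<psi> \<in> gr_hom A NR (restrict_scalars \<phi> BT) 0"
    and \<psi>b: "\<And>i x b. \<lbrakk>x \<in> hcomp N i; b \<in> carrier B\<rbrakk> \<Longrightarrow> \<psi> (ract N x b) = ract BT (\<psi> x) b \<oplus>\<^bsub>NX.T\<^esub> NX.pt x (\<Delta> b)"
    using conn by (auto simp: conn_iff ksign_even)
  note \<psi>a = conn_ahom[OF conn]
  note \<psi>c = ahom_closed[OF \<psi>a]
  have \<psi>h: "\<psi> x \<in> hcomp NX.T i" if "x \<in> hcomp N i" for x i
    using CC.gr_homD(3)[OF \<psi>gr, of x i] that by simp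
  \<comment> \<open>In degree 0 the differential of \<open>\<psi>\<close> is the plain commutator
    with the differentials, so closedness means that \<open>\<psi>\<close> is a chain map.\<close>
  have \<psi>d: "diff NX.T (\<psi> x) = \<psi> (diff N x)" if x: "x \<in> carrier N" for x
  proof -
    have "y \<ominus>\<^bsub>restrict_scalars \<phi> BT\<^esub> z = y \<ominus>\<^bsub>NX.T\<^esub> z" for y z
      by (rule a_minus_cong) (simp add: same_add_def)
    then have "diff NX.T (\<psi> x) \<ominus>\<^bsub>NX.T\<^esub> \<psi> (diff N x) = \<zero>\<^bsub>NX.T\<^esub>"
      using CC.C_diff_hcomp[OF \<psi>gr, of x] x closed by (simp add: ksign_even Cm_zero flip: conn_ambient_eq)
    then show ?thesis
      using NXT.diff_closed[OF \<psi>c[OF x]] \<psi>c[OF N.diff_closed[OF x]] unfolding a_minus_def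
      by (metis NXT.a_inv_closed NXT.minus_equality NXT.minus_minus)
  qed
  define s where "s = (\<lambda>x\<in>carrier N. NA.pt x \<one>\<^bsub>B\<^esub> \<ominus>\<^bsub>NA.T\<^esub> collapse (\<psi> x))"
  have pa: "(\<lambda>x. NA.pt x \<one>\<^bsub>B\<^esub>) \<in> ahom N NA.T" by (rule biadd_left[OF npt_biadd]) simp
  have ga: "(\<lambda>x. NA.pt x \<one>\<^bsub>B\<^esub> \<ominus>\<^bsub>NA.T\<^esub> collapse (\<psi> x)) \<in> ahom N NA.T"
    by (rule ahom_diff[OF NA.abelian pa ahom_comp[OF \<psi>a collapse(1)]])
  have sa: "s \<in> ahom N NA.T" by (rule ahom_cong[OF N.abelian ga]) (simp add: s_def)
  note cc = ahom_closed[OF collapse(1) \<psi>c]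
  have sb: "s (ract N x b) = ract BC (s x) b" if x: "x \<in> carrier N" and b: "b \<in> carrier B" for x b
  proof (rule N.graded_ahom_eqI[where f = "\<lambda>x. s (ract N x b)" and G = NA.T, OF _ _ x])
    show "(\<lambda>x. s (ract N x b)) \<in> ahom N NA.T" by (rule ahom_comp[OF biadd_left[OF N.ract_biadd b] sa])
    show "(\<lambda>x. ract BC (s x) b) \<in> ahom N NA.T" by (rule ahom_comp[OF sa BC_ract(1)[OF b]])
    fix i x assume x: "x \<in> hcomp N i"
    note xc = N.hcomp_closed[OF x]
    let ?U = "NA.pt (ract N x b) \<one>\<^bsub>B\<^esub>" and ?V = "ract BC (collapse (\<psi> x)) b" and ?W = "NA.pt x b"
    have UVW: "?U \<in> carrier NA.T" "?V \<in> carrier NA.T" "?W \<in> carrier NA.T"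
      using xc b cc[OF xc] ahom_closed[OF BC_ract(1)[OF b]] by (auto intro!: npt_closed N.ract_closed)
    \<comment> \<open>The Leibniz term \<open>x \<otimes> \<Delta> b\<close> collapses to
      \<open>x b \<otimes> 1 - x \<otimes> b\<close>, by the formula for
      \<open>ud b\<close>.\<close>
    have "collapse (\<psi> (ract N x b)) = ?V \<oplus>\<^bsub>NA.T\<^esub> (?U \<ominus>\<^bsub>NA.T\<^esub> ?W)"
      using xc b by (simp add: \<psi>b[OF x b] ahom_add[OF collapse(1)] ahom_closed[OF BT_ract(1)] \<psi>c xpt_closed \<Delta>_mem collapse_ract
          collapse \<gamma>_\<Delta> ud_def ahom_a_minus[OF BB.abelian NA.abelian env_act_lift(1)] ept_closed env_act_lift N.ract_one)
    then have "s (ract N x b) = ?U \<ominus>\<^bsub>NA.T\<^esub> (?V \<oplus>\<^bsub>NA.T\<^esub> (?U \<ominus>\<^bsub>NA.T\<^esub> ?W))"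
      using xc b by (simp add: s_def N.ract_closed)
    \<comment> \<open>The term \<open>x b \<otimes> 1\<close> contributed by the connection cancels
      the leading term of \<open>s\<close>, leaving what right multiplication by \<open>b\<close>
      makes of \<open>s x\<close>.\<close>
    also have "\<dots> = ?W \<ominus>\<^bsub>NA.T\<^esub> ?V"
      by (rule NAT.minus_plus_minus) (fact UVW)+
    also have "\<dots> = ract BC (s x) b"
      using xc b cc[OF xc] by (simp add: s_def ahom_a_minus[OF NA.abelian NA.abelian BC_ract(1)[OF b]] npt_closed BC_ract)
    finally show "s (ract N x b) = ract BC (s x) b" .
  qed
  have sh: "s x \<in> hcomp NA.T i" if x: "x \<in> hcomp N i" for x i
    using NA.pt_mem[of x i "\<one>\<^bsub>B\<^esub>" 0] x B.one_hcomp collapse_mem[OF \<psi>h[OF x]] N.hcomp_closed[OF x]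
    by (simp add: s_def a_minus_def NAT.hcomp_add NAT.hcomp_inv)
  have sd: "s (diff N x) = diff NA.T (s x)" if x: "x \<in> carrier N" for x
  proof -
    have "diff NA.T (NA.pt x \<one>\<^bsub>B\<^esub>) = NA.pt (diff N x) \<one>\<^bsub>B\<^esub>"
    proof (rule N.graded_ahom_eqI[where f = "\<lambda>x. diff NA.T (NA.pt x \<one>\<^bsub>B\<^esub>)", OF ahom_comp[OF pa NAT.diff_hom] ahom_comp[OF N.diff_hom pa] x])
      fix i x assume x: "x \<in> hcomp N i"
      show "diff NA.T (NA.pt x \<one>\<^bsub>B\<^esub>) = NA.pt (diff N x) \<one>\<^bsub>B\<^esub>"
        using ahom_zero[OF B.abelian NA.abelian biadd_right[OF npt_biadd N.hcomp_closed[OF x]]]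
        by (simp add: diff_npt[OF x] B.diff_one NAT.ksign_zero npt_closed N.diff_closed N.hcomp_closed[OF x])
    qed
    then show ?thesis
      using x by (simp add: s_def N.diff_closed ahom_a_minus[OF NA.abelian NA.abelian NAT.diff_hom] npt_closed cc diff_collapse \<psi>c \<psi>d)
  qed
  have "ahom N BC = ahom N NA.T" by (rule ahom_struct_cong) (simp_all add: same_add_def)
  then have "s \<in> gr_hom B N BC 0"
    using sa sb sh ahom_closed[OF sa] s_def by (auto simp: gr_hom_def image_subset_iff)
  then have "s \<in> dg_hom B N BC" using sd by (simp add: dg_hom_def)
  moreover have "\<epsilon> (s x) = x" if x: "x \<in> carrier N" for x
  proof -
    have "\<epsilon> (s x) = x \<ominus>\<^bsub>N\<^esub> \<zero>\<^bsub>N\<^esub>"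
      using x by (simp add: s_def ahom_a_minus[OF NA.abelian N.abelian \<epsilon>_ahom] npt_closed cc \<epsilon>_npt \<epsilon>_collapse \<psi>c N.ract_one)
    then show ?thesis using x by (simp add: a_minus_def)
  qed
  ultimately show ?thesis by (auto simp: naively_liftable_def)
qed

lemma liftable_of_splits: "splits B (fundamental_sequence A B \<phi> N X) \<Longrightarrow> naively_liftable A B \<phi> N"
  using closed_conn_of_splits liftable_of_closed_conn by blast

end

section \<open>Transport of structure\<close>

text \<open>A copy of \<open>M\<close> on another type along an injection \<open>h\<close> with left
  inverse \<open>k\<close>; outside the image of \<open>h\<close> the operations are
  irrelevant.\<close>

definition transport :: "('m \<Rightarrow> 'n) \<Rightarrow> ('n \<Rightarrow> 'm) \<Rightarrow> ('s, 'm) dg_rmod \<Rightarrow> ('s, 'n) dg_rmod" where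
  "transport h k M = \<lparr>carrier = h ` carrier M, mult = undefined, one = undefined, zero = h \<zero>\<^bsub>M\<^esub>,
     add = (\<lambda>x y. h (k x \<oplus>\<^bsub>M\<^esub> k y)), hcomp = (\<lambda>n. h ` hcomp M n), diff = (\<lambda>x. h (diff M (k x))),
     ract = (\<lambda>x s. h (ract M (k x) s))\<rparr>"

lemma transport_simps [simp]:
  "carrier (transport h k M) = h ` carrier M" "zero (transport h k M) = h \<zero>\<^bsub>M\<^esub>"
  "add (transport h k M) = (\<lambda>x y. h (k x \<oplus>\<^bsub>M\<^esub> k y))" "hcomp (transport h k M) = (\<lambda>n. h ` hcomp M n)"
  "diff (transport h k M) = (\<lambda>x. h (diff M (k x)))" "ract (transport h k M) = (\<lambda>x s. h (ract M (k x) s))"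
  by (simp_all add: transport_def)

text \<open>The premise on \<open>S\<close> puts differentials of scalars into its carrier, so that
  the sign in the Leibniz rule can be moved through \<open>h\<close>.\<close>

lemma dg_module_transport:
  assumes M: "dg_module S M" and S: "\<And>j a. a \<in> hcomp S j \<Longrightarrow> diff S a \<in> carrier S"
    and kh: "\<And>x. k (h x) = x"
  shows "dg_module S (transport h k M)"
proof -
  interpret M: dg_module S M by fact
  let ?X = "transport h k M"
  have ab: "abelian_group ?X"
  proof (rule abelian_groupI)
    fix x assume "x \<in> carrier ?X"
    then obtain y where "y \<in> carrier M" "x = h y" by auto
    then show "\<exists>z\<in>carrier ?X. z \<oplus>\<^bsub>?X\<^esub> x = \<zero>\<^bsub>?X\<^esub>"
      by (intro bexI[of _ "h (\<ominus>\<^bsub>M\<^esub> y)"]) (auto simp: kh M.l_neg)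
  qed (auto simp: kh M.a_ac)
  have inv: "\<ominus>\<^bsub>?X\<^esub> h y = h (\<ominus>\<^bsub>M\<^esub> y)" if "y \<in> carrier M" for y
    using that by (intro abelian_group.minus_equality[OF ab]) (auto simp: kh M.l_neg)
  have ks: "ksign ?X i (h y) = h (ksign M i y)" if "y \<in> carrier M" for y i
    using that by (simp add: ksign_def inv)
  have gr: "graded_group ?X"
  proof (rule graded_groupI[OF ab ab, where p = "\<lambda>n x. h (hpart M n (k x))"])
    show "subgroup (hcomp ?X n) (add_monoid ?X)" for n
      by (rule subgroup_add_monoidI[OF ab])
        (auto simp: kh inv M.hcomp_closed M.hcomp_add M.hcomp_zero M.hcomp_inv)
    show "(\<lambda>x. h (hpart M n (k x))) \<in> ahom ?X ?X" for n
      by (rule ahomI) (auto simp: kh M.hpart_closed M.hpart_add)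
  next
    fix P x assume "x \<in> carrier ?X" "\<And>n x. x \<in> hcomp ?X n \<Longrightarrow> P x"
      and a: "\<And>x y. \<lbrakk>x \<in> carrier ?X; y \<in> carrier ?X; P x; P y\<rbrakk> \<Longrightarrow> P (x \<oplus>\<^bsub>?X\<^esub> y)"
    then obtain y where y: "y \<in> carrier M" "x = h y" by auto
    have "P (h y)" using y(1)
    proof (induction y rule: M.graded_induct)
      case (add u v)
      then show ?case using a[of "h u" "h v"] by (simp add: kh)
    qed (use \<open>\<And>n x. x \<in> hcomp ?X n \<Longrightarrow> P x\<close> in auto)
    then show "P x" using y by simp
  qed (auto simp: kh M.hpart_hcomp)
  have "diff ?X \<in> ahom ?X ?X" by (rule ahomI) (auto simp: kh M.diff_closed M.diff_add)
  then have dg: "dg_group_axioms ?X"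
    by (rule dg_group_axioms.intro) (auto simp: kh M.diff_hcomp M.diff_diff)
  have gm: "graded_module_axioms S ?X"
    by (rule graded_module_axioms.intro)
      (auto simp: kh M.ract_closed M.ract_add_left M.ract_add_right M.ract_mult M.ract_one M.ract_hcomp)
  have L: "dg_module_axioms S ?X"
  proof
    fix m i a j assume "m \<in> hcomp ?X i" and a: "a \<in> hcomp S j"
    then obtain y where y: "y \<in> hcomp M i" "m = h y" by auto
    have "ksign ?X i (h (ract M y (diff S a))) = h (ksign M i (ract M y (diff S a)))"
      by (rule ks[OF M.ract_closed[OF M.hcomp_closed[OF y(1)] S[OF a]]])
    then show "diff ?X (ract ?X m a) = ract ?X (diff ?X m) a \<oplus>\<^bsub>?X\<^esub> ksign ?X i (ract ?X m (diff S a))"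
      using y by (simp add: kh M.module_Leibniz[OF y(1) a])
  qed
  show ?thesis by (intro dg_module.intro graded_module.intro dg_group.intro gr dg gm L)
qed

section \<open>The equivalences\<close>

context dg_base
begin

lemma splits_of_liftable:
  assumes "naively_liftable A B \<phi> N" "dg_module Be X"
  shows "splits B (fundamental_sequence A B \<phi> N X)"
proof -
  interpret dg_bimodule R A B \<phi> N X
    by (intro dg_bimodule.intro dg_base_axioms assms(2))
  show ?thesis using assms(1) splits_of_section by (auto simp: naively_liftable_def)
qed

lemma admits_connection_iff_splits:
  assumes "dg_module Be X"
  shows "admits_connection A B \<phi> N X (carrier (star_Der A B \<phi> X)) \<longleftrightarrow> splits B (fundamental_sequence A B \<phi> N X)"
proof -
  interpret dg_bimodule R A B \<phi> N X
    by (intro dg_bimodule.intro dg_base_axioms assms)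
  show ?thesis by (rule admits_connection_iff_splits)
qed

lemma diag_copy_J: "diag_copy R A B \<phi> N J (\<lambda>x. x) (univ_derivation A B \<phi>)"
proof -
  interpret dg_bimodule R A B \<phi> N J
    by (intro dg_bimodule.intro dg_base_axioms J_dg_module)
  note univ_derivation_eq
  moreover have "(\<lambda>x. x) \<in> ahom J BB.T" by (rule ahomI) auto
  moreover have "restrict ud (carrier B) \<in> carrier B \<rightarrow>\<^sub>E carrier J"
    using ud_J by (auto simp del: J_simps)
  ultimately show ?thesis
    by unfold_locales auto
qed

text \<open>Provides a module isomorphic to \<open>J\<close> on the sum type over which the
  bimodules of the theorem range.\<close>

lemma diag_copy_Inr:
  "diag_copy R A B \<phi> N (transport Inr projr J) projr (\<lambda>b\<in>carrier B. Inr (ud b))"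
proof -
  let ?X = "transport Inr projr J"
  have X: "dg_module Be ?X"
    by (rule dg_module_transport[OF J_dg_module]) (auto intro: E.diff_closed E.hcomp_closed)
  interpret dg_bimodule R A B \<phi> N ?X
    by (intro dg_bimodule.intro dg_base_axioms X)
  have "projr \<in> ahom ?X BB.T" by (rule ahomI) auto
  moreover have "(\<lambda>b\<in>carrier B. Inr (ud b)) \<in> carrier B \<rightarrow>\<^sub>E carrier ?X"
    using ud_J by (auto simp del: J_simps)
  ultimately show ?thesis
    by unfold_locales (auto simp: inj_on_def)
qed

lemma liftable_iff_splits_J: "naively_liftable A B \<phi> N \<longleftrightarrow> splits B (fundamental_sequence A B \<phi> N J)"
  using splits_of_liftable[OF _ J_dg_module] diag_copy.liftable_of_splits[OF diag_copy_J] by blast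

lemma liftable_iff_closed_connection:
  "naively_liftable A B \<phi> N \<longleftrightarrow>
     (\<exists>\<psi>. is_connection A B \<phi> N J 0 (univ_derivation A B \<phi>) \<psi> \<and>
        diff (star_Conn A B \<phi> N J) (univ_derivation A B \<phi>, \<psi>) = \<zero>\<^bsub>star_Conn A B \<phi> N J\<^esub>)"
  using diag_copy.closed_conn_of_splits[OF diag_copy_J] diag_copy.liftable_of_closed_conn[OF diag_copy_J]
    liftable_iff_splits_J by blast

text \<open>The left summand \<open>'x\<close> is arbitrary, so the type leaves room for other
  modules, while the right summand guarantees a copy of \<open>J\<close>; splitting for that copy
  already forces liftability.\<close>

lemma liftable_iff_all_split:
  "naively_liftable A B \<phi> N \<longleftrightarrow>
     (\<forall>X :: (('b, 'b) tensor, 'x + ('b, 'b) tensor) dg_rmod.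
        dg_module Be X \<longrightarrow> splits B (fundamental_sequence A B \<phi> N X))"
proof
  assume all: "\<forall>X :: (('b, 'b) tensor, 'x + ('b, 'b) tensor) dg_rmod.
        dg_module Be X \<longrightarrow> splits B (fundamental_sequence A B \<phi> N X)"
  have "dg_module Be (transport (Inr :: _ \<Rightarrow> 'x + ('b, 'b) tensor) projr J)"
    by (rule dg_module_transport[OF J_dg_module]) (auto intro: E.diff_closed E.hcomp_closed)
  with all show "naively_liftable A B \<phi> N"
    using diag_copy.liftable_of_splits[OF diag_copy_Inr] by blast
qed (use splits_of_liftable in blast)

end

theorem theorem5p3:
  fixes R :: "'r ring"
    and A :: "('r, 'a) dg_alg" and B :: "('r, 'b) dg_alg" and \<phi> :: "'a \<Rightarrow> 'b"
    and N :: "('b, 'n) dg_rmod"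
  assumes "cring R"
    and "dg_algebra R A" and "dg_algebra R B" and "dg_algebra_hom R A B \<phi>"
    and "graded_projective A (restrict_scalars \<phi> (regular B))"
    and "dg_module B N" and "semifree B N"
  shows "(naively_liftable A B \<phi> N \<longleftrightarrow>
           (\<exists>\<psi>. is_connection A B \<phi> N (diag_ideal A B \<phi>) 0 (univ_derivation A B \<phi>) \<psi> \<and>
                 diff (star_Conn A B \<phi> N (diag_ideal A B \<phi>)) (univ_derivation A B \<phi>, \<psi>)
                   = \<zero>\<^bsub>star_Conn A B \<phi> N (diag_ideal A B \<phi>)\<^esub>)) \<and>
         (naively_liftable A B \<phi> N \<longleftrightarrow>
           splits B (fundamental_sequence A B \<phi> N (diag_ideal A B \<phi>))) \<and>
         (naively_liftable A B \<phi> N \<longleftrightarrow>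
           (\<forall>X :: (('b, 'b) tensor, 'x + ('b, 'b) tensor) dg_rmod.
              dg_module (enveloping A B \<phi>) X \<longrightarrow>
              splits B (fundamental_sequence A B \<phi> N X))) \<and>
         (naively_liftable A B \<phi> N \<longleftrightarrow>
           admits_connection A B \<phi> N (diag_ideal A B \<phi>)
             (carrier (star_Der A B \<phi> (diag_ideal A B \<phi>)))) \<and>
         (naively_liftable A B \<phi> N \<longleftrightarrow>
           (\<forall>X :: (('b, 'b) tensor, 'x + ('b, 'b) tensor) dg_rmod.
              dg_module (enveloping A B \<phi>) X \<longrightarrow>
              admits_connection A B \<phi> N X (carrier (star_Der A B \<phi> X))))"
proof -
  interpret dg_base R A B \<phi> N
    by (intro dg_base.intro dg_extension.intro dg_extension_axioms.intro dg_alg_module.intro assms)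
  \<comment> \<open>The two clauses on connections are the clauses on splittings rewritten, for
    \<open>J\<close> and for each \<open>X\<close> separately.\<close>
  show ?thesis
    using liftable_iff_closed_connection liftable_iff_splits_J liftable_iff_all_split[where 'x = 'x]
      admits_connection_iff_splits[OF J_dg_module] admits_connection_iff_splits
    by (simp only:) blast
qed

end
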